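(* Let $T_{cw,2}^{\boxtimes 2}\in \mathbb{C}^9\otimes\mathbb{C}^9\otimes\mathbb{C}^9$ be the Kronecker square of the small Coppersmith-Winograd tensor $T_{cw,2}\in\mathbb{C}^3\otimes\mathbb{C}^3\otimes\mathbb{C}^3$. Then its border rank satisfies $$\underline{\mathbf{R}}(T_{cw,2}^{\boxtimes 2})=16.$$
   Context: All vector spaces are over $\mathbb{C}$. A tensor in $A\otimes B\otimes C$ has rank one if it equals $a\otimes b\otimes c$ for some nonzero $a\in A$, $b\in B$, $c\in C$; the rank of $T$ is the smallest $r$ such that $T$ is a sum of $r$ rank one tensors; the border rank $\underline{\mathbf{R}}(T)$ is the smallest $r$ such that $T$ is a limit of tensors of rank at most $r$. With bases $a_0,\dots,a_q$; $b_0,\dots,b_q$; $c_0,\dots,c_q$ of three copies of $\mathbb{C}^{q+1}$, the small Coppersmith-Winograd tensor is $$T_{cw,q}=\sum_{j=1}^q \left(a_0\otimes b_j\otimes c_j+a_j\otimes b_0\otimes c_j+a_j\otimes b_j\otimes c_0\right).$$ For $T\in A\otimes B\otimes C$ and $T'\in A'\otimes B'\otimes C'$, the Kronecker product $T\boxtimes T'$ is $T\otimes T'$ regarded as a 3-way tensor in $(A\otimes A')\otimes(B\otimes B')\otimes(C\otimes C')$, and $T^{\boxtimes 2}=T\boxtimes T$. *)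

theory Defs
  imports "HOL-Analysis.Analysis"
begin

text \<open>
  The space \<open>A \<otimes> B \<otimes> C\<close> with \<open>A = \<complex>\<^sup>a\<close>, \<open>B = \<complex>\<^sup>b\<close>, \<open>C = \<complex>\<^sup>c\<close> is represented
  in coordinates: \<open>T $ i $ j $ k\<close> is the coefficient of \<open>T\<close> at the \<open>i\<close>-th, \<open>j\<close>-th and \<open>k\<close>-th
  standard basis vectors of \<open>A\<close>, \<open>B\<close> and \<open>C\<close>.
\<close>

type_synonym ('a, 'b, 'c) tensor = "(((complex, 'c) vec, 'b) vec, 'a) vec"

definition outer ::
  "(complex, 'a::finite) vec \<Rightarrow> (complex, 'b::finite) vec \<Rightarrow> (complex, 'c::finite) vec
    \<Rightarrow> ('a, 'b, 'c) tensor" where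
  "outer a b c = (\<chi> i j k. a $ i * b $ j * c $ k)"

definition rank_one :: "('a::finite, 'b::finite, 'c::finite) tensor \<Rightarrow> bool" where
  "rank_one T \<longleftrightarrow> (\<exists>a b c. a \<noteq> 0 \<and> b \<noteq> 0 \<and> c \<noteq> 0 \<and> T = outer a b c)"

definition tensor_rank :: "('a::finite, 'b::finite, 'c::finite) tensor \<Rightarrow> nat" where
  "tensor_rank T = (LEAST r. \<exists>f. (\<forall>s<r. rank_one (f s)) \<and> T = (\<Sum>s<r. f s))"

definition border_rank :: "('a::finite, 'b::finite, 'c::finite) tensor \<Rightarrow> nat" where
  "border_rank T = (LEAST r. \<exists>S. (\<forall>n. tensor_rank (S n) \<le> r) \<and> S \<longlonglongrightarrow> T)"

text \<open>
  The index type plays the role of \<open>{0, \<dots>, q}\<close>, so \<open>CARD('n) = q + 1\<close>; the vectors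
  \<open>a\<^sub>j\<close>, \<open>b\<^sub>j\<close>, \<open>c\<^sub>j\<close> are all the standard basis vector \<open>axis j 1\<close>.
\<close>

definition small_cw :: "('n::{finite,zero}, 'n, 'n) tensor" where
  "small_cw = (\<Sum>j\<in>UNIV - {0}.
      outer (axis 0 1) (axis j 1) (axis j 1)
    + outer (axis j 1) (axis 0 1) (axis j 1)
    + outer (axis j 1) (axis j 1) (axis 0 1))"

text \<open>
  The basis of \<open>A \<otimes> A'\<close> is indexed by pairs of indices, and likewise for the other two factors.
\<close>

definition kronecker ::
  "('a::finite, 'b::finite, 'c::finite) tensor \<Rightarrow> ('d::finite, 'e::finite, 'f::finite) tensor
    \<Rightarrow> ('a \<times> 'd, 'b \<times> 'e, 'c \<times> 'f) tensor" where
  "kronecker T T' = (\<chi> i j k. T $ fst i $ fst j $ fst k * T' $ snd i $ snd j $ snd k)"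

text \<open>The numeral type \<open>3\<close> has exactly the elements \<open>0\<close>, \<open>1\<close>, \<open>2\<close>, so this is the case \<open>q = 2\<close>.\<close>

abbreviation small_cw_2 :: "(3, 3, 3) tensor" where
  "small_cw_2 \<equiv> small_cw"

end

(*
  In suitable coordinates T_cw,2 is the sum of x_{s(0)} (x) x_{s(1)} (x) x_{s(2)} over all permutations s.
  Polarisation over the signs of x_0 + e_1 x_1 + e_2 x_2 writes it with 4 terms, hence its square with 16.
  The square is the sum of e_i (x) e_j (x) e_k over the triples of positions of a 3 by 3 square that lie in
  different rows and in different columns.

  Suppose that it is a limit of sums of 15 terms. Eliminating one term by substitution and degenerating along
  a torus shows that 8 of its 9 slices in the first factor are simultaneously a limit of sums
  a_s (x) b_s (x) c_s over s < 14. A Koszul flattening of these 8 slices has such a small kernel that every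
  limit of matrices in the span of the a_s (x) c_s lies in a small explicit space (ideal_space).
  The 9 slices in the second factor are such limits and there are at most 14 independent ones, so modulo the
  slices the limits have at most 5 leading weights for the torus; pass to a subsequence for which this set
  of weights is maximal. A combination of the a_s (x) c_s (x) c_s can be chosen to satisfy any 13 linear
  conditions; its normalised limit is a nonzero cubic form all of whose slices are again limits of this kind.
  With the 13 conditions adapted to the leading weights, the top homogeneous part of this form vanishes, a
  contradiction.
*)
theory Submission
  imports Defs
begin

section \<open>Linear systems and subsequences\<close>

text \<open>After projecting the first factor to dimension 5, the Koszul flattening acts on a space
  of dimension 10 * 9 = 90, and a rank one term adds at most 6 to its rank. Fifteen terms can fill
  all 90 dimensions, so the flattening alone cannot exclude them. Trading one term for one slice
  leaves at most 14 * 6 = 84, and the eight slices of the tensor reach exactly 84. In this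
  borderline case the 6-dimensional kernel belonging to the tensor annihilates every limit, not only
  the slices. Spread by the torus and the symmetries of the square, these equations cut the 8 by 9
  matrices down to dimension 23. The 9 slices are independent there, whence 23 - 9 = 14 functionals,
  and 14 - 9 = 5 bounds the leading weights. The limits need not form a torus-stable space, so only
  leading weights are under control. The third factor enters the cubic forms twice because
  coefficients multiplied by an entry of \<open>c\<close> are again admissible coefficients.
  Symmetry in the last two indices is then built in, and symmetry in the first two is inherited from
  \<open>ideal_space\<close>. Thirteen conditions are one fewer than the 14 coefficients.\<close>

lemma nontrivial_solution:
  fixes A :: "'m \<Rightarrow> 'i \<Rightarrow> 'a::field"
  assumes "finite M" "finite I" "card M < card I"
  shows "\<exists>x. (\<exists>i\<in>I. x i \<noteq> 0) \<and> (\<forall>m\<in>M. (\<Sum>i\<in>I. A m i * x i) = 0)"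
  using assms
proof (induction M arbitrary: I A rule: finite_induct)
  case empty
  then obtain i where "i \<in> I" by fastforce
  then show ?case by (intro exI[of _ "\<lambda>_. 1"]) auto
next
  case (insert m M)
  show ?case
  proof (cases "\<forall>i\<in>I. A m i = 0")
    case True
    have "card M < card I" using insert by simp
    from insert.IH[OF insert.prems(1) this, of A] obtain x where
      "\<exists>i\<in>I. x i \<noteq> 0" "\<forall>m\<in>M. (\<Sum>i\<in>I. A m i * x i) = 0" by blast
    with True show ?thesis by (intro exI[of _ x]) auto
  next
    case False
    then obtain p where p: "p \<in> I" "A m p \<noteq> 0" by blast
    define J where "J = I - {p}"
    have J: "finite J" "card M < card J" "I = insert p J" "p \<notin> J"
      using insert.prems insert.hyps p by (auto simp: J_def)
    \<comment> \<open>Gaussian elimination: the pivot equation \<open>m\<close> removes the unknown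
      \<open>p\<close> from every other equation.\<close>
    define B where "B = (\<lambda>l i. A l i - A l p * A m i / A m p)"
    from insert.IH[OF J(1,2), of B] obtain x where
      x: "\<exists>i\<in>J. x i \<noteq> 0" "\<forall>l\<in>M. (\<Sum>i\<in>J. B l i * x i) = 0" by blast
    define t where "t = (\<Sum>i\<in>J. A m i * x i)"
    define y where "y = (\<lambda>i. if i = p then - t / A m p else x i)"
    have yJ: "(\<Sum>i\<in>J. A l i * y i) = (\<Sum>i\<in>J. A l i * x i)" for l
      using J(4) by (intro sum.cong) (auto simp: y_def)
    have sumI: "(\<Sum>i\<in>I. A l i * y i) = A l p * y p + (\<Sum>i\<in>J. A l i * x i)" for l
      using J yJ[of l] by simp
    have "(\<Sum>i\<in>I. A m i * y i) = 0"
      unfolding sumI using p by (simp add: y_def t_def)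
    moreover have "(\<Sum>i\<in>I. A l i * y i) = 0" if "l \<in> M" for l
    proof -
      have "0 = (\<Sum>i\<in>J. B l i * x i)" using x that by simp
      also have "\<dots> = (\<Sum>i\<in>J. A l i * x i) - (\<Sum>i\<in>J. A l p / A m p * (A m i * x i))"
        by (simp add: B_def sum_subtractf[symmetric] algebra_simps)
      also have "\<dots> = (\<Sum>i\<in>J. A l i * x i) - A l p / A m p * t"
        by (simp add: t_def sum_distrib_left)
      finally show ?thesis unfolding sumI by (simp add: y_def)
    qed
    moreover have "\<exists>i\<in>I. y i \<noteq> 0" using x(1) J by (auto simp: y_def)
    ultimately show ?thesis by (intro exI[of _ y]) auto
  qed
qed

lemma bounded_subsequence:
  fixes f :: "nat \<Rightarrow> 'i \<Rightarrow> complex"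
  assumes "finite I" "\<And>n i. i \<in> I \<Longrightarrow> norm (f n i) \<le> B"
  shows "\<exists>r l. strict_mono r \<and> (\<forall>i\<in>I. (\<lambda>n. f (r n) i) \<longlonglongrightarrow> l i)"
  using assms
proof (induction I rule: finite_induct)
  case empty
  show ?case by (intro exI[of _ id]) (auto simp: strict_mono_def)
next
  case (insert p I)
  then obtain r l where r: "strict_mono r" "\<forall>i\<in>I. (\<lambda>n. f (r n) i) \<longlonglongrightarrow> l i" by blast
  have "bounded (range (\<lambda>n. f (r n) p))"
    using insert.prems by (intro boundedI[of _ B]) auto
  from bounded_imp_convergent_subsequence[OF this]
  obtain z s where s: "strict_mono s" "((\<lambda>n. f (r n) p) \<circ> s) \<longlonglongrightarrow> z" by metis
  have "(\<lambda>n. f (r (s n)) i) \<longlonglongrightarrow> (l(p := z)) i" if "i \<in> insert p I" for i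
  proof (cases "i = p")
    case True then show ?thesis using s by (simp add: o_def)
  next
    case False
    then have "(\<lambda>n. f (r n) i) \<longlonglongrightarrow> l i" using that r by simp
    from LIMSEQ_subseq_LIMSEQ[OF this s(1)] show ?thesis using False by (simp add: o_def)
  qed
  then show ?case using strict_mono_o[OF r(1) s(1)]
    by (intro exI[of _ "r \<circ> s"] exI[of _ "l(p := z)"]) (auto simp: o_def)
qed

text \<open>Scaling each \<open>f n\<close> to total norm 1 keeps the limit away from 0. This turns
  solutions of equations that vary with \<open>n\<close> into a nontrivial solution of the limiting
  equations.\<close>

lemma normalized_subsequence:
  fixes f :: "nat \<Rightarrow> 'i \<Rightarrow> complex"
  assumes "finite I" "\<And>n. \<exists>i\<in>I. f n i \<noteq> 0"
  shows "\<exists>r l t. strict_mono r \<and> (\<forall>i\<in>I. (\<lambda>n. t (r n) * f (r n) i) \<longlonglongrightarrow> l i) \<and> (\<exists>i\<in>I. l i \<noteq> 0)"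
proof -
  define N where "N = (\<lambda>n. \<Sum>i\<in>I. norm (f n i))"
  have Npos: "N n > 0" for n
    using assms unfolding N_def by (metis norm_ge_zero sum_pos2 zero_less_norm_iff)
  define t where "t = (\<lambda>n. complex_of_real (1 / N n))"
  have le: "norm (t n * f n i) \<le> 1" if "i \<in> I" for n i
  proof -
    have "norm (f n i) \<le> N n"
      unfolding N_def using that assms(1) by (intro member_le_sum) auto
    then show ?thesis using Npos[of n] by (simp add: t_def norm_mult norm_divide divide_simps)
  qed
  from bounded_subsequence[of I "\<lambda>n i. t n * f n i" 1, OF assms(1) le]
  obtain r l where rl: "strict_mono r" "\<forall>i\<in>I. (\<lambda>n. t (r n) * f (r n) i) \<longlonglongrightarrow> l i" by blast
  have "(\<Sum>i\<in>I. norm (t n * f n i)) = 1" for n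
  proof -
    have "(\<Sum>i\<in>I. norm (t n * f n i)) = (\<Sum>i\<in>I. norm (f n i) / N n)"
      using Npos[of n] by (intro sum.cong) (auto simp: t_def norm_mult norm_divide)
    also have "\<dots> = 1" using Npos[of n] by (simp add: sum_divide_distrib[symmetric] N_def)
    finally show ?thesis .
  qed
  moreover have "(\<lambda>n. \<Sum>i\<in>I. norm (t (r n) * f (r n) i)) \<longlonglongrightarrow> (\<Sum>i\<in>I. norm (l i))"
    using rl(2) by (intro tendsto_sum tendsto_norm) auto
  ultimately have "(\<Sum>i\<in>I. norm (l i)) = 1" by (simp add: LIMSEQ_const_iff)
  then have "\<exists>i\<in>I. l i \<noteq> 0" by (metis norm_zero sum.neutral zero_neq_one)
  with rl show ?thesis by blast
qed

section \<open>Koszul flattening\<close>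

text \<open>An alternating form is stored by its values at increasing triples; this recovers its
  value at arbitrary arguments.\<close>

definition alt3 :: "(nat \<Rightarrow> nat \<Rightarrow> nat \<Rightarrow> 'a::ab_group_add) \<Rightarrow> nat \<Rightarrow> nat \<Rightarrow> nat \<Rightarrow> 'a" where
  "alt3 f i j k =
    (if i < j \<and> j < k then f i j k else if j < k \<and> k < i then f j k i
     else if k < i \<and> i < j then f k i j else if i < k \<and> k < j then - f i k j
     else if j < i \<and> i < k then - f j i k else if k < j \<and> j < i then - f k j i else 0)"

lemma alt3_swap: "alt3 f j i k = - alt3 f i j k" "alt3 f i k j = - alt3 f i j k"
  by (auto simp: alt3_def)

lemma alt3_eq_0: "alt3 f i i k = 0" "alt3 f i k k = 0" "alt3 f i k i = 0"
  by (auto simp: alt3_def)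

text \<open>The index \<open>i < 9\<close> is the position in row \<open>i div 3\<close> and column \<open>i mod 3\<close> of a 3 by 3 square.\<close>

definition transversal :: "nat \<Rightarrow> nat \<Rightarrow> nat \<Rightarrow> bool" where
  "transversal i j k \<longleftrightarrow> i < 9 \<and> j < 9 \<and> k < 9 \<and> distinct [i div 3, j div 3, k div 3]
     \<and> distinct [i mod 3, j mod 3, k mod 3]"

definition perm3 :: "nat \<Rightarrow> nat \<Rightarrow> nat \<Rightarrow> complex" where
  "perm3 i j k = of_bool (transversal i j k)"

text \<open>The first index starts at 1: slice 0 is the price of eliminating the fifteenth
  term.\<close>

definition approx14 :: "(nat \<Rightarrow> nat \<Rightarrow> nat \<Rightarrow> complex) \<Rightarrow> (nat \<Rightarrow> nat \<Rightarrow> nat \<Rightarrow> complex)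
    \<Rightarrow> (nat \<Rightarrow> nat \<Rightarrow> nat \<Rightarrow> complex) \<Rightarrow> bool" where
  "approx14 a b c \<longleftrightarrow> (\<forall>i\<in>{1..8}. \<forall>j<9. \<forall>k<9.
     (\<lambda>n. \<Sum>s<14. a n s i * b n s j * c n s k) \<longlonglongrightarrow> perm3 i j k)"

text \<open>The coefficients \<open>lam\<close> may vary with \<open>n\<close> and may be unbounded;
  only the combined matrices have to converge.\<close>

definition limit_span :: "(nat \<Rightarrow> nat \<Rightarrow> nat \<Rightarrow> complex) \<Rightarrow> (nat \<Rightarrow> nat \<Rightarrow> nat \<Rightarrow> complex)
    \<Rightarrow> (nat \<Rightarrow> nat \<Rightarrow> complex) set" where
  "limit_span a c = {e. \<exists>lam. \<forall>i\<in>{1..8}. \<forall>k<9. (\<lambda>n. \<Sum>s<14. lam n s * a n s i * c n s k) \<longlonglongrightarrow> e i k}"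

text \<open>Adding up the coordinates in each block projects \<open>\<complex>\<^sup>8\<close> to \<open>\<complex>\<^sup>5\<close>. For this projection the Koszul flattening
  of the 8 slices has rank 84, the largest value possible for 14 terms, as each term contributes at most 6.\<close>

definition block :: "nat \<Rightarrow> nat" where
  "block i = [0, 0, 1, 2, 1, 3, 3, 4, 4] ! i"

text \<open>Coordinates of alternating 3-forms on the projected first factor with values in the dual
  of the third factor.\<close>

definition triples :: "(nat \<times> nat \<times> nat \<times> nat) set" where
  "triples = {(i, j, k, c). i < j \<and> j < k \<and> k < 5 \<and> c < 9}"

lemma triples_eq: "triples = set [(i, j, k, c). i \<leftarrow> [0..<5], j \<leftarrow> [0..<5], k \<leftarrow> [0..<5], c \<leftarrow> [0..<9], i < j \<and> j < k]"
  by (auto simp: triples_def split: if_splits)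

lemma finite_triples: "finite triples"
  unfolding triples_eq by simp

lemma card_triples: "card triples = 90"
  unfolding triples_eq by code_simp

lemma alt3_limit:
  fixes x :: "nat \<Rightarrow> nat \<times> nat \<times> nat \<times> nat \<Rightarrow> complex"
  assumes "\<And>q. q \<in> triples \<Longrightarrow> (\<lambda>n. x n q) \<longlonglongrightarrow> y q" "i < 5" "j < 5" "k < 5" "c < 9"
  shows "(\<lambda>n. alt3 (\<lambda>i j k. x n (i, j, k, c)) i j k) \<longlonglongrightarrow> alt3 (\<lambda>i j k. y (i, j, k, c)) i j k"
  using assms unfolding alt3_def by (auto intro!: tendsto_minus simp: triples_def)

lemma functional_expand:
  assumes "finite I" "\<And>c x y. F (\<lambda>i. x i + c * y i) = F x + c * F y" "\<And>i. i \<notin> I \<Longrightarrow> x i = (0::complex)"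
  shows "F x = (\<Sum>i\<in>I. F (\<lambda>j. of_bool (j = i)) * x i)"
proof -
  have F0: "F (\<lambda>i. 0) = 0"
    using assms(2)[where x="\<lambda>_. 0" and c=1 and y="\<lambda>_. 0"] by simp
  have "F (\<lambda>i. if i \<in> J then x i else 0) = (\<Sum>i\<in>J. F (\<lambda>j. of_bool (j = i)) * x i)" if "finite J" for J
    using that
  proof (induction J rule: finite_induct)
    case empty
    then show ?case by (simp add: F0)
  next
    case (insert p J)
    have "(\<lambda>i. if i \<in> insert p J then x i else 0)
        = (\<lambda>i. (if i \<in> J then x i else 0) + x p * of_bool (i = p))"
      using insert.hyps by auto
    then show ?case using insert assms(2) by simp
  qed
  moreover have "(\<lambda>i. if i \<in> I then x i else 0) = x"
    using assms(3) by auto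
  ultimately show ?thesis using assms(1) by metis
qed

lemma nontrivial_solution_functionals:
  fixes F :: "'m \<Rightarrow> ('i \<Rightarrow> complex) \<Rightarrow> complex"
  assumes "finite M" "finite I" "card M < card I"
    "\<And>m c x y. F m (\<lambda>i. x i + c * y i) = F m x + c * F m y"
  shows "\<exists>x. (\<forall>i. i \<notin> I \<longrightarrow> x i = 0) \<and> (\<exists>i\<in>I. x i \<noteq> 0) \<and> (\<forall>m\<in>M. F m x = 0)"
proof -
  from nontrivial_solution[OF assms(1-3), of "\<lambda>m i. F m (\<lambda>j. of_bool (j = i))"] obtain x where
    x: "\<exists>i\<in>I. x i \<noteq> 0" "\<forall>m\<in>M. (\<Sum>i\<in>I. F m (\<lambda>j. of_bool (j = i)) * x i) = 0" by blast
  define y where "y = (\<lambda>i. if i \<in> I then x i else 0)"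
  have "F m y = (\<Sum>i\<in>I. F m (\<lambda>j. of_bool (j = i)) * y i)" for m
    by (rule functional_expand) (use assms in \<open>auto simp: y_def\<close>)
  also have "\<dots> m = (\<Sum>i\<in>I. F m (\<lambda>j. of_bool (j = i)) * x i)" for m
    by (intro sum.cong) (auto simp: y_def)
  finally show ?thesis using x by (intro exI[of _ y]) (auto simp: y_def)
qed

text \<open>The transposed Koszul flattening: a form \<open>x\<close> absorbs a matrix
  \<open>e\<close> into its first argument and its dual value, and the arguments \<open>y\<close>,
  \<open>z\<close> remain open.\<close>

definition contract :: "(nat \<times> nat \<times> nat \<times> nat \<Rightarrow> complex) \<Rightarrow> nat \<Rightarrow> nat \<Rightarrow> (nat \<Rightarrow> nat \<Rightarrow> complex) \<Rightarrow> complex" where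
  "contract x y z e = (\<Sum>i=1..8. \<Sum>k<9. alt3 (\<lambda>i j l. x (i, j, l, k)) (block i) y z * e i k)"

lemma alt3_lin: "alt3 (\<lambda>i j l. x (i, j, l, k) + c * y (i, j, l, k)) p q r
    = alt3 (\<lambda>i j l. x (i, j, l, k)) p q r + (c::complex) * alt3 (\<lambda>i j l. y (i, j, l, k)) p q r"
  by (auto simp: alt3_def)

lemma contract_lin1: "contract (\<lambda>i. x i + c * x' i) y z e = contract x y z e + c * contract x' y z e"
  unfolding contract_def alt3_lin by (simp add: sum.distrib algebra_simps sum_distrib_left)

lemma contract_scale: "contract (\<lambda>i. c * x i) y z e = c * contract x y z e"
  using contract_lin1[of "\<lambda>_. 0" 1 "\<lambda>_. 0" y z e] contract_lin1[of "\<lambda>_. 0" c x y z e] by simp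

lemma contract_sum: "contract x y z (\<lambda>i k. \<Sum>s\<in>S. l s * e s i k) = (\<Sum>s\<in>S. l s * contract x y z (e s))"
proof -
  have "contract x y z (\<lambda>i k. \<Sum>s\<in>S. l s * e s i k) = (\<Sum>i=1..8. \<Sum>k<9. \<Sum>s\<in>S.
      l s * (alt3 (\<lambda>i j l. x (i, j, l, k)) (block i) y z * e s i k))"
    unfolding contract_def by (simp add: sum_distrib_left sum_distrib_right mult_ac)
  also have "\<dots> = (\<Sum>i=1..8. \<Sum>s\<in>S. \<Sum>k<9. l s * (alt3 (\<lambda>i j l. x (i, j, l, k)) (block i) y z * e s i k))"
    by (intro sum.cong refl sum.swap)
  also have "\<dots> = (\<Sum>s\<in>S. \<Sum>i=1..8. \<Sum>k<9. l s * (alt3 (\<lambda>i j l. x (i, j, l, k)) (block i) y z * e s i k))"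
    by (rule sum.swap)
  finally show ?thesis unfolding contract_def by (simp add: sum_distrib_left)
qed

lemma block_less: "i \<in> {1..8} \<Longrightarrow> block i < 5"
  by (auto simp: block_def numeral_eq_Suc less_Suc_eq_le le_Suc_eq)

lemma contract_swap: "contract x z y e = - contract x y z e"
  unfolding contract_def alt3_swap(2)[of _ _ z y] by (simp add: sum_negf)

lemma contract_same: "contract x y y e = 0"
  unfolding contract_def by (simp add: alt3_eq_0)

text \<open>The alternating form vanishes twice on the first factor of a rank one matrix, so by Cramer's rule
  its contraction with the matrix is determined by the six pairs avoiding a nonzero coordinate.\<close>
lemma contract_rank_one_eq_0:
  fixes x u v
  defines "e \<equiv> (\<lambda>i k. u i * v k)"
  defines "p \<equiv> (\<lambda>m. \<Sum>i\<in>{i\<in>{1..8}. block i = m}. u i)"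
  assumes m: "(\<forall>m<5. p m = 0) \<or> (m < 5 \<and> p m \<noteq> 0)"
    and 0: "\<And>y z. y < z \<Longrightarrow> z < 5 \<Longrightarrow> y \<noteq> m \<Longrightarrow> z \<noteq> m \<Longrightarrow> contract x y z e = 0"
    and yz: "y < 5" "z < 5"
  shows "contract x y z e = 0"
proof -
  define g where "g = (\<lambda>m y z. \<Sum>k<9. alt3 (\<lambda>i j l. x (i, j, l, k)) m y z * v k)"
  have h: "contract x y z e = (\<Sum>m<5. p m * g m y z)" for y z
  proof -
    have "contract x y z e = (\<Sum>i=1..8. u i * g (block i) y z)"
      unfolding contract_def e_def g_def by (simp add: sum_distrib_left mult_ac)
    also have "\<dots> = (\<Sum>m<5. \<Sum>i\<in>{i\<in>{1..8}. block i = m}. u i * g (block i) y z)"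
      by (rule sum.group[symmetric]) (use block_less in auto)
    also have "\<dots> = (\<Sum>m<5. p m * g m y z)"
      unfolding p_def sum_distrib_right by (intro sum.cong refl) auto
    finally show ?thesis .
  qed
  have g_swap: "g i j z = - g j i z" for i j z
    unfolding g_def alt3_swap(1)[of _ i j] by (simp add: sum_negf)
  \<comment> \<open>Here \<open>p\<close>, the projection of \<open>u\<close>, is inserted into two
    arguments of an alternating form; \<open>skew\<close> shows that the result vanishes.\<close>
  have twice: "(\<Sum>y<5. p y * contract x y z e) = (\<Sum>y<5. \<Sum>m<5. p y * p m * g m y z)" for z
    unfolding h by (simp add: sum_distrib_left mult_ac)
  have skew: "(\<Sum>y<5. \<Sum>m<5. p y * p m * g m y z) = - (\<Sum>y<5. \<Sum>m<5. p y * p m * g m y z)" for z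
  proof -
    have "(\<Sum>y<5. \<Sum>m<5. p y * p m * g m y z) = (\<Sum>m<5. \<Sum>y<5. p y * p m * g m y z)"
      by (rule sum.swap)
    also have "\<dots> = (\<Sum>m<5. \<Sum>y<5. - (p m * p y * g y m z))"
      by (intro sum.cong refl) (subst g_swap, simp)
    finally show ?thesis by (simp add: sum_negf)
  qed
  have rel: "(\<Sum>y<5. p y * contract x y z e) = 0" for z
    unfolding twice using skew[of z] by (simp add: complex_eq_iff)
  have 1: "contract x y z e = 0" if "y < 5" "z < 5" "y \<noteq> m" "z \<noteq> m" for y z
    using 0[of y z] 0[of z y] contract_swap[of x y z e] contract_same[of x y e] that
    by (cases y z rule: linorder_cases) auto
  show ?thesis using m
  proof
    assume "\<forall>m<5. p m = 0"
    then show ?thesis unfolding h by simp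
  next
    assume m: "m < 5 \<and> p m \<noteq> 0"
    have 2: "contract x m z e = 0" if "z < 5" for z
    proof (cases "z = m")
      case False
      have "0 = (\<Sum>y\<in>{m}. p y * contract x y z e)"
        unfolding rel[of z, symmetric]
        by (rule sum.mono_neutral_right) (use 1 False that m in auto)
      then show ?thesis using m by simp
    qed (simp add: contract_same)
    show ?thesis using 1 2 yz contract_swap[of x y z e] by (cases "y = m"; cases "z = m") auto
  qed
qed

lemma card_pairs: "card {(y, z). y < z \<and> z < (5::nat) \<and> y \<noteq> m \<and> z \<noteq> m} = 6" if "m < 5"
proof -
  have "{(y, z). y < z \<and> z < (5::nat) \<and> y \<noteq> m \<and> z \<noteq> m}
      = set [(y, z). y \<leftarrow> [0..<5], z \<leftarrow> [0..<5], y < z \<and> y \<noteq> m \<and> z \<noteq> m]"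
    by (auto split: if_splits)
  moreover have "\<forall>m\<in>set [0..<5]. card (set [(y, z). y \<leftarrow> [0..<5], z \<leftarrow> [0..<5], y < z \<and> y \<noteq> m \<and> z \<noteq> m]) = 6"
    by code_simp
  ultimately show ?thesis using that by simp
qed

text \<open>For each \<open>n\<close> there are 14 * 6 = 84 equations from the terms and at most 5
  from \<open>Z\<close>, fewer than the 90 unknowns; a normalised limit of solutions annihilates all
  limits. The freedom in \<open>Z\<close> replaces a limit of 6-dimensional kernels: it later forces
  five of the six free coordinates to vanish and so isolates one kernel element at a time.\<close>

lemma koszul_limit:
  assumes appr: "approx14 a b c" and e: "e \<in> limit_span a c"
    and Z: "finite Z" "card Z \<le> 5" "Z \<subseteq> triples"
  shows "\<exists>x. (\<exists>q\<in>triples. x q \<noteq> 0) \<and> (\<forall>q\<in>Z. x q = 0) \<and>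
    (\<forall>y<5. \<forall>z<5. contract x y z e = 0 \<and> (\<forall>j<9. contract x y z (\<lambda>i k. perm3 i j k) = 0))"
proof -
  define p where "p = (\<lambda>n s m. \<Sum>i\<in>{i\<in>{1..8}. block i = m}. a n s i)"
  have "\<exists>m. \<forall>n s. m n s < (5::nat) \<and> ((\<forall>l<5. p n s l = 0) \<or> p n s (m n s) \<noteq> 0)"
  proof -
    have "\<exists>l. l < (5::nat) \<and> ((\<forall>l<5. p n s l = 0) \<or> p n s l \<noteq> 0)" for n s
    proof (cases "\<forall>l<5. p n s l = 0")
      case True
      \<comment> \<open>If the projected vector is 0, all its contractions vanish, so any index may
        be recorded.\<close>
      then show ?thesis by (intro exI[of _ 0]) simp
    qed auto
    then show ?thesis by metis
  qed
  then obtain m where m: "\<And>n s. m n s < (5::nat)" "\<And>n s. (\<forall>l<5. p n s l = 0) \<or> p n s (m n s) \<noteq> 0"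
    by blast
  have "\<forall>n. \<exists>x. (\<exists>q\<in>triples. x q \<noteq> 0) \<and> (\<forall>q\<in>Z. x q = 0) \<and>
    (\<forall>s<14. \<forall>y<5. \<forall>z<5. contract x y z (\<lambda>i k. a n s i * c n s k) = 0)"
  proof
    fix n
    define R where "R = (SIGMA s:{..<14::nat}. {(y, z). y < z \<and> z < (5::nat) \<and> y \<noteq> m n s \<and> z \<noteq> m n s})"
    define M where "M = Z <+> R"
    define F where "F = (\<lambda>m' x. case m' of Inl q \<Rightarrow> x q
      | Inr (s, y, z) \<Rightarrow> contract x y z (\<lambda>i k. a n s i * c n s k))"
    have fin: "finite {(y, z). y < z \<and> z < (5::nat) \<and> y \<noteq> m n s \<and> z \<noteq> m n s}" for s
      by (rule finite_subset[of _ "{..<5} \<times> {..<5}"]) auto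
    have R: "finite R" "card R = 84"
      unfolding R_def using fin by (auto simp: card_SigmaI card_pairs[OF m(1)])
    then have "card M \<le> 5 + 84"
      unfolding M_def using Z by (simp add: card_Plus)
    then have card: "card M < card triples" by (simp add: card_triples)
    have "finite M" unfolding M_def using Z(1) R by simp
    moreover have "F m' (\<lambda>i. x i + c' * y i) = F m' x + c' * F m' y" for m' c' x y
      by (auto simp: F_def contract_lin1 split: sum.splits)
    ultimately obtain x where x: "\<exists>q\<in>triples. x q \<noteq> 0" "\<forall>m'\<in>M. F m' x = 0"
      using nontrivial_solution_functionals[OF _ finite_triples card, of F] by blast
    have "contract x y z (\<lambda>i k. a n s i * c n s k) = 0" if "s < 14" "y < 5" "z < 5" for s y z
    proof (rule contract_rank_one_eq_0)
      show "(\<forall>l<5. (\<Sum>i\<in>{i\<in>{1..8}. block i = l}. a n s i) = 0) \<or> (m n s < 5 \<and> (\<Sum>i\<in>{i\<in>{1..8}. block i = m n s}. a n s i) \<noteq> 0)"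
        using m unfolding p_def by blast
      fix y z assume yz: "y < z" "z < 5" "y \<noteq> m n s" "z \<noteq> m n s"
      have "Inr (s, y, z) \<in> M" unfolding M_def R_def using yz that by auto
      with x(2) have "F (Inr (s, y, z)) x = 0" by blast
      then show "contract x y z (\<lambda>i k. a n s i * c n s k) = 0" by (simp add: F_def)
    qed (use that in auto)
    moreover have "x q = 0" if "q \<in> Z" for q
    proof -
      have "Inl q \<in> M" using that by (simp add: M_def InlI)
      with x(2) have "F (Inl q) x = 0" by blast
      then show ?thesis by (simp add: F_def)
    qed
    ultimately show "\<exists>x. (\<exists>q\<in>triples. x q \<noteq> 0) \<and> (\<forall>q\<in>Z. x q = 0) \<and>
      (\<forall>s<14. \<forall>y<5. \<forall>z<5. contract x y z (\<lambda>i k. a n s i * c n s k) = 0)"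
      using x(1) by (intro exI[of _ x]) auto
  qed
  from choice[OF this] obtain x where x: "\<And>n. \<exists>q\<in>triples. x n q \<noteq> 0" "\<And>n q. q \<in> Z \<Longrightarrow> x n q = 0"
    "\<And>n s y z. s < 14 \<Longrightarrow> y < 5 \<Longrightarrow> z < 5 \<Longrightarrow> contract (x n) y z (\<lambda>i k. a n s i * c n s k) = 0"
    by blast
  from normalized_subsequence[of triples x, OF finite_triples x(1)] obtain r w t where
    w: "strict_mono r" "\<forall>q\<in>triples. (\<lambda>n. t (r n) * x (r n) q) \<longlonglongrightarrow> w q" "\<exists>q\<in>triples. w q \<noteq> 0" by blast
  define x' where "x' = (\<lambda>n q. t (r n) * x (r n) q)"
  have x': "contract (x' n) y z (\<lambda>i k. a (r n) s i * c (r n) s k) = 0" if "s < 14" "y < 5" "z < 5" for n s y z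
    using x(3)[OF that, of "r n"] unfolding x'_def contract_scale by simp
  \<comment> \<open>Stated for arbitrary coefficients, since it is applied both to \<open>e\<close>
    and to the slices, whose coefficients are the entries of \<open>b\<close>.\<close>
  have lim: "contract w y z e' = 0"
    if e': "\<And>i k. i \<in> {1..8} \<Longrightarrow> k < 9 \<Longrightarrow> (\<lambda>n. \<Sum>s<14. lam n s * (a n s i * c n s k)) \<longlonglongrightarrow> e' i k"
      and yz: "y < 5" "z < 5" for lam e' y z
  proof -
    define e2 where "e2 = (\<lambda>n i k. \<Sum>s<14. lam (r n) s * (a (r n) s i * c (r n) s k))"
    have 0: "contract (x' n) y z (e2 n) = 0" for n
      unfolding e2_def contract_sum using x'[OF _ yz] by simp
    have "(\<lambda>n. contract (x' n) y z (e2 n)) \<longlonglongrightarrow> contract w y z e'"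
      unfolding contract_def
    proof (intro tendsto_sum tendsto_mult)
      fix i k :: nat assume ik: "i \<in> {1..8}" "k \<in> {..<9}"
      show "(\<lambda>n. alt3 (\<lambda>i j l. x' n (i, j, l, k)) (block i) y z) \<longlonglongrightarrow> alt3 (\<lambda>i j l. w (i, j, l, k)) (block i) y z"
        by (rule alt3_limit) (use w(2) yz ik block_less in \<open>auto simp: x'_def\<close>)
      show "(\<lambda>n. e2 n i k) \<longlonglongrightarrow> e' i k"
        using LIMSEQ_subseq_LIMSEQ[OF e'[of i k] w(1)] ik unfolding e2_def by (simp add: o_def)
    qed
    then show ?thesis unfolding 0 by (simp add: LIMSEQ_const_iff)
  qed
  from e obtain lam where "\<And>i k. i \<in> {1..8} \<Longrightarrow> k < 9 \<Longrightarrow> (\<lambda>n. \<Sum>s<14. lam n s * a n s i * c n s k) \<longlonglongrightarrow> e i k"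
    unfolding limit_span_def by blast
  then have "contract w y z e = 0" if "y < 5" "z < 5" for y z
    by (intro lim[of lam]) (use that in \<open>simp_all add: mult.assoc\<close>)
  moreover have "contract w y z (\<lambda>i k. perm3 i j k) = 0" if "y < 5" "z < 5" "j < 9" for y z j
    by (rule lim[of "\<lambda>n s. b n s j"])
      (use appr that in \<open>simp_all add: approx14_def mult_ac\<close>)
  moreover have "w q = 0" if "q \<in> Z" for q
  proof -
    have "(\<lambda>n. t (r n) * x (r n) q) \<longlonglongrightarrow> w q" using w(2) that Z(3) by blast
    then show ?thesis using x(2)[OF that] by (simp add: LIMSEQ_const_iff)
  qed
  ultimately show ?thesis using w(3) by (intro exI[of _ w]) blast
qed

section \<open>The Koszul kernel of the tensor\<close>

lemma sum_1_8: "(\<Sum>i=1..8. f i) = f 1 + f 2 + f 3 + f 4 + f 5 + f 6 + f 7 + (f 8 :: complex)" for f :: "nat \<Rightarrow> complex"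
  by (simp add: numeral_eq_Suc)

lemma sum_less_9: "(\<Sum>i<9. f i) = f 0 + f 1 + f 2 + f 3 + f 4 + f 5 + f 6 + f 7 + (f 8 :: complex)" for f :: "nat \<Rightarrow> complex"
  by (simp add: numeral_eq_Suc)

lemma block_simps: "block 1 = 0" "block 2 = 1" "block 3 = 2" "block 4 = 1" "block 5 = 3"
  "block 6 = 3" "block 7 = 4" "block 8 = 4"
  by (simp_all add: block_def)

lemma upt_5: "[0..<5] = [0, 1, 2, 3, 4]" and upt_9: "[0..<9] = [0, 1, 2, 3, 4, 5, 6, 7, 8]"
  by code_simp+

lemmas contract_eval = contract_def sum_1_8 sum_less_9 block_simps perm3_def transversal_def alt3_def

text \<open>The kernel has dimension 6. Five elements come from 4-forms on the projected space, with
  the column index also sent through \<open>block\<close> and column 0 sent to 0: these kill every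
  symmetric matrix. The sixth is \<open>(e0 + e1) \<and> e2 \<and> e4\<close> (dual basis, wedge
  product) times column 5 minus column 4: for the tensor this column difference is projected into
  the span of the basis vector of block 3 and the difference of those of blocks 0 and 1. The
  hypotheses \<open>z\<close> remove four of the 4-forms; the survivors are the 4-form on blocks 0
  to 3 and the sixth element. Each of the 84 equations used settles one further coordinate.\<close>

lemma koszul_kernel:
  assumes "\<forall>y<5. \<forall>z<5. \<forall>j<9. contract w y z (\<lambda>i k. perm3 i j k) = 0"
    and z: "w (1, 2, 4, 1) = 0" "w (1, 3, 4, 1) = 0" "w (2, 3, 4, 1) = 0" "w (2, 3, 4, 4) = 0"
    and q: "q \<in> triples"
  shows "w q =
    (if q \<in> {(1,2,3,1), (0,1,3,3)} then w (1,2,3,1)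
     else if q \<in> {(0,1,2,5), (0,1,2,6), (0,2,3,2), (0,2,3,4)} then - w (1,2,3,1)
     else if q \<in> {(1,2,4,5), (0,2,4,5)} then w (1,2,4,5)
     else if q \<in> {(1,2,4,4), (0,2,4,4)} then - w (1,2,4,5) else 0)"
proof -
  note eq = assms(1)[rule_format]
  have k0: "w (0, 1, 3, 1) = 0" using eq[of 0 1 6] by (simp del: One_nat_def add: contract_eval)
  have k1: "w (0, 1, 2, 1) = 0" using eq[of 0 1 8] by (simp del: One_nat_def add: contract_eval)
  have k2: "w (0, 1, 2, 0) = 0" using eq[of 0 2 8] by (simp del: One_nat_def add: contract_eval)
  have k3: "w (0, 3, 4, 0) = 0" using eq[of 0 3 5] by (simp del: One_nat_def add: contract_eval)
  have k4: "w (0, 1, 4, 7) = 0" using eq[of 0 4 3] by (simp del: One_nat_def add: contract_eval)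
  have k5: "w (0, 3, 4, 1) = 0" using eq[of 0 4 5] by (simp del: One_nat_def add: contract_eval)
  have k6: "w (0, 1, 2, 5) = - w (1, 2, 3, 1)" using eq[of 1 2 6] by (simp del: One_nat_def add: contract_eval eq_neg_iff_add_eq_0 add_ac)
  have k7: "w (1, 2, 3, 0) = 0" using eq[of 1 2 7] by (simp del: One_nat_def add: contract_eval)
  have k8: "w (0, 1, 2, 3) = 0" using eq[of 1 2 8] by (simp del: One_nat_def add: contract_eval)
  have k9: "w (1, 3, 4, 0) = 0" using eq[of 1 3 4] by (simp del: One_nat_def add: contract_eval)
  have k10: "w (0, 1, 3, 6) = 0" using eq[of 1 3 5] by (simp del: One_nat_def add: contract_eval k9)
  have k11: "w (0, 1, 3, 5) = 0" using eq[of 1 3 6] by (simp del: One_nat_def add: contract_eval)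
  have k12: "w (1, 2, 3, 2) = 0" using eq[of 1 3 7] by (simp del: One_nat_def add: contract_eval)
  have k13: "w (0, 1, 3, 3) = w (1, 2, 3, 1)" using eq[of 1 3 8] by (simp del: One_nat_def add: contract_eval eq_neg_iff_add_eq_0 add_ac)
  have k14: "w (1, 3, 4, 7) = 0" using eq[of 1 4 0] by (simp del: One_nat_def add: contract_eval)
  have k15: "w (0, 1, 4, 8) = 0" using eq[of 1 4 3] by (simp del: One_nat_def add: contract_eval)
  have k16: "w (1, 3, 4, 2) = 0" using eq[of 1 4 4] by (simp del: One_nat_def add: contract_eval)
  have k17: "w (0, 1, 4, 6) = 0" using eq[of 1 4 5] by (simp del: One_nat_def add: contract_eval z(2))
  have k18: "w (0, 1, 4, 5) = 0" using eq[of 1 4 6] by (simp del: One_nat_def add: contract_eval z(2))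
  have k19: "w (1, 2, 4, 2) = 0" using eq[of 1 4 7] by (simp del: One_nat_def add: contract_eval k9)
  have k20: "w (0, 1, 4, 3) = 0" using eq[of 1 4 8] by (simp del: One_nat_def add: contract_eval z(1))
  have k21: "w (2, 3, 4, 3) = 0" using eq[of 2 3 1] by (simp del: One_nat_def add: contract_eval)
  have k22: "w (1, 2, 3, 6) = 0" using eq[of 2 3 2] by (simp del: One_nat_def add: contract_eval k21)
  have k23: "w (2, 3, 4, 0) = 0" using eq[of 2 3 4] by (simp del: One_nat_def add: contract_eval k22)
  have k24: "w (0, 2, 3, 6) = 0" using eq[of 2 3 5] by (simp del: One_nat_def add: contract_eval k23)
  have k25: "w (1, 2, 3, 3) = 0" using eq[of 2 3 7] by (simp del: One_nat_def add: contract_eval)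
  have k26: "w (0, 2, 3, 3) = 0" using eq[of 2 3 8] by (simp del: One_nat_def add: contract_eval k7)
  have k27: "w (1, 2, 4, 6) = 0" using eq[of 2 4 2] by (simp del: One_nat_def add: contract_eval z(4))
  have k28: "w (2, 3, 4, 2) = 0" using eq[of 2 4 4] by (simp del: One_nat_def add: contract_eval k27)
  have k29: "w (0, 2, 4, 6) = 0" using eq[of 2 4 5] by (simp del: One_nat_def add: contract_eval z(3))
  have k30: "w (1, 2, 4, 3) = 0" using eq[of 2 4 7] by (simp del: One_nat_def add: contract_eval k23)
  have k31: "w (1, 3, 4, 8) = 0" using eq[of 3 4 0] by (simp del: One_nat_def add: contract_eval)
  have k32: "w (2, 3, 4, 8) = 0" using eq[of 3 4 1] by (simp del: One_nat_def add: contract_eval)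
  have k33: "w (0, 3, 4, 8) = 0" using eq[of 3 4 3] by (simp del: One_nat_def add: contract_eval k14)
  have k34: "w (1, 3, 4, 6) = 0" using eq[of 3 4 4] by (simp del: One_nat_def add: contract_eval)
  have k35: "w (0, 3, 4, 6) = 0" using eq[of 3 4 5] by (simp del: One_nat_def add: contract_eval)
  have k36: "w (1, 3, 4, 3) = 0" using eq[of 3 4 7] by (simp del: One_nat_def add: contract_eval k28)
  have k37: "w (0, 3, 4, 3) = 0" using eq[of 3 4 8] by (simp del: One_nat_def add: contract_eval z(3) k9)
  have k38: "w (0, 1, 2, 8) = 0" using eq[of 0 1 1] by (simp del: One_nat_def add: contract_eval k10 k11 k20)
  have k39: "w (0, 1, 4, 0) = 0" using eq[of 0 1 5] by (simp del: One_nat_def add: contract_eval k0)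
  have k40: "w (0, 2, 3, 0) = 0" using eq[of 0 2 7] by (simp del: One_nat_def add: contract_eval k8)
  have k41: "w (0, 2, 3, 8) = 0" using eq[of 0 3 1] by (simp del: One_nat_def add: contract_eval k37)
  have k42: "w (0, 2, 3, 7) = 0" using eq[of 0 3 2] by (simp del: One_nat_def add: contract_eval k10 k37)
  have k43: "w (0, 2, 3, 2) = - w (1, 2, 3, 1)" using eq[of 0 3 7] by (simp del: One_nat_def add: contract_eval k13 eq_neg_iff_add_eq_0 add_ac)
  have k44: "w (0, 3, 4, 7) = 0" using eq[of 0 4 0] by (simp del: One_nat_def add: contract_eval k15)
  have k45: "w (0, 3, 4, 2) = 0" using eq[of 0 4 4] by (simp del: One_nat_def add: contract_eval k17)
  have k46: "w (0, 2, 4, 2) = 0" using eq[of 0 4 7] by (simp del: One_nat_def add: contract_eval k20 k3)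
  have k47: "w (0, 2, 4, 1) = 0" using eq[of 0 4 8] by (simp del: One_nat_def add: contract_eval k39)
  have k48: "w (1, 2, 3, 5) = 0" using eq[of 1 2 1] by (simp del: One_nat_def add: contract_eval k22 k30)
  have k49: "w (1, 2, 3, 4) = 0" using eq[of 1 2 2] by (simp del: One_nat_def add: contract_eval k30)
  have k50: "w (1, 2, 4, 0) = 0" using eq[of 1 2 4] by (simp del: One_nat_def add: contract_eval k12)
  have k51: "w (0, 1, 2, 6) = - w (1, 2, 3, 1)" using eq[of 1 2 5] by (simp del: One_nat_def add: contract_eval k50 eq_neg_iff_add_eq_0 add_ac)
  have k52: "w (1, 2, 3, 8) = 0" using eq[of 1 3 1] by (simp del: One_nat_def add: contract_eval k36)
  have k53: "w (1, 2, 3, 7) = 0" using eq[of 1 3 2] by (simp del: One_nat_def add: contract_eval k36)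
  have k54: "w (0, 1, 3, 8) = 0" using eq[of 1 3 3] by (simp del: One_nat_def add: contract_eval k16 z(2))
  have k55: "w (2, 3, 4, 5) = 0" using eq[of 2 3 0] by (simp del: One_nat_def add: contract_eval k52 z(4))
  have k56: "w (0, 2, 3, 5) = 0" using eq[of 2 3 6] by (simp del: One_nat_def add: contract_eval k49 k12)
  have k57: "w (2, 3, 4, 6) = 0" using eq[of 2 4 1] by (simp del: One_nat_def add: contract_eval k55)
  have k58: "w (0, 2, 4, 3) = 0" using eq[of 2 4 8] by (simp del: One_nat_def add: contract_eval k50)
  have k59: "w (2, 3, 4, 7) = 0" using eq[of 3 4 2] by (simp del: One_nat_def add: contract_eval k34)
  have k60: "w (0, 1, 3, 2) = 0" using eq[of 0 1 4] by (simp del: One_nat_def add: contract_eval k39)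
  have k61: "w (0, 2, 3, 4) = - w (1, 2, 3, 1)" using eq[of 0 2 2] by (simp del: One_nat_def add: contract_eval k51 k58 eq_neg_iff_add_eq_0 add_ac)
  have k62: "w (0, 1, 2, 7) = 0" using eq[of 0 2 3] by (simp del: One_nat_def add: contract_eval k46 k47)
  have k63: "w (0, 2, 4, 0) = 0" using eq[of 0 2 4] by (simp del: One_nat_def add: contract_eval k51 k43)
  have k64: "w (0, 2, 3, 1) = 0" using eq[of 0 2 5] by (simp del: One_nat_def add: contract_eval k63)
  have k65: "w (0, 1, 3, 7) = 0" using eq[of 0 3 3] by (simp del: One_nat_def add: contract_eval k45 k5)
  have k66: "w (0, 1, 3, 4) = 0" using eq[of 0 3 6] by (simp del: One_nat_def add: contract_eval k60)
  have k67: "w (0, 1, 3, 0) = 0" using eq[of 0 3 8] by (simp del: One_nat_def add: contract_eval k64)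
  have k68: "w (1, 2, 4, 4) = - w (1, 2, 4, 5)" using eq[of 1 2 0] by (simp del: One_nat_def add: contract_eval k53 eq_neg_iff_add_eq_0 add_ac)
  have k69: "w (1, 2, 4, 8) = 0" using eq[of 2 4 0] by (simp del: One_nat_def add: contract_eval k59)
  have k70: "w (0, 2, 4, 5) = w (1, 2, 4, 5)" using eq[of 2 4 6] by (simp del: One_nat_def add: contract_eval k68 k19 z(3) eq_neg_iff_add_eq_0 add_ac)
  have k71: "w (0, 1, 4, 4) = 0" using eq[of 0 1 0] by (simp del: One_nat_def add: contract_eval k65 k18)
  have k72: "w (0, 1, 2, 2) = 0" using eq[of 0 1 7] by (simp del: One_nat_def add: contract_eval k67)
  have k73: "w (0, 2, 4, 4) = - w (1, 2, 4, 5)" using eq[of 0 2 0] by (simp del: One_nat_def add: contract_eval k38 k42 k70 eq_neg_iff_add_eq_0 add_ac)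
  have k74: "w (0, 1, 2, 4) = 0" using eq[of 0 2 6] by (simp del: One_nat_def add: contract_eval k72 k64)
  have k75: "w (0, 1, 4, 2) = 0" using eq[of 0 4 6] by (simp del: One_nat_def add: contract_eval k71 k5)
  have k76: "w (1, 3, 4, 5) = 0" using eq[of 1 4 1] by (simp del: One_nat_def add: contract_eval k69 k34)
  have k77: "w (0, 1, 4, 1) = 0" using eq[of 0 1 3] by (simp del: One_nat_def add: contract_eval k75)
  have k78: "w (1, 3, 4, 4) = 0" using eq[of 1 3 0] by (simp del: One_nat_def add: contract_eval k76)
  have k79: "w (1, 2, 4, 7) = 0" using eq[of 1 4 2] by (simp del: One_nat_def add: contract_eval k78)
  have k80: "w (0, 2, 4, 8) = 0" using eq[of 2 4 3] by (simp del: One_nat_def add: contract_eval k79)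
  have k81: "w (0, 3, 4, 5) = 0" using eq[of 3 4 6] by (simp del: One_nat_def add: contract_eval k78 k16)
  have k82: "w (0, 3, 4, 4) = 0" using eq[of 0 3 0] by (simp del: One_nat_def add: contract_eval k54 k81)
  have k83: "w (0, 2, 4, 7) = 0" using eq[of 0 4 2] by (simp del: One_nat_def add: contract_eval k17 k82)
  note ks = z k0 k1 k2 k3 k4 k5 k6 k7 k8 k9 k10 k11 k12 k13 k14 k15 k16 k17 k18 k19 k20 k21 k22 k23 k24 k25 k26 k27 k28 k29 k30 k31 k32 k33 k34 k35 k36 k37 k38 k39 k40 k41 k42 k43 k44 k45 k46 k47 k48 k49 k50 k51 k52 k53 k54 k55 k56 k57 k58 k59 k60 k61 k62 k63 k64 k65 k66 k67 k68 k69 k70 k71 k72 k73 k74 k75 k76 k77 k78 k79 k80 k81 k82 k83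
  have "\<forall>q\<in>set [(i, j, k, c). i \<leftarrow> [0..<5], j \<leftarrow> [0..<5], k \<leftarrow> [0..<5], c \<leftarrow> [0..<9], i < j \<and> j < k]. w q =
    (if q \<in> {(1,2,3,1), (0,1,3,3)} then w (1,2,3,1)
     else if q \<in> {(0,1,2,5), (0,1,2,6), (0,2,3,2), (0,2,3,4)} then - w (1,2,3,1)
     else if q \<in> {(1,2,4,5), (0,2,4,5)} then w (1,2,4,5)
     else if q \<in> {(1,2,4,4), (0,2,4,4)} then - w (1,2,4,5) else 0)"
    unfolding upt_5 upt_9 by (simp del: One_nat_def add: ks)
  then show ?thesis using q unfolding triples_eq by blast
qed


section \<open>Torus action and splitting of relations by weight\<close>

text \<open>Weights of a one-parameter torus in the symmetry group of the tensor: they are pairwise distinct and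
  add up to 32 on every transversal, and their gaps keep unrelated coordinates of a slice in different degrees.\<close>

definition weight :: "nat \<Rightarrow> nat" where
  "weight i = [0, 7, 21, 1, 8, 22, 3, 10, 24] ! i"

lemma weight_simps: "weight 0 = 0" "weight 1 = 7" "weight 2 = 21" "weight 3 = 1" "weight 4 = 8"
  "weight 5 = 22" "weight 6 = 3" "weight 7 = 10" "weight 8 = 24"
  by (simp_all add: weight_def)

lemma less_9_cases: "i < (9::nat) \<longleftrightarrow> i \<in> {0, 1, 2, 3, 4, 5, 6, 7, 8}"
  by auto

lemma weight_transversal: "transversal i j k \<Longrightarrow> weight i + weight j + weight k = 32"
proof -
  have "\<forall>i\<in>set [0..<9]. \<forall>j\<in>set [0..<9]. \<forall>k\<in>set [0..<9]. transversal i j k \<longrightarrow> weight i + weight j + weight k = 32"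
    by code_simp
  then show "transversal i j k \<Longrightarrow> ?thesis" by (auto simp: transversal_def)
qed

text \<open>Every transversal has total weight 32, so dividing by \<open>t ^ 32\<close> in the
  second factor makes the scaling fix the tensor.\<close>

lemma approx14_scale:
  assumes "approx14 a b c" "t \<noteq> 0"
  shows "approx14 (\<lambda>n s i. t ^ weight i * a n s i) (\<lambda>n s j. t ^ weight j / t ^ 32 * b n s j) (\<lambda>n s k. t ^ weight k * c n s k)"
  unfolding approx14_def
proof safe
  fix i j k :: nat assume ijk: "i \<in> {1..8}" "j < 9" "k < 9"
  define q where "q = t ^ weight i * (t ^ weight j / t ^ 32) * t ^ weight k"
  have "(\<lambda>n. q * (\<Sum>s<14. a n s i * b n s j * c n s k)) \<longlonglongrightarrow> q * perm3 i j k"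
    using assms(1) ijk unfolding approx14_def by (intro tendsto_mult tendsto_const) auto
  moreover have "q * perm3 i j k = perm3 i j k"
  proof (cases "transversal i j k")
    case True
    then have "q = 1" using weight_transversal[OF True] assms(2)
      by (simp add: q_def power_add[symmetric] add_ac)
    then show ?thesis by simp
  qed (simp add: perm3_def)
  moreover have "q * (\<Sum>s<14. a n s i * b n s j * c n s k) =
    (\<Sum>s<14. t ^ weight i * a n s i * (t ^ weight j / t ^ 32 * b n s j) * (t ^ weight k * c n s k))" for n
    unfolding sum_distrib_left by (intro sum.cong) (auto simp: q_def)
  ultimately show "(\<lambda>n. \<Sum>s<14. t ^ weight i * a n s i * (t ^ weight j / t ^ 32 * b n s j) * (t ^ weight k * c n s k)) \<longlonglongrightarrow> perm3 i j k"
    by simp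
qed

lemma limit_span_scale:
  assumes "e \<in> limit_span a c"
  shows "(\<lambda>i k. t ^ (weight i + weight k) * e i k) \<in> limit_span (\<lambda>n s i. t ^ weight i * a n s i) (\<lambda>n s k. t ^ weight k * c n s k)"
proof -
  from assms obtain lam where lam: "\<And>i k. i \<in> {1..8} \<Longrightarrow> k < 9 \<Longrightarrow> (\<lambda>n. \<Sum>s<14. lam n s * a n s i * c n s k) \<longlonglongrightarrow> e i k"
    unfolding limit_span_def by blast
  have "(\<lambda>n. \<Sum>s<14. lam n s * (t ^ weight i * a n s i) * (t ^ weight k * c n s k)) \<longlonglongrightarrow> t ^ (weight i + weight k) * e i k"
    if "i \<in> {1..8}" "k < 9" for i k
  proof -
    have "(\<Sum>s<14. lam n s * (t ^ weight i * a n s i) * (t ^ weight k * c n s k)) = t ^ (weight i + weight k) * (\<Sum>s<14. lam n s * a n s i * c n s k)" for n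
      unfolding sum_distrib_left by (intro sum.cong) (auto simp: power_add)
    then show ?thesis using lam[OF that] by (simp add: tendsto_mult)
  qed
  then show ?thesis unfolding limit_span_def by blast
qed

lemma coefficients_eq_0:
  fixes x :: "nat \<Rightarrow> complex"
  assumes "finite U" "\<And>t. t \<noteq> 0 \<Longrightarrow> (\<Sum>u\<in>U. x u * t ^ u) = 0" "u \<in> U"
  shows "x u = 0"
proof -
  define N where "N = Max U"
  \<comment> \<open>Degrees are shifted up by one, that is, the polynomial is multiplied by
    \<open>t\<close>, because the hypothesis says nothing at \<open>t = 0\<close>.\<close>
  define y where "y = (\<lambda>i. case i of 0 \<Rightarrow> 0 | Suc i \<Rightarrow> if i \<in> U then x i else 0)"
  have "(\<Sum>i\<le>Suc N. y i * t ^ i) = 0" for t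
  proof -
    have "(\<Sum>i\<le>Suc N. y i * t ^ i) = (\<Sum>i\<le>N. (if i \<in> U then x i else 0) * t ^ i) * t"
      by (subst sum.atMost_Suc_shift) (simp add: y_def sum_distrib_left sum_distrib_right mult_ac)
    also have "(\<Sum>i\<le>N. (if i \<in> U then x i else 0) * t ^ i) = (\<Sum>u\<in>U. x u * t ^ u)"
    proof (rule sum.mono_neutral_cong_right)
      show "U \<subseteq> {..N}" using assms(1) by (auto simp: N_def)
    qed auto
    finally show ?thesis using assms(2)[of t] by (cases "t = 0") auto
  qed
  then have "\<forall>i\<le>Suc N. y i = 0" using polyfun_eq_0[of y "Suc N"] by blast
  moreover have "u \<le> N" using assms by (simp add: N_def)
  ultimately have "y (Suc u) = 0" by blast
  then show ?thesis using assms(3) by (simp add: y_def)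
qed

text \<open>Of the six free coordinates, \<open>Z\<close> spares only that of the 4-form on blocks 0
  to 3. Contracting with this form yields differences of opposite entries of the block sums of
  \<open>e\<close>, hence the shape of the three relations.\<close>

lemma koszul_skew:
  assumes "approx14 a b c" "e \<in> limit_span a c"
  shows "e 2 1 + e 4 1 - e 1 2 - e 1 4 = 0" "e 1 3 - e 3 1 = 0" "e 5 1 + e 6 1 - e 1 5 - e 1 6 = 0"
proof -
  define Z :: "(nat \<times> nat \<times> nat \<times> nat) set"
    where "Z = set [(1,2,4,1), (1,3,4,1), (2,3,4,1), (2,3,4,4), (1,2,4,5)]"
  have Z: "finite Z" "card Z \<le> 5" "Z \<subseteq> triples"
    unfolding Z_def by (auto simp: triples_def intro: order.trans[OF card_length])
  from koszul_limit[OF assms Z] obtain w where w: "\<exists>q\<in>triples. w q \<noteq> 0" "\<And>q. q \<in> Z \<Longrightarrow> w q = 0"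
    "\<And>y z. y < 5 \<Longrightarrow> z < 5 \<Longrightarrow> contract w y z e = 0"
    "\<forall>y<5. \<forall>z<5. \<forall>j<9. contract w y z (\<lambda>i k. perm3 i j k) = 0" by blast
  have Z0: "w (1,2,4,1) = 0" "w (1,3,4,1) = 0" "w (2,3,4,1) = 0" "w (2,3,4,4) = 0" "w (1,2,4,5) = 0"
    by (auto intro: w(2) simp: Z_def)
  obtain z where z: "z = w (1,2,3,1)" by blast
  note k = koszul_kernel[OF w(4) Z0(1-4), folded z, unfolded Z0(5)]
  have 0: "z \<noteq> 0"
  proof
    assume "z = 0"
    then have "w q = 0" if "q \<in> triples" for q using k[OF that] by simp
    with w(1) show False by blast
  qed
  have "contract w 2 3 e = z * (e 2 1 + e 4 1 - e 1 2 - e 1 4)"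
    by (simp del: One_nat_def add: contract_eval k triples_def algebra_simps)
  then show "e 2 1 + e 4 1 - e 1 2 - e 1 4 = 0" using 0 w(3)[of 2 3] by simp
  have "contract w 1 3 e = z * (e 1 3 - e 3 1)"
    by (simp del: One_nat_def add: contract_eval k triples_def algebra_simps)
  then show "e 1 3 - e 3 1 = 0" using 0 w(3)[of 1 3] by simp
  have "contract w 1 2 e = z * (e 5 1 + e 6 1 - e 1 5 - e 1 6)"
    by (simp del: One_nat_def add: contract_eval k triples_def algebra_simps)
  then show "e 5 1 + e 6 1 - e 1 5 - e 1 6 = 0" using 0 w(3)[of 1 2] by simp
qed

text \<open>Now \<open>Z\<close> spares only the sixth kernel element. The relations say that column
  5 minus column 4 of \<open>e\<close>, summed over blocks, has entries in blocks 0 and 1 adding up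
  to 0 and vanishing entries in blocks 2 and 4.\<close>

lemma koszul_special:
  assumes "approx14 a b c" "e \<in> limit_span a c"
  shows "e 1 5 + e 2 5 + e 4 5 - e 1 4 - e 2 4 - e 4 4 = 0" "e 3 5 - e 3 4 = 0" "e 7 5 + e 8 5 - e 7 4 - e 8 4 = 0"
proof -
  define Z :: "(nat \<times> nat \<times> nat \<times> nat) set"
    where "Z = set [(1,2,4,1), (1,3,4,1), (2,3,4,1), (2,3,4,4), (1,2,3,1)]"
  have Z: "finite Z" "card Z \<le> 5" "Z \<subseteq> triples"
    unfolding Z_def by (auto simp: triples_def intro: order.trans[OF card_length])
  from koszul_limit[OF assms Z] obtain w where w: "\<exists>q\<in>triples. w q \<noteq> 0" "\<And>q. q \<in> Z \<Longrightarrow> w q = 0"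
    "\<And>y z. y < 5 \<Longrightarrow> z < 5 \<Longrightarrow> contract w y z e = 0"
    "\<forall>y<5. \<forall>z<5. \<forall>j<9. contract w y z (\<lambda>i k. perm3 i j k) = 0" by blast
  have Z0: "w (1,2,4,1) = 0" "w (1,3,4,1) = 0" "w (2,3,4,1) = 0" "w (2,3,4,4) = 0" "w (1,2,3,1) = 0"
    by (auto intro: w(2) simp: Z_def)
  obtain z where z: "z = w (1,2,4,5)" by blast
  note k = koszul_kernel[OF w(4) Z0(1-4), folded z, unfolded Z0(5)]
  have 0: "z \<noteq> 0"
  proof
    assume "z = 0"
    then have "w q = 0" if "q \<in> triples" for q using k[OF that] by simp
    with w(1) show False by blast
  qed
  have "contract w 2 4 e = z * (e 1 5 + e 2 5 + e 4 5 - e 1 4 - e 2 4 - e 4 4)"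
    by (simp del: One_nat_def add: contract_eval k triples_def algebra_simps)
  then show "e 1 5 + e 2 5 + e 4 5 - e 1 4 - e 2 4 - e 4 4 = 0" using 0 w(3)[of 2 4] by simp
  have "contract w 1 4 e = z * (e 3 4 - e 3 5)"
    by (simp del: One_nat_def add: contract_eval k triples_def algebra_simps)
  then show "e 3 5 - e 3 4 = 0" using 0 w(3)[of 1 4] by simp
  have "contract w 1 2 e = z * (e 7 5 + e 8 5 - e 7 4 - e 8 4)"
    by (simp del: One_nat_def add: contract_eval k triples_def algebra_simps)
  then show "e 7 5 + e 8 5 - e 7 4 - e 8 4 = 0" using 0 w(3)[of 1 2] by simp
qed

lemma transversal_image:
  assumes g: "\<forall>i<9. g i < 9 \<and> g i div 3 = s (i div 3) \<and> g i mod 3 = t (i mod 3)"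
    and inj: "inj_on s {0, 1, 2}" "inj_on t {0, 1, 2}"
    and ijk: "i < 9" "j < 9" "k < 9"
  shows "transversal (g i) (g j) (g k) \<longleftrightarrow> transversal i j k"
proof -
  have eq: "s (a div 3) = s (b div 3) \<longleftrightarrow> a div 3 = b div 3" "t (a mod 3) = t (b mod 3) \<longleftrightarrow> a mod 3 = b mod 3"
    if "a < 9" "b < 9" for a b :: nat
  proof -
    have D: "a div 3 \<in> {0, 1, 2}" "b div 3 \<in> {0, 1, 2}" "a mod 3 \<in> {0, 1, 2}" "b mod 3 \<in> {0, 1, 2}"
      using that by auto
    show "s (a div 3) = s (b div 3) \<longleftrightarrow> a div 3 = b div 3"
      by (rule inj_on_eq_iff[OF inj(1) D(1,2)])
    show "t (a mod 3) = t (b mod 3) \<longleftrightarrow> a mod 3 = b mod 3"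
      by (rule inj_on_eq_iff[OF inj(2) D(3,4)])
  qed
  from g ijk have "g i < 9 \<and> g i div 3 = s (i div 3) \<and> g i mod 3 = t (i mod 3)"
    "g j < 9 \<and> g j div 3 = s (j div 3) \<and> g j mod 3 = t (j mod 3)"
    "g k < 9 \<and> g k div 3 = s (k div 3) \<and> g k mod 3 = t (k mod 3)" by blast+
  with ijk show ?thesis by (simp add: transversal_def eq)
qed

section \<open>Symmetries of the square\<close>

text \<open>Positions 1 to 8 must be preserved because slice 0 is missing from the
  approximation.\<close>

definition position_symmetry :: "(nat \<Rightarrow> nat) \<Rightarrow> bool" where
  "position_symmetry g \<longleftrightarrow> (\<forall>i<9. \<forall>j<9. \<forall>k<9. transversal (g i) (g j) (g k) \<longleftrightarrow> transversal i j k) \<and>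
    (\<forall>i<9. g i < 9) \<and> (\<forall>i\<in>{1..8}. g i \<in> {1..8})"

definition row_swap :: "nat \<Rightarrow> nat" where "row_swap i = [0, 1, 2, 6, 7, 8, 3, 4, 5] ! i"
definition col_swap :: "nat \<Rightarrow> nat" where "col_swap i = [0, 2, 1, 3, 5, 4, 6, 8, 7] ! i"
definition transposition :: "nat \<Rightarrow> nat" where "transposition i = [0, 3, 6, 1, 4, 7, 2, 5, 8] ! i"

lemma row_swap_simps: "row_swap 1 = 1" "row_swap 2 = 2" "row_swap 3 = 6" "row_swap 4 = 7" "row_swap 5 = 8" "row_swap 6 = 3" "row_swap 7 = 4" "row_swap 8 = 5"
  by (simp_all add: row_swap_def)

lemma col_swap_simps: "col_swap 1 = 2" "col_swap 2 = 1" "col_swap 3 = 3" "col_swap 4 = 5" "col_swap 5 = 4" "col_swap 6 = 6" "col_swap 7 = 8" "col_swap 8 = 7"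
  by (simp_all add: col_swap_def)

lemma transposition_simps: "transposition 1 = 3" "transposition 2 = 6" "transposition 3 = 1" "transposition 4 = 4" "transposition 5 = 7" "transposition 6 = 2" "transposition 7 = 5" "transposition 8 = 8"
  by (simp_all add: transposition_def)

lemma atLeastAtMost_1_8: "{1..8::nat} = {1, 2, 3, 4, 5, 6, 7, 8}"
  by auto

lemma position_symmetryI:
  assumes g: "\<forall>i<9. g i < 9 \<and> g i div 3 = s (i div 3) \<and> g i mod 3 = t (i mod 3)"
    and inj: "inj_on s {0, 1, 2}" "inj_on t {0, 1, 2}"
    and pos: "\<forall>i\<in>{1..8}. g i \<in> {1..8}"
  shows "position_symmetry g"
  unfolding position_symmetry_def
proof (intro conjI pos)
  show "\<forall>i<9. \<forall>j<9. \<forall>k<9. transversal (g i) (g j) (g k) = transversal i j k"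
    using transversal_image[OF g inj] by simp
  show "\<forall>i<9. g i < 9" using g by blast
qed

lemma ball_less_9: "(\<forall>i<9. P i) \<longleftrightarrow> (\<forall>i\<in>{0, 1, 2, 3, 4, 5, 6, 7, 8::nat}. P i)"
  unfolding less_9_cases by blast

lemma position_symmetry_row_swap: "position_symmetry row_swap"
proof (rule position_symmetryI)
  show "\<forall>i<9. row_swap i < 9 \<and> row_swap i div 3 = [0, 2, 1] ! (i div 3) \<and> row_swap i mod 3 = id (i mod 3)"
    unfolding ball_less_9 by (simp add: row_swap_def)
  show "\<forall>i\<in>{1..8}. row_swap i \<in> {1..8}"
    unfolding atLeastAtMost_1_8 by (simp add: row_swap_def)
qed (simp_all add: inj_on_def)

lemma position_symmetry_col_swap: "position_symmetry col_swap"
proof (rule position_symmetryI)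
  show "\<forall>i<9. col_swap i < 9 \<and> col_swap i div 3 = id (i div 3) \<and> col_swap i mod 3 = [0, 2, 1] ! (i mod 3)"
    unfolding ball_less_9 by (simp add: col_swap_def)
  show "\<forall>i\<in>{1..8}. col_swap i \<in> {1..8}"
    unfolding atLeastAtMost_1_8 by (simp add: col_swap_def)
qed (simp_all add: inj_on_def)

lemma position_symmetry_transposition: "position_symmetry transposition"
  unfolding position_symmetry_def
proof (intro conjI)
  have t: "\<forall>i<9. transposition i < 9 \<and> transposition i div 3 = i mod 3 \<and> transposition i mod 3 = i div 3"
    unfolding ball_less_9 by (simp add: transposition_def)
  show "\<forall>i<9. \<forall>j<9. \<forall>k<9. transversal (transposition i) (transposition j) (transposition k) = transversal i j k"
  proof (intro allI impI)
    fix i j k :: nat assume ijk: "i < 9" "j < 9" "k < 9"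
    from t ijk have "transposition i < 9 \<and> transposition i div 3 = i mod 3 \<and> transposition i mod 3 = i div 3"
      "transposition j < 9 \<and> transposition j div 3 = j mod 3 \<and> transposition j mod 3 = j div 3"
      "transposition k < 9 \<and> transposition k div 3 = k mod 3 \<and> transposition k mod 3 = k div 3" by blast+
    with ijk show "transversal (transposition i) (transposition j) (transposition k) = transversal i j k"
      by (auto simp: transversal_def)
  qed
  show "\<forall>i<9. transposition i < 9" using t by blast
  show "\<forall>i\<in>{1..8}. transposition i \<in> {1..8}"
    unfolding atLeastAtMost_1_8 by (simp add: transposition_def)
qed

lemma position_symmetry_comp: "position_symmetry f \<Longrightarrow> position_symmetry g \<Longrightarrow> position_symmetry (f \<circ> g)"
  unfolding position_symmetry_def by (simp add: Ball_def)

lemma position_symmetry_id: "position_symmetry id"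
  by (simp add: position_symmetry_def)

lemma approx14_symmetry:
  "approx14 (\<lambda>n s i. a n s (g i)) (\<lambda>n s i. b n s (g i)) (\<lambda>n s i. c n s (g i))"
  if "approx14 a b c" "position_symmetry g"
  unfolding approx14_def
proof safe
  fix i j k :: nat assume ijk: "i \<in> {1..8}" "j < 9" "k < 9"
  then have g: "g i \<in> {1..8}" "g j < 9" "g k < 9" and "perm3 (g i) (g j) (g k) = perm3 i j k"
    using that(2) by (auto simp: position_symmetry_def perm3_def)
  moreover have "(\<lambda>n. \<Sum>s<14. a n s (g i) * b n s (g j) * c n s (g k)) \<longlonglongrightarrow> perm3 (g i) (g j) (g k)"
    using that(1)[unfolded approx14_def] g by simp
  ultimately show "(\<lambda>n. \<Sum>s<14. a n s (g i) * b n s (g j) * c n s (g k)) \<longlonglongrightarrow> perm3 i j k"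
    by simp
qed

lemma limit_span_symmetry:
  "(\<lambda>i k. e (g i) (g k)) \<in> limit_span (\<lambda>n s i. a n s (g i)) (\<lambda>n s i. c n s (g i))"
  if e: "e \<in> limit_span a c" and g: "position_symmetry g"
proof -
  from e obtain lam where "\<forall>i\<in>{1..8}. \<forall>k<9. (\<lambda>n. \<Sum>s<14. lam n s * a n s i * c n s k) \<longlonglongrightarrow> e i k"
    unfolding limit_span_def by blast
  moreover have "\<forall>i\<in>{1..8}. g i \<in> {1..8}" "\<forall>k<9. g k < 9"
    using g unfolding position_symmetry_def by blast+
  ultimately have "\<forall>i\<in>{1..8}. \<forall>k<9. (\<lambda>n. \<Sum>s<14. lam n s * a n s (g i) * c n s (g k)) \<longlonglongrightarrow> e (g i) (g k)"
    by simp
  then show ?thesis unfolding limit_span_def by blast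
qed

lemma two_weights:
  fixes x y :: complex and u v :: nat
  assumes "\<And>t. t \<noteq> 0 \<Longrightarrow> x * t ^ u + y * t ^ v = 0" "u \<noteq> v"
  shows "x = 0" "y = 0"
  using coefficients_eq_0[of "{u, v}" "\<lambda>w. if w = u then x else y" u]
    coefficients_eq_0[of "{u, v}" "\<lambda>w. if w = u then x else y" v] assms by auto

text \<open>The torus turns a limit into a limit for the rescaled sequences, which approximate the
  same tensor. The relations therefore hold as polynomial identities in \<open>t\<close> and split
  into one relation per weight.\<close>

lemma limit_span_relations:
  assumes "approx14 a b c" "e \<in> limit_span a c"
  shows "e 1 2 = e 2 1" "e 1 4 = e 4 1" "e 1 3 = e 3 1" "e 1 5 = e 5 1" "e 1 6 = e 6 1"
    and "e 1 5 = e 2 4" "e 7 5 = e 8 4"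
    and "e 2 5 = 0" "e 4 5 = 0" "e 1 4 = 0" "e 4 4 = 0" "e 3 5 = 0" "e 3 4 = 0" "e 8 5 = 0" "e 7 4 = 0"
proof -
  note sk = koszul_skew[OF approx14_scale[OF assms(1)] limit_span_scale[OF assms(2)]]
    and sp = koszul_special[OF approx14_scale[OF assms(1)] limit_span_scale[OF assms(2)]]
  note ws = weight_simps
  have 1: "(e 2 1 - e 1 2) * t ^ 28 + (e 4 1 - e 1 4) * t ^ 15 = 0" if "t \<noteq> 0" for t
    using sk(1)[OF that] by (simp del: One_nat_def add: ws algebra_simps)
  from two_weights[OF 1] have r1: "e 1 2 = e 2 1" "e 1 4 = e 4 1" by simp_all
  have r2: "e 1 3 = e 3 1" using koszul_skew(2)[OF assms] unfolding right_minus_eq .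
  have 2: "(e 5 1 - e 1 5) * t ^ 29 + (e 6 1 - e 1 6) * t ^ 10 = 0" if "t \<noteq> 0" for t
    using sk(3)[OF that] by (simp del: One_nat_def add: ws algebra_simps)
  from two_weights[OF 2] have r3: "e 1 5 = e 5 1" "e 1 6 = e 6 1" by simp_all
  have 3: "e 3 5 * t ^ 23 + (- e 3 4) * t ^ 9 = 0" if "t \<noteq> 0" for t
    using sp(2)[OF that] by (simp del: One_nat_def add: ws algebra_simps)
  from two_weights[OF 3] have r4: "e 3 5 = 0" "e 3 4 = 0" by simp_all
  \<comment> \<open>The keys are the sums \<open>weight i + weight k\<close>. The entries
    \<open>e 1 5\<close> and \<open>e 2 4\<close> share the weight 29, as both pairs of positions
    are completed to a transversal by 6, and so they stay together.\<close>
  define x where "x = (\<lambda>u::nat. if u = 29 then e 1 5 - e 2 4 else if u = 43 then e 2 5 else if u = 30 then e 4 5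
    else if u = 15 then - e 1 4 else - e 4 4)"
  have 4: "(\<Sum>u\<in>{29, 43, 30, 15, 16::nat}. x u * t ^ u) = 0" if "t \<noteq> 0" for t
    using sp(1)[OF that] by (simp del: One_nat_def add: ws x_def algebra_simps)
  from coefficients_eq_0[OF _ 4] have "\<forall>u\<in>{29, 43, 30, 15, 16}. x u = 0" by simp
  then have r5: "e 1 5 = e 2 4" "e 2 5 = 0" "e 4 5 = 0" "e 1 4 = 0" "e 4 4 = 0" by (simp_all add: x_def)
  define y where "y = (\<lambda>u::nat. if u = 32 then e 7 5 - e 8 4 else if u = 46 then e 8 5 else - e 7 4)"
  have 5: "(\<Sum>u\<in>{32, 46, 18::nat}. y u * t ^ u) = 0" if "t \<noteq> 0" for t
    using sp(3)[OF that] by (simp del: One_nat_def add: ws y_def algebra_simps)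
  from coefficients_eq_0[OF _ 5] have "\<forall>u\<in>{32, 46, 18}. y u = 0" by simp
  then have r6: "e 7 5 = e 8 4" "e 8 5 = 0" "e 7 4 = 0" by (simp_all add: y_def)
  show "e 1 2 = e 2 1" "e 1 4 = e 4 1" "e 1 3 = e 3 1" "e 1 5 = e 5 1" "e 1 6 = e 6 1" "e 1 5 = e 2 4" "e 7 5 = e 8 4" "e 2 5 = 0" "e 4 5 = 0" "e 1 4 = 0" "e 4 4 = 0" "e 3 5 = 0" "e 3 4 = 0" "e 8 5 = 0" "e 7 4 = 0"
    by (fact r1 r2 r3 r4 r5 r6)+
qed

section \<open>The explicit space containing all limits\<close>

definition cross :: "nat set" where "cross = {1, 2, 3, 6}"

definition collinear_positions :: "nat \<Rightarrow> nat \<Rightarrow> bool" where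
  "collinear_positions i k \<longleftrightarrow> i div 3 = k div 3 \<or> i mod 3 = k mod 3"

text \<open>The exceptional set \<open>cross\<close> consists of the positions sharing a row or
  column with 0. On rows 1 to 8 and columns 0 to 8 the dimension is 23: nine values indexed by the
  completing position \<open>b\<close>, six entries at collinear pairs in \<open>cross\<close>, and
  the eight unrestricted entries of column 0.\<close>

definition ideal_space :: "(nat \<Rightarrow> nat \<Rightarrow> complex) set" where
  "ideal_space = {e. (\<forall>i\<in>{1..8}. \<forall>k\<in>{1..8}. e i k = e k i) \<and>
    (\<forall>i\<in>{1..8}. \<forall>k\<in>{1..8}. collinear_positions i k \<longrightarrow> \<not> (i \<in> cross \<and> k \<in> cross) \<longrightarrow> e i k = 0) \<and>
    (\<forall>i\<in>{1..8}. \<forall>k\<in>{1..8}. \<forall>i'\<in>{1..8}. \<forall>k'\<in>{1..8}. \<forall>b<9.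
      transversal i b k \<longrightarrow> transversal i' b k' \<longrightarrow> e i k = e i' k')}"

text \<open>The fifteen relations are carried around by the eight symmetries that fix position 0,
  generated by a row swap, a column swap and the transposition.\<close>

lemma limit_span_subset_ideal_space:
  assumes "approx14 a b c"
  shows "limit_span a c \<subseteq> ideal_space"
proof
  fix e assume e: "e \<in> limit_span a c"
  have rel: "e (g 1) (g 2) = e (g 2) (g 1)" "e (g 1) (g 4) = e (g 4) (g 1)" "e (g 1) (g 3) = e (g 3) (g 1)"
    "e (g 1) (g 5) = e (g 5) (g 1)" "e (g 1) (g 6) = e (g 6) (g 1)"
    "e (g 1) (g 5) = e (g 2) (g 4)" "e (g 7) (g 5) = e (g 8) (g 4)"
    "e (g 2) (g 5) = 0" "e (g 4) (g 5) = 0" "e (g 1) (g 4) = 0" "e (g 4) (g 4) = 0" "e (g 3) (g 5) = 0"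
    "e (g 3) (g 4) = 0" "e (g 8) (g 5) = 0" "e (g 7) (g 4) = 0" if "position_symmetry g" for g
    by (rule limit_span_relations[OF approx14_symmetry[OF assms that] limit_span_symmetry[OF e that]])+
  note r = position_symmetry_row_swap and c = position_symmetry_col_swap and t = position_symmetry_transposition
  note gs = row_swap_simps col_swap_simps transposition_simps o_apply
  note f1 = rel[OF position_symmetry_id, unfolded id_apply]
  note f2 = rel[OF r, unfolded gs]
  note f3 = rel[OF c, unfolded gs]
  note f4 = rel[OF t, unfolded gs]
  note f5 = rel[OF position_symmetry_comp[OF r c], unfolded gs]
  note f6 = rel[OF position_symmetry_comp[OF r t], unfolded gs]
  note f7 = rel[OF position_symmetry_comp[OF c t], unfolded gs]
  note f8 = rel[OF position_symmetry_comp[OF position_symmetry_comp[OF r c] t], unfolded gs]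
  have z14: "e 1 4 = 0" by (fact f1(10))
  have z17: "e 1 7 = 0" by (fact f2(10))
  have z25: "e 2 5 = 0" by (fact f1(8))
  have z28: "e 2 8 = 0" by (fact f2(8))
  have z34: "e 3 4 = 0" by (fact f1(13))
  have z35: "e 3 5 = 0" by (fact f1(12))
  have z41: "e 4 1 = 0" using f1(2) f1(10) by simp
  have z43: "e 4 3 = 0" using f4(2) f1(13) by simp
  have z44: "e 4 4 = 0" by (fact f1(11))
  have z45: "e 4 5 = 0" by (fact f1(9))
  have z47: "e 4 7 = 0" by (fact f2(15))
  have z52: "e 5 2 = 0" using f3(2) f1(8) by simp
  have z53: "e 5 3 = 0" using f7(2) f1(12) by simp
  have z54: "e 5 4 = 0" by (fact f3(9))
  have z55: "e 5 5 = 0" by (fact f3(11))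
  have z58: "e 5 8 = 0" by (fact f2(14))
  have z67: "e 6 7 = 0" by (fact f2(13))
  have z68: "e 6 8 = 0" by (fact f2(12))
  have z71: "e 7 1 = 0" using f2(2) f2(10) by simp
  have z74: "e 7 4 = 0" by (fact f1(15))
  have z76: "e 7 6 = 0" using f6(2) f2(13) by simp
  have z77: "e 7 7 = 0" by (fact f2(11))
  have z78: "e 7 8 = 0" by (fact f2(9))
  have z82: "e 8 2 = 0" using f5(2) f2(8) by simp
  have z85: "e 8 5 = 0" by (fact f1(14))
  have z86: "e 8 6 = 0" using f8(2) f2(12) by simp
  have z87: "e 8 7 = 0" by (fact f4(14))
  have z88: "e 8 8 = 0" by (fact f5(11))
  have c21: "e 2 1 = e 1 2" using f1(1) by simp
  have c31: "e 3 1 = e 1 3" using f1(3) by simp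
  have c51: "e 5 1 = e 1 5" using f1(4) by simp
  have c24: "e 2 4 = e 1 5" using f1(6) by simp
  have c42: "e 4 2 = e 1 5" using f3(4) c24 by simp
  have c61: "e 6 1 = e 1 6" using f1(5) by simp
  have c81: "e 8 1 = e 1 8" using f2(4) by simp
  have c27: "e 2 7 = e 1 8" using f2(6) by simp
  have c72: "e 7 2 = e 1 8" using f5(4) c27 by simp
  have c32: "e 3 2 = e 2 3" using f3(3) by simp
  have c62: "e 6 2 = e 2 6" using f3(5) by simp
  have c63: "e 6 3 = e 3 6" using f4(1) by simp
  have c73: "e 7 3 = e 3 7" using f4(4) by simp
  have c64: "e 6 4 = e 3 7" using f4(6) by simp
  have c46: "e 4 6 = e 3 7" using f6(4) c64 by simp
  have c83: "e 8 3 = e 3 8" using f7(4) by simp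
  have c65: "e 6 5 = e 3 8" using f7(6) by simp
  have c56: "e 5 6 = e 3 8" using f8(4) c65 by simp
  have c57: "e 5 7 = e 4 8" using f2(7) by simp
  have c75: "e 7 5 = e 4 8" using f7(7) by simp
  have c84: "e 8 4 = e 4 8" using f4(7) c57 by simp
  note zs = z14 z17 z25 z28 z34 z35 z41 z43 z44 z45 z47 z52 z53 z54 z55 z58 z67 z68 z71 z74 z76 z77 z78 z82 z85 z86 z87 z88
  note cs = c21 c31 c51 c24 c42 c61 c81 c27 c72 c32 c62 c63 c73 c64 c46 c83 c65 c56 c57 c75 c84
  have 1: "\<forall>i\<in>{1..8}. \<forall>k\<in>{1..8}. e i k = e k i"
    unfolding atLeastAtMost_1_8 by (simp del: One_nat_def add: zs cs)
  have 2: "\<forall>i\<in>{1..8}. \<forall>k\<in>{1..8}. collinear_positions i k \<longrightarrow> \<not> (i \<in> cross \<and> k \<in> cross) \<longrightarrow> e i k = 0"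
    unfolding atLeastAtMost_1_8 by (simp del: One_nat_def add: zs cross_def collinear_positions_def)
  define p where "p = (\<lambda>b. [e 4 8, e 3 8, e 3 7, e 1 8, e 2 6, e 1 6, e 1 5, e 2 3, e 1 3] ! b)"
  have "\<forall>i\<in>{1..8}. \<forall>k\<in>{1..8}. \<forall>b\<in>{0, 1, 2, 3, 4, 5, 6, 7, 8}. transversal i b k \<longrightarrow> e i k = p b"
    unfolding atLeastAtMost_1_8 by (simp del: One_nat_def add: cs p_def transversal_def)
  then have 3: "\<forall>i\<in>{1..8}. \<forall>k\<in>{1..8}. \<forall>b<9. transversal i b k \<longrightarrow> e i k = p b"
    by (simp add: less_9_cases)
  show "e \<in> ideal_space"
    unfolding ideal_space_def using 1 2 3 by (simp add: Ball_def)
qed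

section \<open>Bounding the number of vanishing conditions\<close>

definition without :: "'a \<Rightarrow> 'a list list list \<Rightarrow> 'a list list list" where
  "without x C = filter (\<lambda>c. [] \<notin> set c) (map (map (removeAll x)) C)"

text \<open>Branches on whether each weight of \<open>xs\<close> lies in \<open>S\<close>, with
  \<open>k\<close> bounding how many more may. A weight outside \<open>S\<close> is deleted from all
  clauses, and a formula with an emptied clause is dropped as false. A weight inside
  \<open>S\<close> leaves \<open>C\<close> as it is, since it falsifies nothing. A branch ends once
  at most \<open>m\<close> formulas survive.\<close>

fun search :: "nat \<Rightarrow> 'a list \<Rightarrow> nat \<Rightarrow> 'a list list list \<Rightarrow> bool" where
  "search m xs k C = (if length C \<le> m then True else case xs of [] \<Rightarrow> False
     | x # ys \<Rightarrow> if search m ys k (without x C) then (case k of 0 \<Rightarrow> True | Suc l \<Rightarrow> search m ys l C) else False)"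

definition meets :: "'a set \<Rightarrow> 'a list list \<Rightarrow> bool" where
  "meets S c \<longleftrightarrow> (\<forall>d\<in>set c. set d \<inter> S \<noteq> {})"

lemma length_filter_without:
  assumes "x \<notin> S"
  shows "length (filter (meets S) (without x C)) = length (filter (meets S) C)"
proof -
  have "meets S (map (removeAll x) c) = meets S c" for c
  proof -
    have "set (removeAll x d) \<inter> S = set d \<inter> S" for d using assms by auto
    then show ?thesis by (simp add: meets_def)
  qed
  moreover have "[] \<notin> set c" if "meets S c" for c using that by (auto simp: meets_def)
  ultimately have "([] \<notin> set (map (removeAll x) c) \<and> meets S (map (removeAll x) c)) = meets S c" for c
    by metis
  then show ?thesis
    unfolding without_def filter_map length_map filter_filter o_def by presburger
qed

lemma search:
  "search m xs k C \<Longrightarrow> distinct xs \<Longrightarrow> card (S \<inter> set xs) \<le> k \<Longrightarrow> length (filter (meets S) C) \<le> m"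
proof (induction xs arbitrary: k C)
  case Nil
  then have "length C \<le> m" by (simp split: if_splits)
  then show ?case using length_filter_le le_trans by blast
next
  case (Cons x ys)
  show ?case
  proof (cases "length C \<le> m")
    case True
    then show ?thesis using length_filter_le le_trans by blast
  next
    case False
    from Cons.prems(1) False have a: "search m ys k (without x C)"
      and b: "case k of 0 \<Rightarrow> True | Suc l \<Rightarrow> search m ys l C"
      by (simp_all del: search.simps add: search.simps[of m "x # ys"] split: if_splits)
    show ?thesis
    proof (cases "x \<in> S")
      case False
      then have "card (S \<inter> set ys) \<le> k" using Cons.prems by simp
      from Cons.IH[OF a _ this] show ?thesis
        using length_filter_without[OF False, of C] Cons.prems by simp
    next
      case True
      then have "card (S \<inter> set (x # ys)) = Suc (card (S \<inter> set ys))"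
        using Cons.prems(2) by simp
      then obtain l where l: "k = Suc l" "card (S \<inter> set ys) \<le> l"
        using Cons.prems(3) by (cases k) auto
      with b Cons.prems Cons.IH[of l C] show ?thesis by simp
    qed
  qed
qed

text \<open>The 14 functionals are homogeneous, vanish on the slices of the tensor and are indexed by their weights.\<close>

definition leading_weights :: "nat list" where
  "leading_weights = [42, 10, 22, 2, 3, 21, 14, 6, 7, 1, 24, 8, 4, 28]"

definition leading_functional :: "nat \<Rightarrow> (nat \<Rightarrow> nat \<Rightarrow> complex) \<Rightarrow> complex" where
  "leading_functional w e = (if w = 14 then e 1 1 else
     if w = 42 then e 2 2 else
     if w = 2 then e 3 3 else
     if w = 6 then e 6 6 else
     if w = 7 then e 1 0 else
     if w = 21 then e 2 0 else
     if w = 1 then e 3 0 else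
     if w = 3 then e 6 0 else
     if w = 28 then e 1 2 else
     if w = 4 then e 3 6 else
     if w = 8 then e 4 0 - e 1 3 else
     if w = 22 then e 5 0 - e 2 3 else
     if w = 10 then e 7 0 - e 1 6 else
     if w = 24 then e 8 0 - e 2 6 else 0)"

text \<open>Each entry lists a coordinate of a cubic form and a formula in conjunctive normal form over the set \<open>S\<close> of
  leading weights; the coordinate is required to vanish only if the formula holds. The formulas are as strong as
  the proof of \<open>symmetric_form_eq_0\<close> permits, because at most 13 conditions may be imposed when \<open>S\<close>
  has 5 elements.\<close>

definition vanishing_conditions :: "((nat \<times> nat \<times> nat) \<times> nat list list) list" where
  "vanishing_conditions = [
     ((1, 1, 1), [[14]]),
     ((2, 2, 2), [[42]]),
     ((3, 3, 3), [[2]]),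
     ((6, 6, 6), [[6]]),
     ((1, 0, 0), [[7]]),
     ((2, 0, 0), [[21]]),
     ((3, 0, 0), [[1]]),
     ((6, 0, 0), [[3]]),
     ((1, 1, 0), [[14], [7]]),
     ((2, 2, 0), [[42], [21]]),
     ((3, 3, 0), [[2], [1]]),
     ((6, 6, 0), [[6], [3]]),
     ((1, 1, 2), [[28], [14]]),
     ((2, 2, 1), [[28], [42]]),
     ((3, 3, 6), [[4], [2]]),
     ((6, 6, 3), [[4], [6]]),
     ((2, 6, 0), [[21], [3]]),
     ((1, 6, 0), [[7], [3]]),
     ((2, 3, 0), [[21], [1]]),
     ((1, 3, 0), [[7], [1]]),
     ((2, 2, 6), [[42], [24]]),
     ((6, 6, 2), [[6], [24]]),
     ((1, 1, 6), [[14], [10]]),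
     ((6, 6, 1), [[6], [10]]),
     ((2, 2, 3), [[42], [22]]),
     ((3, 3, 2), [[2], [22]]),
     ((1, 1, 3), [[14], [8]]),
     ((3, 3, 1), [[2], [8]]),
     ((1, 2, 0), [[7], [21], [28]]),
     ((3, 6, 0), [[1], [3], [4]]),
     ((1, 8, 0), [[7], [21], [10, 28], [24, 28]]),
     ((1, 2, 6), [[10], [24], [28]]),
     ((1, 5, 0), [[7], [21], [8, 28], [22, 28]]),
     ((1, 2, 3), [[8], [22], [28]]),
     ((3, 8, 0), [[1], [3], [22, 4], [24, 4]]),
     ((3, 6, 2), [[22], [24], [4]]),
     ((3, 7, 0), [[1], [3], [8, 4], [10, 4]]),
     ((3, 6, 1), [[8], [10], [4]]),
     ((1, 5, 6), []),
     ((4, 8, 0), [[8], [22], [10], [24]]),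
     ((4, 0, 0), [[8]]),
     ((5, 0, 0), [[22]]),
     ((7, 0, 0), [[10]]),
     ((8, 0, 0), [[24]])]"

text \<open>A finite check by evaluation; the order of \<open>leading_weights\<close> is the
  branching order.\<close>

lemma few_vanishing_conditions:
  assumes "card (S \<inter> set leading_weights) \<le> 5"
  shows "length (filter (meets S) (map snd vanishing_conditions)) \<le> 13"
proof (rule search)
  show "search 13 leading_weights 5 (map snd vanishing_conditions)"
    unfolding leading_weights_def vanishing_conditions_def by code_simp
qed (use assms in \<open>simp_all add: leading_weights_def\<close>)

text \<open>For each listed coordinate, either its formula holds and \<open>act\<close> makes it 0,
  or some clause misses \<open>S\<close>; then the functionals named in that clause vanish on all
  slices, and they reduce the coordinate to 0 or to coordinates already known to vanish. All other
  coordinates follow from the equations of \<open>ideal_space\<close> and symmetry.\<close>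

lemma symmetric_form_eq_0:
  assumes sym: "\<And>i k l. X i k l = X k i l" "\<And>i k l. X i k l = X i l k"
    and ideal: "\<And>l. l < 9 \<Longrightarrow> (\<lambda>i k. X i k l) \<in> ideal_space"
    and dead: "\<And>w l. w \<in> set leading_weights \<Longrightarrow> w \<notin> S \<Longrightarrow> l < 9 \<Longrightarrow> leading_functional w (\<lambda>i k. X i k l) = 0"
    and act: "\<forall>((i, k, l), c)\<in>set vanishing_conditions. meets S c \<longrightarrow> X i k l = 0"
    and ikl: "i \<in> {1..8}" "k < 9" "l < 9"
  shows "X i k l = 0"
proof -
  have collinear: "X i k l = 0" if "i \<in> {1..8}" "k \<in> {1..8}" "collinear_positions i k" "\<not> (i \<in> cross \<and> k \<in> cross)" "l < 9" for i k l
    using ideal[OF that(5)] that(1-4) unfolding ideal_space_def by blast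
  have transv: "X i k l = X i' k' l" if "i \<in> {1..8}" "k \<in> {1..8}" "i' \<in> {1..8}" "k' \<in> {1..8}" "b < 9"
      "transversal i b k" "transversal i' b k'" "l < 9" for i k i' k' b l
    using ideal[OF that(8)] that(1-7) unfolding ideal_space_def by blast
  \<comment> \<open>Facts \<open>Z..\<close> are zeros at collinear pairs, \<open>C..\<close>
    equalities of entries completed by the same position, \<open>D..\<close> consequences of weights
    outside \<open>S\<close>, and \<open>P..\<close> the coordinates shown to vanish.\<close>
  have Z14: "X 1 4 l = 0" if "l < 9" for l
    by (rule collinear) (use that in \<open>simp_all add: collinear_positions_def cross_def\<close>)
  have Z17: "X 1 7 l = 0" if "l < 9" for l
    by (rule collinear) (use that in \<open>simp_all add: collinear_positions_def cross_def\<close>)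
  have Z25: "X 2 5 l = 0" if "l < 9" for l
    by (rule collinear) (use that in \<open>simp_all add: collinear_positions_def cross_def\<close>)
  have Z28: "X 2 8 l = 0" if "l < 9" for l
    by (rule collinear) (use that in \<open>simp_all add: collinear_positions_def cross_def\<close>)
  have Z34: "X 3 4 l = 0" if "l < 9" for l
    by (rule collinear) (use that in \<open>simp_all add: collinear_positions_def cross_def\<close>)
  have Z35: "X 3 5 l = 0" if "l < 9" for l
    by (rule collinear) (use that in \<open>simp_all add: collinear_positions_def cross_def\<close>)
  have Z44: "X 4 4 l = 0" if "l < 9" for l
    by (rule collinear) (use that in \<open>simp_all add: collinear_positions_def cross_def\<close>)
  have Z45: "X 4 5 l = 0" if "l < 9" for l
    by (rule collinear) (use that in \<open>simp_all add: collinear_positions_def cross_def\<close>)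
  have Z47: "X 4 7 l = 0" if "l < 9" for l
    by (rule collinear) (use that in \<open>simp_all add: collinear_positions_def cross_def\<close>)
  have Z55: "X 5 5 l = 0" if "l < 9" for l
    by (rule collinear) (use that in \<open>simp_all add: collinear_positions_def cross_def\<close>)
  have Z58: "X 5 8 l = 0" if "l < 9" for l
    by (rule collinear) (use that in \<open>simp_all add: collinear_positions_def cross_def\<close>)
  have Z67: "X 6 7 l = 0" if "l < 9" for l
    by (rule collinear) (use that in \<open>simp_all add: collinear_positions_def cross_def\<close>)
  have Z68: "X 6 8 l = 0" if "l < 9" for l
    by (rule collinear) (use that in \<open>simp_all add: collinear_positions_def cross_def\<close>)
  have Z77: "X 7 7 l = 0" if "l < 9" for l
    by (rule collinear) (use that in \<open>simp_all add: collinear_positions_def cross_def\<close>)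
  have Z78: "X 7 8 l = 0" if "l < 9" for l
    by (rule collinear) (use that in \<open>simp_all add: collinear_positions_def cross_def\<close>)
  have Z88: "X 8 8 l = 0" if "l < 9" for l
    by (rule collinear) (use that in \<open>simp_all add: collinear_positions_def cross_def\<close>)
  have C15: "X 1 5 l = X 2 4 l" if "l < 9" for l
    by (rule transv[where b = 6]) (use that in \<open>simp_all add: transversal_def\<close>)
  have C18: "X 1 8 l = X 2 7 l" if "l < 9" for l
    by (rule transv[where b = 3]) (use that in \<open>simp_all add: transversal_def\<close>)
  have C37: "X 3 7 l = X 4 6 l" if "l < 9" for l
    by (rule transv[where b = 2]) (use that in \<open>simp_all add: transversal_def\<close>)
  have C38: "X 3 8 l = X 5 6 l" if "l < 9" for l
    by (rule transv[where b = 1]) (use that in \<open>simp_all add: transversal_def\<close>)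
  have C48: "X 4 8 l = X 5 7 l" if "l < 9" for l
    by (rule transv[where b = 0]) (use that in \<open>simp_all add: transversal_def\<close>)
  have D14: "X 1 1 l = 0" if "14 \<notin> S" "l < 9" for l
    using dead[of 14 l] that by (simp add: leading_weights_def leading_functional_def)
  have D42: "X 2 2 l = 0" if "42 \<notin> S" "l < 9" for l
    using dead[of 42 l] that by (simp add: leading_weights_def leading_functional_def)
  have D2: "X 3 3 l = 0" if "2 \<notin> S" "l < 9" for l
    using dead[of 2 l] that by (simp add: leading_weights_def leading_functional_def)
  have D6: "X 6 6 l = 0" if "6 \<notin> S" "l < 9" for l
    using dead[of 6 l] that by (simp add: leading_weights_def leading_functional_def)
  have D7: "X 1 0 l = 0" if "7 \<notin> S" "l < 9" for l
    using dead[of 7 l] that by (simp add: leading_weights_def leading_functional_def)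
  have D21: "X 2 0 l = 0" if "21 \<notin> S" "l < 9" for l
    using dead[of 21 l] that by (simp add: leading_weights_def leading_functional_def)
  have D1: "X 3 0 l = 0" if "1 \<notin> S" "l < 9" for l
    using dead[of 1 l] that by (simp add: leading_weights_def leading_functional_def)
  have D3: "X 6 0 l = 0" if "3 \<notin> S" "l < 9" for l
    using dead[of 3 l] that by (simp add: leading_weights_def leading_functional_def)
  have D28: "X 1 2 l = 0" if "28 \<notin> S" "l < 9" for l
    using dead[of 28 l] that by (simp add: leading_weights_def leading_functional_def)
  have D4: "X 3 6 l = 0" if "4 \<notin> S" "l < 9" for l
    using dead[of 4 l] that by (simp add: leading_weights_def leading_functional_def)
  have D8: "X 4 0 l = X 1 3 l" if "8 \<notin> S" "l < 9" for l
    using dead[of 8 l] that by (simp add: leading_weights_def leading_functional_def)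
  have D22: "X 5 0 l = X 2 3 l" if "22 \<notin> S" "l < 9" for l
    using dead[of 22 l] that by (simp add: leading_weights_def leading_functional_def)
  have D10: "X 7 0 l = X 1 6 l" if "10 \<notin> S" "l < 9" for l
    using dead[of 10 l] that by (simp add: leading_weights_def leading_functional_def)
  have D24: "X 8 0 l = X 2 6 l" if "24 \<notin> S" "l < 9" for l
    using dead[of 24 l] that by (simp add: leading_weights_def leading_functional_def)
  have l0: "0 < (9::nat)" and l1: "1 < (9::nat)" and l2: "2 < (9::nat)" and l3: "3 < (9::nat)" and l4: "4 < (9::nat)" and l5: "5 < (9::nat)" and l6: "6 < (9::nat)" and l7: "7 < (9::nat)" and l8: "8 < (9::nat)" by simp_all
  have act': "X i k l = 0" if "((i, k, l), c) \<in> set vanishing_conditions" "meets S c" for i k l c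
    using act that by fastforce
  have P111: "X 1 1 1 = 0"
  proof -
    have "X 1 1 1 = 0 \<or> 14 \<notin> S"
      using act'[of 1 1 1 "[[14]]"] by (auto simp: vanishing_conditions_def meets_def sym)
    moreover have "X 1 1 1 = 0" if "14 \<notin> S"
      using D14[OF that(1) l1] by (simp add: sym)
    ultimately show ?thesis by blast
  qed
  have P222: "X 2 2 2 = 0"
  proof -
    have "X 2 2 2 = 0 \<or> 42 \<notin> S"
      using act'[of 2 2 2 "[[42]]"] by (auto simp: vanishing_conditions_def meets_def sym)
    moreover have "X 2 2 2 = 0" if "42 \<notin> S"
      using D42[OF that(1) l2] by (simp add: sym)
    ultimately show ?thesis by blast
  qed
  have P333: "X 3 3 3 = 0"
  proof -
    have "X 3 3 3 = 0 \<or> 2 \<notin> S"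
      using act'[of 3 3 3 "[[2]]"] by (auto simp: vanishing_conditions_def meets_def sym)
    moreover have "X 3 3 3 = 0" if "2 \<notin> S"
      using D2[OF that(1) l3] by (simp add: sym)
    ultimately show ?thesis by blast
  qed
  have P666: "X 6 6 6 = 0"
  proof -
    have "X 6 6 6 = 0 \<or> 6 \<notin> S"
      using act'[of 6 6 6 "[[6]]"] by (auto simp: vanishing_conditions_def meets_def sym)
    moreover have "X 6 6 6 = 0" if "6 \<notin> S"
      using D6[OF that(1) l6] by (simp add: sym)
    ultimately show ?thesis by blast
  qed
  have P100: "X 1 0 0 = 0"
  proof -
    have "X 1 0 0 = 0 \<or> 7 \<notin> S"
      using act'[of 1 0 0 "[[7]]"] by (auto simp: vanishing_conditions_def meets_def sym)
    moreover have "X 1 0 0 = 0" if "7 \<notin> S"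
      using D7[OF that(1) l0] by (simp add: sym)
    ultimately show ?thesis by blast
  qed
  have P001: "X 0 0 1 = 0" using P100 by (simp add: sym)
  have P200: "X 2 0 0 = 0"
  proof -
    have "X 2 0 0 = 0 \<or> 21 \<notin> S"
      using act'[of 2 0 0 "[[21]]"] by (auto simp: vanishing_conditions_def meets_def sym)
    moreover have "X 2 0 0 = 0" if "21 \<notin> S"
      using D21[OF that(1) l0] by (simp add: sym)
    ultimately show ?thesis by blast
  qed
  have P002: "X 0 0 2 = 0" using P200 by (simp add: sym)
  have P300: "X 3 0 0 = 0"
  proof -
    have "X 3 0 0 = 0 \<or> 1 \<notin> S"
      using act'[of 3 0 0 "[[1]]"] by (auto simp: vanishing_conditions_def meets_def sym)
    moreover have "X 3 0 0 = 0" if "1 \<notin> S"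
      using D1[OF that(1) l0] by (simp add: sym)
    ultimately show ?thesis by blast
  qed
  have P003: "X 0 0 3 = 0" using P300 by (simp add: sym)
  have P600: "X 6 0 0 = 0"
  proof -
    have "X 6 0 0 = 0 \<or> 3 \<notin> S"
      using act'[of 6 0 0 "[[3]]"] by (auto simp: vanishing_conditions_def meets_def sym)
    moreover have "X 6 0 0 = 0" if "3 \<notin> S"
      using D3[OF that(1) l0] by (simp add: sym)
    ultimately show ?thesis by blast
  qed
  have P006: "X 0 0 6 = 0" using P600 by (simp add: sym)
  have P110: "X 1 1 0 = 0"
  proof -
    have "X 1 1 0 = 0 \<or> 14 \<notin> S \<or> 7 \<notin> S"
      using act'[of 1 1 0 "[[14], [7]]"] by (auto simp: vanishing_conditions_def meets_def sym)
    moreover have "X 1 1 0 = 0" if "14 \<notin> S"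
      using D14[OF that(1) l0] by (simp add: sym)
    moreover have "X 1 1 0 = 0" if "7 \<notin> S"
      using D7[OF that(1) l1] by (simp add: sym)
    ultimately show ?thesis by blast
  qed
  have P011: "X 0 1 1 = 0" using P110 by (simp add: sym)
  have P220: "X 2 2 0 = 0"
  proof -
    have "X 2 2 0 = 0 \<or> 42 \<notin> S \<or> 21 \<notin> S"
      using act'[of 2 2 0 "[[42], [21]]"] by (auto simp: vanishing_conditions_def meets_def sym)
    moreover have "X 2 2 0 = 0" if "42 \<notin> S"
      using D42[OF that(1) l0] by (simp add: sym)
    moreover have "X 2 2 0 = 0" if "21 \<notin> S"
      using D21[OF that(1) l2] by (simp add: sym)
    ultimately show ?thesis by blast
  qed
  have P022: "X 0 2 2 = 0" using P220 by (simp add: sym)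
  have P330: "X 3 3 0 = 0"
  proof -
    have "X 3 3 0 = 0 \<or> 2 \<notin> S \<or> 1 \<notin> S"
      using act'[of 3 3 0 "[[2], [1]]"] by (auto simp: vanishing_conditions_def meets_def sym)
    moreover have "X 3 3 0 = 0" if "2 \<notin> S"
      using D2[OF that(1) l0] by (simp add: sym)
    moreover have "X 3 3 0 = 0" if "1 \<notin> S"
      using D1[OF that(1) l3] by (simp add: sym)
    ultimately show ?thesis by blast
  qed
  have P033: "X 0 3 3 = 0" using P330 by (simp add: sym)
  have P660: "X 6 6 0 = 0"
  proof -
    have "X 6 6 0 = 0 \<or> 6 \<notin> S \<or> 3 \<notin> S"
      using act'[of 6 6 0 "[[6], [3]]"] by (auto simp: vanishing_conditions_def meets_def sym)
    moreover have "X 6 6 0 = 0" if "6 \<notin> S"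
      using D6[OF that(1) l0] by (simp add: sym)
    moreover have "X 6 6 0 = 0" if "3 \<notin> S"
      using D3[OF that(1) l6] by (simp add: sym)
    ultimately show ?thesis by blast
  qed
  have P066: "X 0 6 6 = 0" using P660 by (simp add: sym)
  have P112: "X 1 1 2 = 0"
  proof -
    have "X 1 1 2 = 0 \<or> 28 \<notin> S \<or> 14 \<notin> S"
      using act'[of 1 1 2 "[[28], [14]]"] by (auto simp: vanishing_conditions_def meets_def sym)
    moreover have "X 1 1 2 = 0" if "28 \<notin> S"
      using D28[OF that(1) l1] by (simp add: sym)
    moreover have "X 1 1 2 = 0" if "14 \<notin> S"
      using D14[OF that(1) l2] by (simp add: sym)
    ultimately show ?thesis by blast
  qed
  have P221: "X 2 2 1 = 0"
  proof -
    have "X 2 2 1 = 0 \<or> 28 \<notin> S \<or> 42 \<notin> S"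
      using act'[of 2 2 1 "[[28], [42]]"] by (auto simp: vanishing_conditions_def meets_def sym)
    moreover have "X 2 2 1 = 0" if "28 \<notin> S"
      using D28[OF that(1) l2] by (simp add: sym)
    moreover have "X 2 2 1 = 0" if "42 \<notin> S"
      using D42[OF that(1) l1] by (simp add: sym)
    ultimately show ?thesis by blast
  qed
  have P122: "X 1 2 2 = 0" using P221 by (simp add: sym)
  have P336: "X 3 3 6 = 0"
  proof -
    have "X 3 3 6 = 0 \<or> 4 \<notin> S \<or> 2 \<notin> S"
      using act'[of 3 3 6 "[[4], [2]]"] by (auto simp: vanishing_conditions_def meets_def sym)
    moreover have "X 3 3 6 = 0" if "4 \<notin> S"
      using D4[OF that(1) l3] by (simp add: sym)
    moreover have "X 3 3 6 = 0" if "2 \<notin> S"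
      using D2[OF that(1) l6] by (simp add: sym)
    ultimately show ?thesis by blast
  qed
  have P663: "X 6 6 3 = 0"
  proof -
    have "X 6 6 3 = 0 \<or> 4 \<notin> S \<or> 6 \<notin> S"
      using act'[of 6 6 3 "[[4], [6]]"] by (auto simp: vanishing_conditions_def meets_def sym)
    moreover have "X 6 6 3 = 0" if "4 \<notin> S"
      using D4[OF that(1) l6] by (simp add: sym)
    moreover have "X 6 6 3 = 0" if "6 \<notin> S"
      using D6[OF that(1) l3] by (simp add: sym)
    ultimately show ?thesis by blast
  qed
  have P366: "X 3 6 6 = 0" using P663 by (simp add: sym)
  have P260: "X 2 6 0 = 0"
  proof -
    have "X 2 6 0 = 0 \<or> 21 \<notin> S \<or> 3 \<notin> S"
      using act'[of 2 6 0 "[[21], [3]]"] by (auto simp: vanishing_conditions_def meets_def sym)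
    moreover have "X 2 6 0 = 0" if "21 \<notin> S"
      using D21[OF that(1) l6] by (simp add: sym)
    moreover have "X 2 6 0 = 0" if "3 \<notin> S"
      using D3[OF that(1) l2] by (simp add: sym)
    ultimately show ?thesis by blast
  qed
  have P026: "X 0 2 6 = 0" using P260 by (simp add: sym)
  have P160: "X 1 6 0 = 0"
  proof -
    have "X 1 6 0 = 0 \<or> 7 \<notin> S \<or> 3 \<notin> S"
      using act'[of 1 6 0 "[[7], [3]]"] by (auto simp: vanishing_conditions_def meets_def sym)
    moreover have "X 1 6 0 = 0" if "7 \<notin> S"
      using D7[OF that(1) l6] by (simp add: sym)
    moreover have "X 1 6 0 = 0" if "3 \<notin> S"
      using D3[OF that(1) l1] by (simp add: sym)
    ultimately show ?thesis by blast
  qed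
  have P016: "X 0 1 6 = 0" using P160 by (simp add: sym)
  have P230: "X 2 3 0 = 0"
  proof -
    have "X 2 3 0 = 0 \<or> 21 \<notin> S \<or> 1 \<notin> S"
      using act'[of 2 3 0 "[[21], [1]]"] by (auto simp: vanishing_conditions_def meets_def sym)
    moreover have "X 2 3 0 = 0" if "21 \<notin> S"
      using D21[OF that(1) l3] by (simp add: sym)
    moreover have "X 2 3 0 = 0" if "1 \<notin> S"
      using D1[OF that(1) l2] by (simp add: sym)
    ultimately show ?thesis by blast
  qed
  have P023: "X 0 2 3 = 0" using P230 by (simp add: sym)
  have P130: "X 1 3 0 = 0"
  proof -
    have "X 1 3 0 = 0 \<or> 7 \<notin> S \<or> 1 \<notin> S"
      using act'[of 1 3 0 "[[7], [1]]"] by (auto simp: vanishing_conditions_def meets_def sym)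
    moreover have "X 1 3 0 = 0" if "7 \<notin> S"
      using D7[OF that(1) l3] by (simp add: sym)
    moreover have "X 1 3 0 = 0" if "1 \<notin> S"
      using D1[OF that(1) l1] by (simp add: sym)
    ultimately show ?thesis by blast
  qed
  have P013: "X 0 1 3 = 0" using P130 by (simp add: sym)
  have P226: "X 2 2 6 = 0"
  proof -
    have "X 2 2 6 = 0 \<or> 42 \<notin> S \<or> 24 \<notin> S"
      using act'[of 2 2 6 "[[42], [24]]"] by (auto simp: vanishing_conditions_def meets_def sym)
    moreover have "X 2 2 6 = 0" if "42 \<notin> S"
      using D42[OF that(1) l6] by (simp add: sym)
    moreover have "X 2 2 6 = 0" if "24 \<notin> S"
      using D24[OF that(1) l2] Z28[OF l0] by (simp add: sym)
    ultimately show ?thesis by blast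
  qed
  have P662: "X 6 6 2 = 0"
  proof -
    have "X 6 6 2 = 0 \<or> 6 \<notin> S \<or> 24 \<notin> S"
      using act'[of 6 6 2 "[[6], [24]]"] by (auto simp: vanishing_conditions_def meets_def sym)
    moreover have "X 6 6 2 = 0" if "6 \<notin> S"
      using D6[OF that(1) l2] by (simp add: sym)
    moreover have "X 6 6 2 = 0" if "24 \<notin> S"
      using D24[OF that(1) l6] Z68[OF l0] by (simp add: sym)
    ultimately show ?thesis by blast
  qed
  have P266: "X 2 6 6 = 0" using P662 by (simp add: sym)
  have P116: "X 1 1 6 = 0"
  proof -
    have "X 1 1 6 = 0 \<or> 14 \<notin> S \<or> 10 \<notin> S"
      using act'[of 1 1 6 "[[14], [10]]"] by (auto simp: vanishing_conditions_def meets_def sym)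
    moreover have "X 1 1 6 = 0" if "14 \<notin> S"
      using D14[OF that(1) l6] by (simp add: sym)
    moreover have "X 1 1 6 = 0" if "10 \<notin> S"
      using D10[OF that(1) l1] Z17[OF l0] by (simp add: sym)
    ultimately show ?thesis by blast
  qed
  have P661: "X 6 6 1 = 0"
  proof -
    have "X 6 6 1 = 0 \<or> 6 \<notin> S \<or> 10 \<notin> S"
      using act'[of 6 6 1 "[[6], [10]]"] by (auto simp: vanishing_conditions_def meets_def sym)
    moreover have "X 6 6 1 = 0" if "6 \<notin> S"
      using D6[OF that(1) l1] by (simp add: sym)
    moreover have "X 6 6 1 = 0" if "10 \<notin> S"
      using D10[OF that(1) l6] Z67[OF l0] by (simp add: sym)
    ultimately show ?thesis by blast
  qed
  have P166: "X 1 6 6 = 0" using P661 by (simp add: sym)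
  have P223: "X 2 2 3 = 0"
  proof -
    have "X 2 2 3 = 0 \<or> 42 \<notin> S \<or> 22 \<notin> S"
      using act'[of 2 2 3 "[[42], [22]]"] by (auto simp: vanishing_conditions_def meets_def sym)
    moreover have "X 2 2 3 = 0" if "42 \<notin> S"
      using D42[OF that(1) l3] by (simp add: sym)
    moreover have "X 2 2 3 = 0" if "22 \<notin> S"
      using D22[OF that(1) l2] Z25[OF l0] by (simp add: sym)
    ultimately show ?thesis by blast
  qed
  have P332: "X 3 3 2 = 0"
  proof -
    have "X 3 3 2 = 0 \<or> 2 \<notin> S \<or> 22 \<notin> S"
      using act'[of 3 3 2 "[[2], [22]]"] by (auto simp: vanishing_conditions_def meets_def sym)
    moreover have "X 3 3 2 = 0" if "2 \<notin> S"
      using D2[OF that(1) l2] by (simp add: sym)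
    moreover have "X 3 3 2 = 0" if "22 \<notin> S"
      using D22[OF that(1) l3] Z35[OF l0] by (simp add: sym)
    ultimately show ?thesis by blast
  qed
  have P233: "X 2 3 3 = 0" using P332 by (simp add: sym)
  have P113: "X 1 1 3 = 0"
  proof -
    have "X 1 1 3 = 0 \<or> 14 \<notin> S \<or> 8 \<notin> S"
      using act'[of 1 1 3 "[[14], [8]]"] by (auto simp: vanishing_conditions_def meets_def sym)
    moreover have "X 1 1 3 = 0" if "14 \<notin> S"
      using D14[OF that(1) l3] by (simp add: sym)
    moreover have "X 1 1 3 = 0" if "8 \<notin> S"
      using D8[OF that(1) l1] Z14[OF l0] by (simp add: sym)
    ultimately show ?thesis by blast
  qed
  have P331: "X 3 3 1 = 0"
  proof -
    have "X 3 3 1 = 0 \<or> 2 \<notin> S \<or> 8 \<notin> S"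
      using act'[of 3 3 1 "[[2], [8]]"] by (auto simp: vanishing_conditions_def meets_def sym)
    moreover have "X 3 3 1 = 0" if "2 \<notin> S"
      using D2[OF that(1) l1] by (simp add: sym)
    moreover have "X 3 3 1 = 0" if "8 \<notin> S"
      using D8[OF that(1) l3] Z34[OF l0] by (simp add: sym)
    ultimately show ?thesis by blast
  qed
  have P133: "X 1 3 3 = 0" using P331 by (simp add: sym)
  have P120: "X 1 2 0 = 0"
  proof -
    have "X 1 2 0 = 0 \<or> 7 \<notin> S \<or> 21 \<notin> S \<or> 28 \<notin> S"
      using act'[of 1 2 0 "[[7], [21], [28]]"] by (auto simp: vanishing_conditions_def meets_def sym)
    moreover have "X 1 2 0 = 0" if "7 \<notin> S"
      using D7[OF that(1) l2] by (simp add: sym)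
    moreover have "X 1 2 0 = 0" if "21 \<notin> S"
      using D21[OF that(1) l1] by (simp add: sym)
    moreover have "X 1 2 0 = 0" if "28 \<notin> S"
      using D28[OF that(1) l0] by (simp add: sym)
    ultimately show ?thesis by blast
  qed
  have P012: "X 0 1 2 = 0" using P120 by (simp add: sym)
  have P360: "X 3 6 0 = 0"
  proof -
    have "X 3 6 0 = 0 \<or> 1 \<notin> S \<or> 3 \<notin> S \<or> 4 \<notin> S"
      using act'[of 3 6 0 "[[1], [3], [4]]"] by (auto simp: vanishing_conditions_def meets_def sym)
    moreover have "X 3 6 0 = 0" if "1 \<notin> S"
      using D1[OF that(1) l6] by (simp add: sym)
    moreover have "X 3 6 0 = 0" if "3 \<notin> S"
      using D3[OF that(1) l3] by (simp add: sym)
    moreover have "X 3 6 0 = 0" if "4 \<notin> S"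
      using D4[OF that(1) l0] by (simp add: sym)
    ultimately show ?thesis by blast
  qed
  have P036: "X 0 3 6 = 0" using P360 by (simp add: sym)
  have P180: "X 1 8 0 = 0"
  proof -
    have "X 1 8 0 = 0 \<or> 7 \<notin> S \<or> 21 \<notin> S \<or> 10 \<notin> S \<and> 28 \<notin> S \<or> 24 \<notin> S \<and> 28 \<notin> S"
      using act'[of 1 8 0 "[[7], [21], [10, 28], [24, 28]]"] by (auto simp: vanishing_conditions_def meets_def sym)
    moreover have "X 1 8 0 = 0" if "7 \<notin> S"
      using D7[OF that(1) l8] by (simp add: sym)
    moreover have "X 1 8 0 = 0" if "21 \<notin> S"
      using C18[OF l0] D21[OF that(1) l7] by (simp add: sym)
    moreover have "X 1 8 0 = 0" if "10 \<notin> S" "28 \<notin> S"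
      using C18[OF l0] D10[OF that(1) l2] D28[OF that(2) l6] by (simp add: sym)
    moreover have "X 1 8 0 = 0" if "24 \<notin> S" "28 \<notin> S"
      using D24[OF that(1) l1] D28[OF that(2) l6] by (simp add: sym)
    ultimately show ?thesis by blast
  qed
  have P018: "X 0 1 8 = 0" using P180 by (simp add: sym)
  \<comment> \<open>With 10 or 24 outside \<open>S\<close>, this coordinate equals
    \<open>X 1 8 0\<close>, which is why that one is settled first; 1 2 3, 3 6 2 and 3 6 1 below
    follow the same pattern.\<close>
  have P126: "X 1 2 6 = 0"
  proof -
    have "X 1 2 6 = 0 \<or> 10 \<notin> S \<or> 24 \<notin> S \<or> 28 \<notin> S"
      using act'[of 1 2 6 "[[10], [24], [28]]"] by (auto simp: vanishing_conditions_def meets_def sym)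
    moreover have "X 1 2 6 = 0" if "10 \<notin> S"
      using C18[OF l0] D10[OF that(1) l2] P018 by (simp add: sym)
    moreover have "X 1 2 6 = 0" if "24 \<notin> S"
      using D24[OF that(1) l1] P018 by (simp add: sym)
    moreover have "X 1 2 6 = 0" if "28 \<notin> S"
      using D28[OF that(1) l6] by (simp add: sym)
    ultimately show ?thesis by blast
  qed
  have P150: "X 1 5 0 = 0"
  proof -
    have "X 1 5 0 = 0 \<or> 7 \<notin> S \<or> 21 \<notin> S \<or> 8 \<notin> S \<and> 28 \<notin> S \<or> 22 \<notin> S \<and> 28 \<notin> S"
      using act'[of 1 5 0 "[[7], [21], [8, 28], [22, 28]]"] by (auto simp: vanishing_conditions_def meets_def sym)
    moreover have "X 1 5 0 = 0" if "7 \<notin> S"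
      using D7[OF that(1) l5] by (simp add: sym)
    moreover have "X 1 5 0 = 0" if "21 \<notin> S"
      using C15[OF l0] D21[OF that(1) l4] by (simp add: sym)
    moreover have "X 1 5 0 = 0" if "8 \<notin> S" "28 \<notin> S"
      using C15[OF l0] D8[OF that(1) l2] D28[OF that(2) l3] by (simp add: sym)
    moreover have "X 1 5 0 = 0" if "22 \<notin> S" "28 \<notin> S"
      using D22[OF that(1) l1] D28[OF that(2) l3] by (simp add: sym)
    ultimately show ?thesis by blast
  qed
  have P015: "X 0 1 5 = 0" using P150 by (simp add: sym)
  have P123: "X 1 2 3 = 0"
  proof -
    have "X 1 2 3 = 0 \<or> 8 \<notin> S \<or> 22 \<notin> S \<or> 28 \<notin> S"
      using act'[of 1 2 3 "[[8], [22], [28]]"] by (auto simp: vanishing_conditions_def meets_def sym)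
    moreover have "X 1 2 3 = 0" if "8 \<notin> S"
      using C15[OF l0] D8[OF that(1) l2] P015 by (simp add: sym)
    moreover have "X 1 2 3 = 0" if "22 \<notin> S"
      using D22[OF that(1) l1] P015 by (simp add: sym)
    moreover have "X 1 2 3 = 0" if "28 \<notin> S"
      using D28[OF that(1) l3] by (simp add: sym)
    ultimately show ?thesis by blast
  qed
  have P380: "X 3 8 0 = 0"
  proof -
    have "X 3 8 0 = 0 \<or> 1 \<notin> S \<or> 3 \<notin> S \<or> 22 \<notin> S \<and> 4 \<notin> S \<or> 24 \<notin> S \<and> 4 \<notin> S"
      using act'[of 3 8 0 "[[1], [3], [22, 4], [24, 4]]"] by (auto simp: vanishing_conditions_def meets_def sym)
    moreover have "X 3 8 0 = 0" if "1 \<notin> S"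
      using D1[OF that(1) l8] by (simp add: sym)
    moreover have "X 3 8 0 = 0" if "3 \<notin> S"
      using C38[OF l0] D3[OF that(1) l5] by (simp add: sym)
    moreover have "X 3 8 0 = 0" if "22 \<notin> S" "4 \<notin> S"
      using C38[OF l0] D22[OF that(1) l6] D4[OF that(2) l2] by (simp add: sym)
    moreover have "X 3 8 0 = 0" if "24 \<notin> S" "4 \<notin> S"
      using D24[OF that(1) l3] D4[OF that(2) l2] by (simp add: sym)
    ultimately show ?thesis by blast
  qed
  have P038: "X 0 3 8 = 0" using P380 by (simp add: sym)
  have P362: "X 3 6 2 = 0"
  proof -
    have "X 3 6 2 = 0 \<or> 22 \<notin> S \<or> 24 \<notin> S \<or> 4 \<notin> S"
      using act'[of 3 6 2 "[[22], [24], [4]]"] by (auto simp: vanishing_conditions_def meets_def sym)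
    moreover have "X 3 6 2 = 0" if "22 \<notin> S"
      using C38[OF l0] D22[OF that(1) l6] P038 by (simp add: sym)
    moreover have "X 3 6 2 = 0" if "24 \<notin> S"
      using D24[OF that(1) l3] P038 by (simp add: sym)
    moreover have "X 3 6 2 = 0" if "4 \<notin> S"
      using D4[OF that(1) l2] by (simp add: sym)
    ultimately show ?thesis by blast
  qed
  have P236: "X 2 3 6 = 0" using P362 by (simp add: sym)
  have P370: "X 3 7 0 = 0"
  proof -
    have "X 3 7 0 = 0 \<or> 1 \<notin> S \<or> 3 \<notin> S \<or> 8 \<notin> S \<and> 4 \<notin> S \<or> 10 \<notin> S \<and> 4 \<notin> S"
      using act'[of 3 7 0 "[[1], [3], [8, 4], [10, 4]]"] by (auto simp: vanishing_conditions_def meets_def sym)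
    moreover have "X 3 7 0 = 0" if "1 \<notin> S"
      using D1[OF that(1) l7] by (simp add: sym)
    moreover have "X 3 7 0 = 0" if "3 \<notin> S"
      using C37[OF l0] D3[OF that(1) l4] by (simp add: sym)
    moreover have "X 3 7 0 = 0" if "8 \<notin> S" "4 \<notin> S"
      using C37[OF l0] D8[OF that(1) l6] D4[OF that(2) l1] by (simp add: sym)
    moreover have "X 3 7 0 = 0" if "10 \<notin> S" "4 \<notin> S"
      using D10[OF that(1) l3] D4[OF that(2) l1] by (simp add: sym)
    ultimately show ?thesis by blast
  qed
  have P037: "X 0 3 7 = 0" using P370 by (simp add: sym)
  have P361: "X 3 6 1 = 0"
  proof -
    have "X 3 6 1 = 0 \<or> 8 \<notin> S \<or> 10 \<notin> S \<or> 4 \<notin> S"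
      using act'[of 3 6 1 "[[8], [10], [4]]"] by (auto simp: vanishing_conditions_def meets_def sym)
    moreover have "X 3 6 1 = 0" if "8 \<notin> S"
      using C37[OF l0] D8[OF that(1) l6] P037 by (simp add: sym)
    moreover have "X 3 6 1 = 0" if "10 \<notin> S"
      using D10[OF that(1) l3] P037 by (simp add: sym)
    moreover have "X 3 6 1 = 0" if "4 \<notin> S"
      using D4[OF that(1) l1] by (simp add: sym)
    ultimately show ?thesis by blast
  qed
  have P136: "X 1 3 6 = 0" using P361 by (simp add: sym)
  \<comment> \<open>The positions 1, 5, 6 form a transversal. The tensor itself is a symmetric form
    whose slices lie in \<open>ideal_space\<close> and are killed by all functionals, so it must be
    excluded by a condition imposed whatever \<open>S\<close> is.\<close>
  have P156: "X 1 5 6 = 0"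
  proof -
    show ?thesis using act'[of 1 5 6 "[]"] by (simp add: vanishing_conditions_def meets_def)
  qed
  \<comment> \<open>Any one of the four weights missing from \<open>S\<close> links this coordinate
    to \<open>X 1 5 6\<close> through a chain of transversals.\<close>
  have P480: "X 4 8 0 = 0"
  proof -
    have "X 4 8 0 = 0 \<or> 8 \<notin> S \<or> 22 \<notin> S \<or> 10 \<notin> S \<or> 24 \<notin> S"
      using act'[of 4 8 0 "[[8], [22], [10], [24]]"] by (auto simp: vanishing_conditions_def meets_def sym)
    moreover have "X 4 8 0 = 0" if "8 \<notin> S"
      using C38[OF l1] D8[OF that(1) l8] P156 by (simp add: sym)
    moreover have "X 4 8 0 = 0" if "22 \<notin> S"
      using C38[OF l1] C48[OF l0] C18[OF l3] D22[OF that(1) l7] P156 by (simp add: sym)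
    moreover have "X 4 8 0 = 0" if "10 \<notin> S"
      using C48[OF l0] D10[OF that(1) l5] P156 by (simp add: sym)
    moreover have "X 4 8 0 = 0" if "24 \<notin> S"
      using D24[OF that(1) l4] C15[OF l6] P156 by (simp add: sym)
    ultimately show ?thesis by blast
  qed
  have P048: "X 0 4 8 = 0" using P480 by (simp add: sym)
  have P400: "X 4 0 0 = 0"
  proof -
    have "X 4 0 0 = 0 \<or> 8 \<notin> S"
      using act'[of 4 0 0 "[[8]]"] by (auto simp: vanishing_conditions_def meets_def sym)
    moreover have "X 4 0 0 = 0" if "8 \<notin> S"
      using D8[OF that(1) l0] P013 by (simp add: sym)
    ultimately show ?thesis by blast
  qed
  have P004: "X 0 0 4 = 0" using P400 by (simp add: sym)
  have P500: "X 5 0 0 = 0"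
  proof -
    have "X 5 0 0 = 0 \<or> 22 \<notin> S"
      using act'[of 5 0 0 "[[22]]"] by (auto simp: vanishing_conditions_def meets_def sym)
    moreover have "X 5 0 0 = 0" if "22 \<notin> S"
      using D22[OF that(1) l0] P023 by (simp add: sym)
    ultimately show ?thesis by blast
  qed
  have P005: "X 0 0 5 = 0" using P500 by (simp add: sym)
  have P700: "X 7 0 0 = 0"
  proof -
    have "X 7 0 0 = 0 \<or> 10 \<notin> S"
      using act'[of 7 0 0 "[[10]]"] by (auto simp: vanishing_conditions_def meets_def sym)
    moreover have "X 7 0 0 = 0" if "10 \<notin> S"
      using D10[OF that(1) l0] P016 by (simp add: sym)
    ultimately show ?thesis by blast
  qed
  have P007: "X 0 0 7 = 0" using P700 by (simp add: sym)
  have P800: "X 8 0 0 = 0"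
  proof -
    have "X 8 0 0 = 0 \<or> 24 \<notin> S"
      using act'[of 8 0 0 "[[24]]"] by (auto simp: vanishing_conditions_def meets_def sym)
    moreover have "X 8 0 0 = 0" if "24 \<notin> S"
      using D24[OF that(1) l0] P026 by (simp add: sym)
    ultimately show ?thesis by blast
  qed
  have P008: "X 0 0 8 = 0" using P800 by (simp add: sym)
  have P014: "X 0 1 4 = 0"
    using Z14[OF l0] by (simp add: sym)
  have P017: "X 0 1 7 = 0"
    using Z17[OF l0] by (simp add: sym)
  have P024: "X 0 2 4 = 0"
    using C15[OF l0] P015 by (simp add: sym)
  have P025: "X 0 2 5 = 0"
    using Z25[OF l0] by (simp add: sym)
  have P027: "X 0 2 7 = 0"
    using C18[OF l0] P018 by (simp add: sym)
  have P028: "X 0 2 8 = 0"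
    using Z28[OF l0] by (simp add: sym)
  have P034: "X 0 3 4 = 0"
    using Z34[OF l0] by (simp add: sym)
  have P035: "X 0 3 5 = 0"
    using Z35[OF l0] by (simp add: sym)
  have P044: "X 0 4 4 = 0"
    using Z44[OF l0] by (simp add: sym)
  have P045: "X 0 4 5 = 0"
    using Z45[OF l0] by (simp add: sym)
  have P046: "X 0 4 6 = 0"
    using C37[OF l0] P037 by (simp add: sym)
  have P047: "X 0 4 7 = 0"
    using Z47[OF l0] by (simp add: sym)
  have P055: "X 0 5 5 = 0"
    using Z55[OF l0] by (simp add: sym)
  have P056: "X 0 5 6 = 0"
    using C38[OF l0] P038 by (simp add: sym)
  have P057: "X 0 5 7 = 0"
    using C48[OF l0] P048 by (simp add: sym)
  have P058: "X 0 5 8 = 0"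
    using Z58[OF l0] by (simp add: sym)
  have P067: "X 0 6 7 = 0"
    using Z67[OF l0] by (simp add: sym)
  have P068: "X 0 6 8 = 0"
    using Z68[OF l0] by (simp add: sym)
  have P077: "X 0 7 7 = 0"
    using Z77[OF l0] by (simp add: sym)
  have P078: "X 0 7 8 = 0"
    using Z78[OF l0] by (simp add: sym)
  have P088: "X 0 8 8 = 0"
    using Z88[OF l0] by (simp add: sym)
  have P114: "X 1 1 4 = 0"
    using Z14[OF l1] by (simp add: sym)
  have P115: "X 1 1 5 = 0"
    using C15[OF l1] Z14[OF l2] by (simp add: sym)
  have P117: "X 1 1 7 = 0"
    using Z17[OF l1] by (simp add: sym)
  have P118: "X 1 1 8 = 0"
    using C18[OF l1] Z17[OF l2] by (simp add: sym)
  have P124: "X 1 2 4 = 0"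
    using Z14[OF l2] by (simp add: sym)
  have P125: "X 1 2 5 = 0"
    using Z25[OF l1] by (simp add: sym)
  have P127: "X 1 2 7 = 0"
    using Z17[OF l2] by (simp add: sym)
  have P128: "X 1 2 8 = 0"
    using Z28[OF l1] by (simp add: sym)
  have P134: "X 1 3 4 = 0"
    using Z34[OF l1] by (simp add: sym)
  have P135: "X 1 3 5 = 0"
    using Z35[OF l1] by (simp add: sym)
  have P137: "X 1 3 7 = 0"
    using Z17[OF l3] by (simp add: sym)
  have P138: "X 1 3 8 = 0"
    using C38[OF l1] P156 by (simp add: sym)
  have P144: "X 1 4 4 = 0"
    using Z44[OF l1] by (simp add: sym)
  have P145: "X 1 4 5 = 0"
    using Z14[OF l5] by (simp add: sym)
  have P146: "X 1 4 6 = 0"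
    using Z14[OF l6] by (simp add: sym)
  have P147: "X 1 4 7 = 0"
    using Z17[OF l4] by (simp add: sym)
  have P148: "X 1 4 8 = 0"
    using Z14[OF l8] by (simp add: sym)
  have P155: "X 1 5 5 = 0"
    using Z55[OF l1] by (simp add: sym)
  have P157: "X 1 5 7 = 0"
    using Z17[OF l5] by (simp add: sym)
  have P158: "X 1 5 8 = 0"
    using Z58[OF l1] by (simp add: sym)
  have P167: "X 1 6 7 = 0"
    using Z67[OF l1] by (simp add: sym)
  have P168: "X 1 6 8 = 0"
    using Z68[OF l1] by (simp add: sym)
  have P177: "X 1 7 7 = 0"
    using Z77[OF l1] by (simp add: sym)
  have P178: "X 1 7 8 = 0"
    using Z17[OF l8] by (simp add: sym)
  have P188: "X 1 8 8 = 0"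
    using Z88[OF l1] by (simp add: sym)
  have P224: "X 2 2 4 = 0"
    using C15[OF l2] P125 by (simp add: sym)
  have P225: "X 2 2 5 = 0"
    using Z25[OF l2] by (simp add: sym)
  have P227: "X 2 2 7 = 0"
    using C18[OF l2] P128 by (simp add: sym)
  have P228: "X 2 2 8 = 0"
    using Z28[OF l2] by (simp add: sym)
  have P234: "X 2 3 4 = 0"
    using Z34[OF l2] by (simp add: sym)
  have P235: "X 2 3 5 = 0"
    using Z35[OF l2] by (simp add: sym)
  have P237: "X 2 3 7 = 0"
    using C18[OF l3] P138 by (simp add: sym)
  have P238: "X 2 3 8 = 0"
    using Z28[OF l3] by (simp add: sym)
  have P244: "X 2 4 4 = 0"
    using Z44[OF l2] by (simp add: sym)
  have P245: "X 2 4 5 = 0"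
    using Z25[OF l4] by (simp add: sym)
  have P246: "X 2 4 6 = 0"
    using C15[OF l6] P156 by (simp add: sym)
  have P247: "X 2 4 7 = 0"
    using Z47[OF l2] by (simp add: sym)
  have P248: "X 2 4 8 = 0"
    using Z28[OF l4] by (simp add: sym)
  have P255: "X 2 5 5 = 0"
    using Z55[OF l2] by (simp add: sym)
  have P256: "X 2 5 6 = 0"
    using Z25[OF l6] by (simp add: sym)
  have P257: "X 2 5 7 = 0"
    using Z25[OF l7] by (simp add: sym)
  have P258: "X 2 5 8 = 0"
    using Z28[OF l5] by (simp add: sym)
  have P267: "X 2 6 7 = 0"
    using Z67[OF l2] by (simp add: sym)
  have P268: "X 2 6 8 = 0"
    using Z68[OF l2] by (simp add: sym)
  have P277: "X 2 7 7 = 0"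
    using Z77[OF l2] by (simp add: sym)
  have P278: "X 2 7 8 = 0"
    using Z28[OF l7] by (simp add: sym)
  have P288: "X 2 8 8 = 0"
    using Z88[OF l2] by (simp add: sym)
  have P334: "X 3 3 4 = 0"
    using Z34[OF l3] by (simp add: sym)
  have P335: "X 3 3 5 = 0"
    using Z35[OF l3] by (simp add: sym)
  have P337: "X 3 3 7 = 0"
    using C37[OF l3] Z34[OF l6] by (simp add: sym)
  have P338: "X 3 3 8 = 0"
    using C38[OF l3] Z35[OF l6] by (simp add: sym)
  have P344: "X 3 4 4 = 0"
    using Z44[OF l3] by (simp add: sym)
  have P345: "X 3 4 5 = 0"
    using Z35[OF l4] by (simp add: sym)
  have P346: "X 3 4 6 = 0"
    using Z34[OF l6] by (simp add: sym)
  have P347: "X 3 4 7 = 0"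
    using Z34[OF l7] by (simp add: sym)
  have P348: "X 3 4 8 = 0"
    using Z34[OF l8] by (simp add: sym)
  have P355: "X 3 5 5 = 0"
    using Z55[OF l3] by (simp add: sym)
  have P356: "X 3 5 6 = 0"
    using Z35[OF l6] by (simp add: sym)
  have P357: "X 3 5 7 = 0"
    using Z35[OF l7] by (simp add: sym)
  have P358: "X 3 5 8 = 0"
    using Z35[OF l8] by (simp add: sym)
  have P367: "X 3 6 7 = 0"
    using Z67[OF l3] by (simp add: sym)
  have P368: "X 3 6 8 = 0"
    using Z68[OF l3] by (simp add: sym)
  have P377: "X 3 7 7 = 0"
    using Z77[OF l3] by (simp add: sym)
  have P378: "X 3 7 8 = 0"
    using Z78[OF l3] by (simp add: sym)
  have P388: "X 3 8 8 = 0"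
    using Z88[OF l3] by (simp add: sym)
  have P444: "X 4 4 4 = 0"
    using Z44[OF l4] by (simp add: sym)
  have P445: "X 4 4 5 = 0"
    using Z45[OF l4] by (simp add: sym)
  have P446: "X 4 4 6 = 0"
    using Z44[OF l6] by (simp add: sym)
  have P447: "X 4 4 7 = 0"
    using Z47[OF l4] by (simp add: sym)
  have P448: "X 4 4 8 = 0"
    using Z44[OF l8] by (simp add: sym)
  have P455: "X 4 5 5 = 0"
    using Z55[OF l4] by (simp add: sym)
  have P456: "X 4 5 6 = 0"
    using Z45[OF l6] by (simp add: sym)
  have P457: "X 4 5 7 = 0"
    using Z45[OF l7] by (simp add: sym)
  have P458: "X 4 5 8 = 0"
    using Z45[OF l8] by (simp add: sym)
  have P466: "X 4 6 6 = 0"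
    using C37[OF l6] P367 by (simp add: sym)
  have P467: "X 4 6 7 = 0"
    using Z47[OF l6] by (simp add: sym)
  have P468: "X 4 6 8 = 0"
    using Z68[OF l4] by (simp add: sym)
  have P477: "X 4 7 7 = 0"
    using Z77[OF l4] by (simp add: sym)
  have P478: "X 4 7 8 = 0"
    using Z47[OF l8] by (simp add: sym)
  have P488: "X 4 8 8 = 0"
    using Z88[OF l4] by (simp add: sym)
  have P555: "X 5 5 5 = 0"
    using Z55[OF l5] by (simp add: sym)
  have P556: "X 5 5 6 = 0"
    using Z55[OF l6] by (simp add: sym)
  have P557: "X 5 5 7 = 0"
    using Z55[OF l7] by (simp add: sym)
  have P558: "X 5 5 8 = 0"
    using Z58[OF l5] by (simp add: sym)
  have P566: "X 5 6 6 = 0"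
    using C38[OF l6] P368 by (simp add: sym)
  have P567: "X 5 6 7 = 0"
    using Z67[OF l5] by (simp add: sym)
  have P568: "X 5 6 8 = 0"
    using Z58[OF l6] by (simp add: sym)
  have P577: "X 5 7 7 = 0"
    using Z77[OF l5] by (simp add: sym)
  have P578: "X 5 7 8 = 0"
    using Z58[OF l7] by (simp add: sym)
  have P588: "X 5 8 8 = 0"
    using Z88[OF l5] by (simp add: sym)
  have P667: "X 6 6 7 = 0"
    using Z67[OF l6] by (simp add: sym)
  have P668: "X 6 6 8 = 0"
    using Z68[OF l6] by (simp add: sym)
  have P677: "X 6 7 7 = 0"
    using Z77[OF l6] by (simp add: sym)
  have P678: "X 6 7 8 = 0"
    using Z68[OF l7] by (simp add: sym)
  have P688: "X 6 8 8 = 0"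
    using Z88[OF l6] by (simp add: sym)
  have P777: "X 7 7 7 = 0"
    using Z77[OF l7] by (simp add: sym)
  have P778: "X 7 7 8 = 0"
    using Z78[OF l7] by (simp add: sym)
  have P788: "X 7 8 8 = 0"
    using Z88[OF l7] by (simp add: sym)
  have P888: "X 8 8 8 = 0"
    using Z88[OF l8] by (simp add: sym)
  \<comment> \<open>For sorted indices, \<open>l \<noteq> 0\<close> leaves out exactly the
    coordinate 0 0 0, which the assumption on \<open>i\<close> excludes from the claim.\<close>
  have "\<forall>i<9. \<forall>k<9. \<forall>l<9. i \<le> k \<longrightarrow> k \<le> l \<longrightarrow> l \<noteq> 0 \<longrightarrow> X i k l = 0"
    unfolding ball_less_9 by (simp del: One_nat_def add: P001 P002 P003 P004 P005 P006 P007 P008 P011 P012 P013 P014 P015 P016 P017 P018 P022 P023 P024 P025 P026 P027 P028 P033 P034 P035 P036 P037 P038 P044 P045 P046 P047 P048 P055 P056 P057 P058 P066 P067 P068 P077 P078 P088 P111 P112 P113 P114 P115 P116 P117 P118 P122 P123 P124 P125 P126 P127 P128 P133 P134 P135 P136 P137 P138 P144 P145 P146 P147 P148 P155 P156 P157 P158 P166 P167 P168 P177 P178 P188 P222 P223 P224 P225 P226 P227 P228 P233 P234 P235 P236 P237 P238 P244 P245 P246 P247 P248 P255 P256 P257 P258 P266 P267 P268 P277 P278 P288 P333 P334 P335 P336 P337 P338 P344 P345 P346 P347 P348 P355 P356 P357 P358 P366 P367 P368 P377 P378 P388 P444 P445 P446 P447 P448 P455 P456 P457 P458 P466 P467 P468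 P477 P478 P488 P555 P556 P557 P558 P566 P567 P568 P577 P578 P588 P666 P667 P668 P677 P678 P688 P777 P778 P788 P888)
  then have sorted: "X i k l = 0" if "i \<le> k" "k \<le> l" "l < 9" "l \<noteq> 0" for i k l
    using that by simp
  consider "i \<le> k" "k \<le> l" | "i \<le> l" "l \<le> k" | "k \<le> i" "i \<le> l" | "k \<le> l" "l \<le> i" | "l \<le> i" "i \<le> k" | "l \<le> k" "k \<le> i"
    by linarith
  then show ?thesis
    using ikl sorted[of i k l] sorted[of i l k] sorted[of k i l] sorted[of k l i] sorted[of l i k] sorted[of l k i]
      sym(1)[of i k l] sym(2)[of i k l] sym(1)[of i l k] sym(2)[of k i l] sym(1)[of k l i]
    by cases auto
qed

section \<open>No approximation by 14 terms\<close>

text \<open>A matrix \<open>a s\<close> times \<open>c s\<close> that depends on its predecessors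
  can be absorbed: its \<open>b\<close>-vector is distributed over them, and its place is taken by a
  new independent matrix with \<open>b\<close>-vector 0. Independence later ensures that nonzero
  coefficients give a nonzero cubic form.\<close>

lemma independent_representation:
  fixes a b c :: "nat \<Rightarrow> nat \<Rightarrow> complex" and m :: nat
  assumes "m \<le> 14"
  shows "\<exists>a' b' c' :: nat \<Rightarrow> nat \<Rightarrow> complex.
    (\<forall>i\<in>{1..8}. \<forall>j. \<forall>k<9. (\<Sum>s<14. a' s i * b' s j * c' s k) = (\<Sum>s<14. a s i * b s j * c s k)) \<and>
    (\<forall>x. (\<forall>i\<in>{1..8}. \<forall>k<9. (\<Sum>s<m. x s * a' s i * c' s k) = 0) \<longrightarrow> (\<forall>s<m. x s = 0))"
  using assms
proof (induction m)
  case 0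
  show ?case by (intro exI[of _ a] exI[of _ b] exI[of _ c]) simp
next
  case (Suc m)
  then obtain a' b' c' :: "nat \<Rightarrow> nat \<Rightarrow> complex" where
    rep: "\<forall>i\<in>{1..8}. \<forall>j. \<forall>k<9. (\<Sum>s<14. a' s i * b' s j * c' s k) = (\<Sum>s<14. a s i * b s j * c s k)"
    and indep: "\<And>x. \<forall>i\<in>{1..8}. \<forall>k<9. (\<Sum>s<m. x s * a' s i * c' s k) = 0 \<Longrightarrow> \<forall>s<m. x s = 0"
    using Suc_leD by blast
  show ?case
  proof (cases "\<forall>x. (\<forall>i\<in>{1..8}. \<forall>k<9. (\<Sum>s<Suc m. x s * a' s i * c' s k) = 0) \<longrightarrow> (\<forall>s<Suc m. x s = 0)")
    case True
    with rep show ?thesis by blast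
  next
    case False
    then obtain x where x: "\<forall>i\<in>{1..8}. \<forall>k<9. (\<Sum>s<Suc m. x s * a' s i * c' s k) = 0" "\<not> (\<forall>s<Suc m. x s = 0)"
      by blast
    have xm: "x m \<noteq> 0"
    proof
      assume 0: "x m = 0"
      have "\<forall>s<m. x s = 0" by (rule indep) (use x(1) 0 in simp)
      with 0 x(2) show False by (simp add: less_Suc_eq)
    qed
    \<comment> \<open>At most 13 matrices in a space of dimension 8 * 9 = 72: some functional kills
      them all but not the unit matrix at \<open>(p, q)\<close>, which is therefore independent of
      them.\<close>
    have "\<exists>\<phi>. (\<exists>q\<in>{1..8} \<times> {..<9}. \<phi> q \<noteq> 0) \<and>
      (\<forall>s\<in>{..<m}. (\<Sum>q\<in>{1..8} \<times> {..<9}. (a' s (fst q) * c' s (snd q)) * \<phi> q) = 0)"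
      by (rule nontrivial_solution) (use Suc.prems in simp_all)
    then obtain \<phi> p q where \<phi>: "p \<in> {1..8}" "q < 9" "\<phi> (p, q) \<noteq> 0"
      "\<And>s. s < m \<Longrightarrow> (\<Sum>r\<in>{1..8} \<times> {..<9}. (a' s (fst r) * c' s (snd r)) * \<phi> r) = 0"
      by auto
    define a'' where "a'' = a'(m := \<lambda>i. of_bool (i = p))"
    define c'' where "c'' = c'(m := \<lambda>k. of_bool (k = q))"
    define b'' where "b'' = (\<lambda>s j. if s < m then b' s j - x s / x m * b' m j else if s = m then 0 else b' s j)"
    have eq: "(\<Sum>s<14. a'' s i * b'' s j * c'' s k) = (\<Sum>s<14. a' s i * b' s j * c' s k)"
      if ik: "i \<in> {1..8}" "k < 9" for i j k
    proof -
      have "a' s i * b' s j * c' s k - a'' s i * b'' s j * c'' s k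
        = (if s < Suc m then b' m j / x m * (x s * a' s i * c' s k) else 0)" for s
        using xm by (auto simp: a''_def b''_def c''_def algebra_simps)
      then have "(\<Sum>s<14. a' s i * b' s j * c' s k) - (\<Sum>s<14. a'' s i * b'' s j * c'' s k)
        = (\<Sum>s<14. if s < Suc m then b' m j / x m * (x s * a' s i * c' s k) else 0)"
        by (simp add: sum_subtractf[symmetric])
      also have "\<dots> = (\<Sum>s<Suc m. b' m j / x m * (x s * a' s i * c' s k))"
        using Suc.prems by (intro sum.mono_neutral_cong_right) auto
      also have "\<dots> = 0"
        using x(1) ik unfolding sum_distrib_left[symmetric] by simp
      finally show ?thesis by simp
    qed
    have indep': "\<forall>s<Suc m. y s = 0"
      if y: "\<forall>i\<in>{1..8}. \<forall>k<9. (\<Sum>s<Suc m. y s * a'' s i * c'' s k) = 0" for y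
    proof -
      have y': "(\<Sum>s<m. y s * (a' s i * c' s k)) + y m * of_bool ((i, k) = (p, q)) = 0"
        if "i \<in> {1..8}" "k < 9" for i k
        using y that by (simp add: a''_def c''_def mult.assoc of_bool_conj)
      have "0 = (\<Sum>r\<in>{1..8} \<times> {..<9}. ((\<Sum>s<m. y s * (a' s (fst r) * c' s (snd r))) + y m * of_bool (r = (p, q))) * \<phi> r)"
        by (intro sum.neutral[symmetric] ballI) (use y' in force)
      also have "\<dots> = (\<Sum>r\<in>{1..8} \<times> {..<9}. \<Sum>s<m. y s * ((a' s (fst r) * c' s (snd r)) * \<phi> r))
          + (\<Sum>r\<in>{1..8} \<times> {..<9}. if r = (p, q) then y m * \<phi> r else 0)"
        unfolding sum.distrib[symmetric] by (intro sum.cong) (auto simp: distrib_right sum_distrib_right mult.assoc)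
      also have "(\<Sum>r\<in>{1..8} \<times> {..<9}. \<Sum>s<m. y s * ((a' s (fst r) * c' s (snd r)) * \<phi> r))
          = (\<Sum>s<m. y s * (\<Sum>r\<in>{1..8} \<times> {..<9}. (a' s (fst r) * c' s (snd r)) * \<phi> r))"
        by (subst sum.swap) (simp add: sum_distrib_left)
      also have "\<dots> = 0" using \<phi>(4) by (intro sum.neutral) simp
      also have "(\<Sum>r\<in>{1..8} \<times> {..<9}. if r = (p, q) then y m * \<phi> r else 0) = y m * \<phi> (p, q)"
        using \<phi>(1,2) by (subst sum.delta) auto
      finally have ym: "y m = 0" using \<phi>(3) by simp
      have "\<forall>s<m. y s = 0"
        by (rule indep) (use y' ym in \<open>simp add: mult.assoc\<close>)
      with ym show ?thesis by (simp add: less_Suc_eq)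
    qed
    show ?thesis using eq indep' rep by (intro exI[of _ a''] exI[of _ b''] exI[of _ c'']) auto
  qed
qed

text \<open>The coefficient vectors of more than 14 limits are dependent at each \<open>n\<close>.
  Only the normalised dependency has to converge, so unbounded coefficients \<open>lam\<close> do no
  harm.\<close>

lemma limit_span_dependent:
  assumes "finite J" "14 < card J" "\<And>j. j \<in> J \<Longrightarrow> e j \<in> limit_span a c"
  shows "\<exists>x. (\<exists>j\<in>J. x j \<noteq> 0) \<and> (\<forall>i\<in>{1..8}. \<forall>k<9. (\<Sum>j\<in>J. x j * e j i k) = 0)"
proof -
  from assms(3) have "\<forall>j\<in>J. \<exists>lam. \<forall>i\<in>{1..8}. \<forall>k<9. (\<lambda>n. \<Sum>s<14. lam n s * a n s i * c n s k) \<longlonglongrightarrow> e j i k"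
    unfolding limit_span_def by blast
  from bchoice[OF this] obtain lam where
    lam: "\<And>j i k. j \<in> J \<Longrightarrow> i \<in> {1..8} \<Longrightarrow> k < 9 \<Longrightarrow> (\<lambda>n. \<Sum>s<14. lam j n s * a n s i * c n s k) \<longlonglongrightarrow> e j i k"
    by blast
  have "\<forall>n. \<exists>y. (\<exists>j\<in>J. y j \<noteq> 0) \<and> (\<forall>s\<in>{..<14::nat}. (\<Sum>j\<in>J. lam j n s * y j) = 0)"
    by (intro allI nontrivial_solution) (use assms in auto)
  from choice[OF this] obtain y where y: "\<And>n. \<exists>j\<in>J. y n j \<noteq> 0"
    "\<And>n s. s < 14 \<Longrightarrow> (\<Sum>j\<in>J. lam j n s * y n j) = 0" by blast
  from normalized_subsequence[of J y, OF assms(1) y(1)] obtain r x t where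
    r: "strict_mono r" "\<forall>j\<in>J. (\<lambda>n. t (r n) * y (r n) j) \<longlonglongrightarrow> x j" "\<exists>j\<in>J. x j \<noteq> 0" by blast
  have "(\<Sum>j\<in>J. x j * e j i k) = 0" if ik: "i \<in> {1..8}" "k < 9" for i k
  proof -
    define M where "M = (\<lambda>j n. \<Sum>s<14. lam j n s * a n s i * c n s k)"
    have "(\<lambda>n. M j (r n)) \<longlonglongrightarrow> e j i k" if "j \<in> J" for j
      using LIMSEQ_subseq_LIMSEQ[OF lam[OF that ik] r(1)] by (simp add: M_def o_def)
    then have "(\<lambda>n. \<Sum>j\<in>J. (t (r n) * y (r n) j) * M j (r n)) \<longlonglongrightarrow> (\<Sum>j\<in>J. x j * e j i k)"
      using r(2) by (intro tendsto_sum tendsto_mult) auto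
    moreover have "(\<Sum>j\<in>J. (t n * y n j) * M j n) = 0" for n
    proof -
      have "(\<Sum>j\<in>J. (t n * y n j) * M j n) = (\<Sum>s<14. t n * (\<Sum>j\<in>J. lam j n s * y n j) * a n s i * c n s k)"
        unfolding M_def sum_distrib_left sum_distrib_right by (subst sum.swap) (simp add: ac_simps)
      also have "\<dots> = 0" using y(2) by (intro sum.neutral) simp
      finally show ?thesis .
    qed
    ultimately show ?thesis by (simp add: LIMSEQ_const_iff)
  qed
  with r(3) show ?thesis by blast
qed

section \<open>Leading weights of the limits\<close>

lemma leading_functional_cong:
  assumes "\<And>i k. i \<in> {1..8} \<Longrightarrow> k < 9 \<Longrightarrow> e i k = e' i k"
  shows "leading_functional w e = leading_functional w e'"
  using assms by (simp add: leading_functional_def)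

lemma leading_functional_0: "leading_functional w (\<lambda>i k. 0) = 0"
  by (simp add: leading_functional_def)

lemma in_leading_weights:
  "w \<in> set leading_weights \<longleftrightarrow> w = 42 \<or> w = 10 \<or> w = 22 \<or> w = 2 \<or> w = 3 \<or> w = 21 \<or> w = 14 \<or> w = 6 \<or> w = 7
    \<or> w = 1 \<or> w = 24 \<or> w = 8 \<or> w = 4 \<or> w = 28"
  by (simp add: leading_weights_def)

lemma leading_functional_outside: "w \<notin> set leading_weights \<Longrightarrow> leading_functional w e = 0"
  by (simp add: leading_weights_def leading_functional_def)

lemma leading_functional_sum:
  "leading_functional w (\<lambda>i k. \<Sum>j\<in>J. x j * e j i k) = (\<Sum>j\<in>J. x j * leading_functional w (e j))"
proof (cases "w \<in> set leading_weights")
  case True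
  then show ?thesis
    unfolding in_leading_weights
    by (elim disjE) (simp_all add: leading_functional_def sum_subtractf right_diff_distrib)
qed (simp add: leading_functional_outside)

lemma leading_functional_perm3:
  assumes "b < 9"
  shows "leading_functional w (\<lambda>i k. perm3 i b k) = 0"
proof -
  have "perm3 4 b 0 = perm3 1 b 3" "perm3 5 b 0 = perm3 2 b 3" "perm3 7 b 0 = perm3 1 b 6" "perm3 8 b 0 = perm3 2 b 6"
    using assms unfolding less_9_cases by (auto simp: perm3_def transversal_def simp del: One_nat_def)
  moreover have "perm3 i b k = 0" if "i div 3 = k div 3 \<or> i mod 3 = k mod 3" for i k
    using that by (auto simp: perm3_def transversal_def)
  ultimately show ?thesis by (simp add: leading_functional_def)
qed

lemma leading_functional_weight:
  "leading_functional w (\<lambda>i k. if weight i + weight k = v then e i k else 0) = (if w = v then leading_functional w e else 0)"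
proof (cases "w \<in> set leading_weights")
  case True
  then show ?thesis
    unfolding in_leading_weights
    by (elim disjE) (simp_all add: leading_functional_def weight_def)
qed (auto simp: leading_functional_outside)

lemma leading_functional_eq_0:
  assumes "\<And>i k. i \<in> {1..8} \<Longrightarrow> k < 9 \<Longrightarrow> weight i + weight k = w \<Longrightarrow> e i k = 0"
  shows "leading_functional w e = 0"
proof -
  have "leading_functional w e = leading_functional w (\<lambda>i k. if weight i + weight k = w then e i k else 0)"
    by (simp add: leading_functional_weight)
  also have "\<dots> = leading_functional w (\<lambda>i k. 0)"
    using assms by (intro leading_functional_cong) auto
  finally show ?thesis by (simp add: leading_functional_0)
qed

text \<open>The limits are filtered by weight; the functionals vanish on the slices, so only the
  class of \<open>e\<close> modulo the slices matters.\<close>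

definition leading_set :: "(nat \<Rightarrow> nat \<Rightarrow> nat \<Rightarrow> complex) \<Rightarrow> (nat \<Rightarrow> nat \<Rightarrow> nat \<Rightarrow> complex) \<Rightarrow> nat set" where
  "leading_set a c = {w \<in> set leading_weights. \<exists>e\<in>limit_span a c.
     leading_functional w e \<noteq> 0 \<and> (\<forall>v>w. leading_functional v e = 0)}"

text \<open>A non-collinear pair of positions is completed to a transversal by exactly one position;
  the nine entries chosen see one slice each.\<close>

lemma perm3_independent:
  assumes "\<forall>i\<in>{1..8}. \<forall>k<9. (\<Sum>b<9. y b * perm3 i b k) = 0" "b < 9"
  shows "y b = 0"
proof -
  have "(\<Sum>b<9. y b * perm3 4 b 8) = 0" "(\<Sum>b<9. y b * perm3 3 b 8) = 0" "(\<Sum>b<9. y b * perm3 3 b 7) = 0"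
    "(\<Sum>b<9. y b * perm3 1 b 8) = 0" "(\<Sum>b<9. y b * perm3 2 b 6) = 0" "(\<Sum>b<9. y b * perm3 1 b 6) = 0"
    "(\<Sum>b<9. y b * perm3 1 b 5) = 0" "(\<Sum>b<9. y b * perm3 2 b 3) = 0" "(\<Sum>b<9. y b * perm3 1 b 3) = 0"
    using assms(1) by simp_all
  then have "\<forall>b<9. y b = 0"
    unfolding ball_less_9 sum_less_9 perm3_def transversal_def by simp
  with assms(2) show ?thesis by simp
qed

text \<open>Limits with six distinct leading weights are independent modulo the slices, as the
  functionals are triangular on them. Together with the 9 slices they would be 15 independent
  limits.\<close>

lemma card_leading_set:
  assumes "approx14 a b c"
  shows "card (leading_set a c) \<le> 5"
proof (rule ccontr)
  assume "\<not> ?thesis"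
  then have card: "card (leading_set a c) \<ge> 6" by simp
  define L where "L = leading_set a c"
  have finL: "finite L" by (simp add: L_def leading_set_def)
  have "\<forall>w\<in>L. \<exists>e. e \<in> limit_span a c \<and> leading_functional w e \<noteq> 0 \<and> (\<forall>v>w. leading_functional v e = 0)"
    by (auto simp: L_def leading_set_def)
  from bchoice[OF this] obtain e where e: "\<And>w. w \<in> L \<Longrightarrow> e w \<in> limit_span a c"
    "\<And>w. w \<in> L \<Longrightarrow> leading_functional w (e w) \<noteq> 0" "\<And>w v. w \<in> L \<Longrightarrow> w < v \<Longrightarrow> leading_functional v (e w) = 0"
    by blast
  define J where "J = L <+> {..<9::nat}"
  define f where "f = case_sum e (\<lambda>j i k. perm3 i j k)"
  have slice: "(\<lambda>i k. perm3 i j k) \<in> limit_span a c" if "j < 9" for j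
    unfolding limit_span_def
  proof (intro CollectI exI ballI allI impI)
    fix i k :: nat assume "i \<in> {1..8}" "k < 9"
    with assms that have "(\<lambda>n. \<Sum>s<14. a n s i * b n s j * c n s k) \<longlonglongrightarrow> perm3 i j k"
      unfolding approx14_def by blast
    then show "(\<lambda>n. \<Sum>s<14. b n s j * a n s i * c n s k) \<longlonglongrightarrow> perm3 i j k"
      by (simp add: mult.commute)
  qed
  have finJ: "finite J" using finL by (simp add: J_def)
  have card_J: "card J > 14" using card finL by (simp add: J_def card_Plus L_def)
  have f: "f j \<in> limit_span a c" if "j \<in> J" for j
    using that e(1) slice by (auto simp: J_def f_def)
  obtain x where x: "\<exists>j\<in>J. x j \<noteq> 0" "\<And>i k. i \<in> {1..8} \<Longrightarrow> k < 9 \<Longrightarrow> (\<Sum>j\<in>J. x j * f j i k) = 0"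
    using limit_span_dependent[of J f a c, OF finJ card_J f] by blast
  have lf: "(\<Sum>w\<in>L. x (Inl w) * leading_functional v (e w)) = 0" for v
  proof -
    have "(\<Sum>j\<in>J. x j * leading_functional v (f j)) = leading_functional v (\<lambda>i k. \<Sum>j\<in>J. x j * f j i k)"
      by (rule leading_functional_sum[symmetric])
    also have "\<dots> = leading_functional v (\<lambda>i k. 0)" by (rule leading_functional_cong) (rule x(2))
    finally have "(\<Sum>j\<in>J. x j * leading_functional v (f j)) = 0" by (simp add: leading_functional_0)
    then show ?thesis using finL by (simp add: J_def f_def sum.Plus leading_functional_perm3)
  qed
  have xL: "x (Inl w) = 0" if "w \<in> L" for w
  proof (rule ccontr)
    assume nz: "x (Inl w) \<noteq> 0"
    \<comment> \<open>The functional of the largest weight with nonzero coefficient isolates that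
      coefficient.\<close>
    define N where "N = {w \<in> L. x (Inl w) \<noteq> 0}"
    have N: "finite N" "N \<noteq> {}" using finL nz that by (auto simp: N_def)
    define v where "v = Max N"
    have v: "v \<in> N" "\<And>w. w \<in> N \<Longrightarrow> w \<le> v" using N by (auto simp: v_def)
    have "(\<Sum>w\<in>L. x (Inl w) * leading_functional v (e w)) = (\<Sum>w\<in>{v}. x (Inl w) * leading_functional v (e w))"
    proof (rule sum.mono_neutral_right)
      show "\<forall>w\<in>L - {v}. x (Inl w) * leading_functional v (e w) = 0"
      proof
        fix w assume w: "w \<in> L - {v}"
        show "x (Inl w) * leading_functional v (e w) = 0"
        proof (cases "w \<in> N")
          case True
          then have "w < v" using v(2)[of w] w by simp
          then show ?thesis using e(3)[of w v] w by simp
        next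
          case False
          then show ?thesis using w by (simp add: N_def)
        qed
      qed
    qed (use finL v in \<open>auto simp: N_def\<close>)
    then show False using lf[of v] v(1) e(2)[of v] by (simp add: N_def)
  qed
  have "x (Inr j) = 0" if "j < 9" for j
  proof (rule perm3_independent[of "\<lambda>j. x (Inr j)", OF _ that], intro ballI allI impI)
    fix i k :: nat assume "i \<in> {1..8}" "k < 9"
    from x(2)[OF this] show "(\<Sum>j<9. x (Inr j) * perm3 i j k) = 0"
      using finL xL by (simp add: J_def f_def sum.Plus)
  qed
  with xL x(1) show False by (auto simp: J_def)
qed

lemma approx14_subsequence:
  assumes "approx14 a b c" "strict_mono r"
  shows "approx14 (\<lambda>n. a (r n)) (\<lambda>n. b (r n)) (\<lambda>n. c (r n))"
  unfolding approx14_def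
proof (intro ballI allI impI)
  fix i j k :: nat assume "i \<in> {1..8}" "j < 9" "k < 9"
  then have "(\<lambda>n. \<Sum>s<14. a n s i * b n s j * c n s k) \<longlonglongrightarrow> perm3 i j k"
    using assms(1) unfolding approx14_def by blast
  from LIMSEQ_subseq_LIMSEQ[OF this assms(2)]
  show "(\<lambda>n. \<Sum>s<14. a (r n) s i * b (r n) s j * c (r n) s k) \<longlonglongrightarrow> perm3 i j k"
    by (simp add: o_def)
qed

lemma limit_span_subsequence:
  assumes "e \<in> limit_span a c" "strict_mono r"
  shows "e \<in> limit_span (\<lambda>n. a (r n)) (\<lambda>n. c (r n))"
proof -
  from assms(1) obtain lam where
    lam: "\<forall>i\<in>{1..8}. \<forall>k<9. (\<lambda>n. \<Sum>s<14. lam n s * a n s i * c n s k) \<longlonglongrightarrow> e i k"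
    unfolding limit_span_def by blast
  have "(\<lambda>n. \<Sum>s<14. lam (r n) s * a (r n) s i * c (r n) s k) \<longlonglongrightarrow> e i k" if "i \<in> {1..8}" "k < 9" for i k
    using LIMSEQ_subseq_LIMSEQ[OF lam[rule_format, OF that] assms(2)] by (simp add: o_def)
  then show ?thesis unfolding limit_span_def by (intro CollectI exI[of _ "\<lambda>n. lam (r n)"] ballI allI impI)
qed

lemma leading_set_subsequence:
  "strict_mono r \<Longrightarrow> leading_set a c \<subseteq> leading_set (\<lambda>n. a (r n)) (\<lambda>n. c (r n))"
  unfolding leading_set_def using limit_span_subsequence by blast

text \<open>Subsequences can only enlarge the leading set, and its size is at most 5, so a
  subsequence of maximal size is stable. Stability matters because the vanishing conditions are
  fixed before the subsequence along which the cubic forms converge is known.\<close>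

lemma stable_leading_set:
  assumes "approx14 a b c"
  obtains r where "strict_mono r" "\<And>q. strict_mono q \<Longrightarrow>
    leading_set (\<lambda>n. a (r (q n))) (\<lambda>n. c (r (q n))) = leading_set (\<lambda>n. a (r n)) (\<lambda>n. c (r n))"
proof -
  define f where "f = (\<lambda>r. card (leading_set (\<lambda>n. a (r n)) (\<lambda>n. c (r n))))"
  have f: "f r \<le> 5" if "strict_mono r" for r
    using card_leading_set[OF approx14_subsequence[OF assms that]] by (simp add: f_def)
  have "\<exists>r. strict_mono r \<and> (\<forall>q. strict_mono q \<longrightarrow> f q \<le> f r)"
    by (rule ex_has_greatest_nat[of strict_mono id f 6]) (use f strict_mono_id in \<open>auto simp: less_Suc_eq_le numeral_eq_Suc\<close>)
  then obtain r where r: "strict_mono r" "\<And>q. strict_mono q \<Longrightarrow> f q \<le> f r" by blast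
  have "leading_set (\<lambda>n. a (r (q n))) (\<lambda>n. c (r (q n))) = leading_set (\<lambda>n. a (r n)) (\<lambda>n. c (r n))"
    if q: "strict_mono q" for q
  proof (rule card_seteq[symmetric])
    show "leading_set (\<lambda>n. a (r n)) (\<lambda>n. c (r n)) \<subseteq> leading_set (\<lambda>n. a (r (q n))) (\<lambda>n. c (r (q n)))"
      by (rule leading_set_subsequence[OF q])
    show "card (leading_set (\<lambda>n. a (r (q n))) (\<lambda>n. c (r (q n)))) \<le> card (leading_set (\<lambda>n. a (r n)) (\<lambda>n. c (r n)))"
      using r(2)[OF strict_mono_o[OF r(1) q]] by (simp add: f_def o_def)
  qed (simp add: leading_set_def)
  from that[OF r(1) this] show ?thesis .
qed

text \<open>The equations of \<open>ideal_space\<close> are homogeneous: all pairs completed by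
  \<open>b\<close> have weight \<open>32 - weight b\<close>. The sum
  \<open>weight i + weight k + v\<close> avoids truncated subtraction.\<close>

lemma ideal_space_weight:
  assumes "e \<in> ideal_space"
  shows "(\<lambda>i k. if weight i + weight k + v = u then e i k else 0) \<in> ideal_space"
proof -
  have eq: "weight i + weight k = weight i' + weight k'" if "transversal i b k" "transversal i' b k'" for i k i' k' b
    using weight_transversal[OF that(1)] weight_transversal[OF that(2)] by simp
  note D = assms[unfolded ideal_space_def mem_Collect_eq]
  note e = D[THEN conjunct1] D[THEN conjunct2, THEN conjunct1] D[THEN conjunct2, THEN conjunct2]
  show ?thesis
    unfolding ideal_space_def
  proof (intro CollectI conjI ballI allI impI)
    fix i k i' k' b :: nat
    assume "i \<in> {1..8}" "k \<in> {1..8}" "i' \<in> {1..8}" "k' \<in> {1..8}" "b < 9" and tr: "transversal i b k" "transversal i' b k'"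
    then have "e i k = e i' k'" by (rule e(3)[rule_format, of i k i' k' b])
    then show "(if weight i + weight k + v = u then e i k else 0) = (if weight i' + weight k' + v = u then e i' k' else 0)"
      using eq[OF tr] by simp
  next
    fix i k :: nat assume ik: "i \<in> {1..8}" "k \<in> {1..8}"
    then have "e i k = e k i" by (rule e(1)[rule_format])
    then show "(if weight i + weight k + v = u then e i k else 0) = (if weight k + weight i + v = u then e k i else 0)"
      by (simp add: add.commute[of "weight i"])
  next
    fix i k :: nat assume "i \<in> {1..8}" "k \<in> {1..8}" "collinear_positions i k" "\<not> (i \<in> cross \<and> k \<in> cross)"
    then have "e i k = 0" by (rule e(2)[rule_format])
    then show "(if weight i + weight k + v = u then e i k else 0) = 0" by simp
  qed
qed

lemma ideal_space_cong:
  assumes "e \<in> ideal_space" "\<And>i k. i \<in> {1..8} \<Longrightarrow> k \<in> {1..8} \<Longrightarrow> e i k = e' i k"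
  shows "e' \<in> ideal_space"
proof -
  note D = assms(1)[unfolded ideal_space_def mem_Collect_eq]
  note e = D[THEN conjunct1] D[THEN conjunct2, THEN conjunct1] D[THEN conjunct2, THEN conjunct2]
  show ?thesis
    unfolding ideal_space_def
  proof (intro CollectI conjI ballI allI impI)
    fix i k i' k' b :: nat
    assume ik: "i \<in> {1..8}" "k \<in> {1..8}" "i' \<in> {1..8}" "k' \<in> {1..8}" and "b < 9" "transversal i b k" "transversal i' b k'"
    then have "e i k = e i' k'" by (rule e(3)[rule_format, of i k i' k' b])
    then show "e' i k = e' i' k'" using assms(2)[OF ik(1,2)] assms(2)[OF ik(3,4)] by simp
  next
    fix i k :: nat assume ik: "i \<in> {1..8}" "k \<in> {1..8}"
    then have "e i k = e k i" by (rule e(1)[rule_format])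
    then show "e' i k = e' k i" using assms(2)[OF ik] assms(2)[OF ik(2,1)] by simp
  next
    fix i k :: nat assume ik: "i \<in> {1..8}" "k \<in> {1..8}" and "collinear_positions i k" "\<not> (i \<in> cross \<and> k \<in> cross)"
    then have "e i k = 0" by (rule e(2)[rule_format])
    then show "e' i k = 0" using assms(2)[OF ik] by simp
  qed
qed

section \<open>The top homogeneous part of a limiting cubic form\<close>

lemma vanishing_conditions_range:
  "((i, k, l), c) \<in> set vanishing_conditions \<Longrightarrow> i \<in> {1..8} \<and> k < 9 \<and> l < 9"
  unfolding vanishing_conditions_def by auto

text \<open>Slices of the top part need not be limits, but they stay in \<open>ideal_space\<close>.
  A functional of weight \<open>w\<close> on slice \<open>l\<close> of the top part sees the entries
  of \<open>X\<close> with \<open>w + weight l = u\<close>, and functionals of larger weight vanish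
  on slice \<open>l\<close> of \<open>X\<close> by maximality of \<open>u\<close>. A nonzero value
  would thus make \<open>w\<close> a leading weight of a genuine limit.\<close>

lemma homogeneous_part_eq_0:
  fixes X :: "nat \<times> nat \<times> nat \<Rightarrow> complex"
  assumes approx: "approx14 a b c"
    and span: "\<And>l. l < 9 \<Longrightarrow> (\<lambda>i k. X (i, k, l)) \<in> limit_span a c"
    and X_sym: "\<And>i k l. X (i, k, l) = X (i, l, k)"
    and act: "\<And>i k l d. ((i, k, l), d) \<in> set vanishing_conditions \<Longrightarrow> meets (leading_set a c) d \<Longrightarrow> X (i, k, l) = 0"
    and top: "\<And>i k l. i \<in> {1..8} \<Longrightarrow> k < 9 \<Longrightarrow> l < 9 \<Longrightarrow> u < weight i + weight k + weight l \<Longrightarrow> X (i, k, l) = 0"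
    and ikl: "i \<in> {1..8}" "k < 9" "l < 9" "weight i + weight k + weight l = u"
  shows "X (i, k, l) = 0"
proof -
  have ideal: "(\<lambda>i k. X (i, k, l)) \<in> ideal_space" if "l < 9" for l
    using span[OF that] limit_span_subset_ideal_space[OF approx] by blast
  have X_swap: "X (i, k, l) = X (k, i, l)" if "i \<in> {1..8}" "k \<in> {1..8}" "l < 9" for i k l
    using ideal[OF that(3), unfolded ideal_space_def mem_Collect_eq, THEN conjunct1] that(1,2) by blast
  \<comment> \<open>\<open>X\<close> carries information only for a nonzero first index; an index 0
    in front is moved back by symmetry, and the entry at 0 0 0 is set to 0.\<close>
  define Z where "Z = (\<lambda>i k l. if i < 9 \<and> k < 9 \<and> l < 9 \<and> weight i + weight k + weight l = u then
      if i \<noteq> 0 then X (i, k, l) else if k \<noteq> 0 then X (k, i, l) else if l \<noteq> 0 then X (l, i, k) else 0 else 0)"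
  have Z: "Z i k l = (if weight i + weight k + weight l = u then X (i, k, l) else 0)"
    if "i \<in> {1..8}" "k < 9" "l < 9" for i k l
    using that by (simp add: Z_def)
  have "Z i k l = 0"
  proof (rule symmetric_form_eq_0[of Z "leading_set a c"])
    show sym1: "Z i k l = Z k i l" for i k l
      using X_swap[of i k l] X_sym[of i k l] X_sym[of k i l] by (auto simp: Z_def ac_simps)
    show "Z i k l = Z i l k" for i k l
      using X_sym[of i k l] X_swap[of k l i] X_sym[of k i l] X_sym[of l i k] by (auto simp: Z_def ac_simps)
    show "(\<lambda>i k. Z i k l) \<in> ideal_space" if "l < 9" for l
      by (rule ideal_space_cong[OF ideal_space_weight[OF ideal[OF that], of "weight l" u]]) (use Z that in simp)
    show "leading_functional w (\<lambda>i k. Z i k l) = 0"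
      if w: "w \<in> set leading_weights" "w \<notin> leading_set a c" "l < 9" for w l
    proof (rule ccontr)
      assume nz: "leading_functional w (\<lambda>i k. Z i k l) \<noteq> 0"
      have eq: "leading_functional w (\<lambda>i k. Z i k l)
        = leading_functional w (\<lambda>i k. if weight i + weight k = u - weight l then (if weight l \<le> u then X (i, k, l) else 0) else 0)"
        by (rule leading_functional_cong) (use Z w(3) in auto)
      \<comment> \<open>Guards the subtraction \<open>u - weight l\<close>: for a heavier slice the
        top part is zero.\<close>
      have le: "weight l \<le> u"
        by (rule ccontr) (use nz[unfolded eq leading_functional_weight] in \<open>simp add: leading_functional_0 split: if_splits\<close>)
      with nz[unfolded eq leading_functional_weight] have wu: "w = u - weight l" and lf: "leading_functional w (\<lambda>i k. X (i, k, l)) \<noteq> 0"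
        by (simp_all split: if_splits)
      have "leading_functional v (\<lambda>i k. X (i, k, l)) = 0" if "v > w" for v
        by (rule leading_functional_eq_0, rule top) (use that wu le w(3) in auto)
      with lf have "leading_functional w (\<lambda>i k. X (i, k, l)) \<noteq> 0 \<and> (\<forall>v>w. leading_functional v (\<lambda>i k. X (i, k, l)) = 0)"
        by simp
      with span[OF w(3)] w(1) have "w \<in> leading_set a c"
        unfolding leading_set_def by (intro CollectI conjI bexI[of _ "\<lambda>i k. X (i, k, l)"]) simp_all
      with w(2) show False by simp
    qed
    show "\<forall>((i, k, l), d)\<in>set vanishing_conditions. meets (leading_set a c) d \<longrightarrow> Z i k l = 0"
    proof clarify
      fix i k l d assume v: "((i, k, l), d) \<in> set vanishing_conditions" "meets (leading_set a c) d"
      have "X (i, k, l) = 0" by (rule act[OF v])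
      then show "Z i k l = 0" using Z[of i k l] vanishing_conditions_range[OF v(1)] by simp
    qed
  qed (use ikl in simp_all)
  with Z[OF ikl(1-3)] ikl(4) show ?thesis by simp
qed

lemma no_approx14: "\<not> approx14 a b c"
proof
  assume "approx14 a b c"
  have "\<forall>n. \<exists>p :: (nat \<Rightarrow> nat \<Rightarrow> complex) \<times> (nat \<Rightarrow> nat \<Rightarrow> complex) \<times> (nat \<Rightarrow> nat \<Rightarrow> complex).
      (\<forall>i\<in>{1..8}. \<forall>j. \<forall>k<9.
      (\<Sum>s<14. fst p s i * fst (snd p) s j * snd (snd p) s k) = (\<Sum>s<14. a n s i * b n s j * c n s k)) \<and>
    (\<forall>x. (\<forall>i\<in>{1..8}. \<forall>k<9. (\<Sum>s<14. x s * fst p s i * snd (snd p) s k) = 0) \<longrightarrow> (\<forall>s<14. x s = 0))"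
  proof
    fix n
    from independent_representation[of 14 "a n" "b n" "c n"] obtain a' b' c' :: "nat \<Rightarrow> nat \<Rightarrow> complex" where
      "\<forall>i\<in>{1..8}. \<forall>j. \<forall>k<9. (\<Sum>s<14. a' s i * b' s j * c' s k) = (\<Sum>s<14. a n s i * b n s j * c n s k)"
      "\<forall>x. (\<forall>i\<in>{1..8}. \<forall>k<9. (\<Sum>s<14. x s * a' s i * c' s k) = 0) \<longrightarrow> (\<forall>s<14. x s = 0)"
      by auto
    then show "\<exists>p :: (nat \<Rightarrow> nat \<Rightarrow> complex) \<times> (nat \<Rightarrow> nat \<Rightarrow> complex) \<times> (nat \<Rightarrow> nat \<Rightarrow> complex).
      (\<forall>i\<in>{1..8}. \<forall>j. \<forall>k<9.
      (\<Sum>s<14. fst p s i * fst (snd p) s j * snd (snd p) s k) = (\<Sum>s<14. a n s i * b n s j * c n s k)) \<and>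
    (\<forall>x. (\<forall>i\<in>{1..8}. \<forall>k<9. (\<Sum>s<14. x s * fst p s i * snd (snd p) s k) = 0) \<longrightarrow> (\<forall>s<14. x s = 0))"
      by (intro exI[of _ "(a', b', c')"]) (simp only: fst_conv snd_conv)
  qed
  from choice[OF this] obtain p :: "nat \<Rightarrow> (nat \<Rightarrow> nat \<Rightarrow> complex) \<times> (nat \<Rightarrow> nat \<Rightarrow> complex) \<times> (nat \<Rightarrow> nat \<Rightarrow> complex)" where
    p_eq: "\<And>n i j k. i \<in> {1..8} \<Longrightarrow> k < 9 \<Longrightarrow>
      (\<Sum>s<14. fst (p n) s i * fst (snd (p n)) s j * snd (snd (p n)) s k) = (\<Sum>s<14. a n s i * b n s j * c n s k)"
    and p_indep: "\<And>n x s. \<forall>i\<in>{1..8}. \<forall>k<9. (\<Sum>s<14. x s * fst (p n) s i * snd (snd (p n)) s k) = 0 \<Longrightarrow> s < 14 \<Longrightarrow> x s = 0"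
    by blast
  have "approx14 (\<lambda>n. fst (p n)) (\<lambda>n. fst (snd (p n))) (\<lambda>n. snd (snd (p n)))"
    using \<open>approx14 a b c\<close> unfolding approx14_def by (simp add: p_eq)
  then obtain r where r: "strict_mono r" and stable: "\<And>q. strict_mono q \<Longrightarrow>
      leading_set (\<lambda>n. fst (p (r (q n)))) (\<lambda>n. snd (snd (p (r (q n))))) = leading_set (\<lambda>n. fst (p (r n))) (\<lambda>n. snd (snd (p (r n))))"
    by (rule stable_leading_set) blast
  define A where "A = (\<lambda>n. fst (p (r n)))"
  define B where "B = (\<lambda>n. fst (snd (p (r n))))"
  define C where "C = (\<lambda>n. snd (snd (p (r n))))"
  have approx: "approx14 A B C"
    using approx14_subsequence[OF \<open>approx14 (\<lambda>n. fst (p n)) (\<lambda>n. fst (snd (p n))) (\<lambda>n. snd (snd (p n)))\<close> r]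
    by (simp add: A_def B_def C_def)
  have indep: "x s = 0" if "\<forall>i\<in>{1..8}. \<forall>k<9. (\<Sum>s<14. x s * A n s i * C n s k) = 0" "s < 14" for n x s
    using p_indep[OF that[unfolded A_def C_def]] .
  define S where "S = leading_set A C"
  have stable': "leading_set (\<lambda>n. A (q n)) (\<lambda>n. C (q n)) = S" if "strict_mono q" for q
    using stable[OF that] by (simp add: A_def C_def S_def)
  define M where "M = fst ` set (filter (\<lambda>v. meets S (snd v)) vanishing_conditions)"
  have "card M \<le> length (filter (\<lambda>v. meets S (snd v)) vanishing_conditions)"
    unfolding M_def using card_image_le[of "set (filter (\<lambda>v. meets S (snd v)) vanishing_conditions)" fst]
      card_length[of "filter (\<lambda>v. meets S (snd v)) vanishing_conditions"] by simp
  also have "\<dots> = length (filter (meets S) (map snd vanishing_conditions))"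
    by (simp add: filter_map o_def)
  also have "\<dots> \<le> 13"
  proof (rule few_vanishing_conditions)
    have "S \<inter> set leading_weights = S" by (auto simp: S_def leading_set_def)
    then show "card (S \<inter> set leading_weights) \<le> 5"
      using card_leading_set[OF approx] by (simp add: S_def)
  qed
  finally have card_M: "card M < card {..<14::nat}" by simp
  \<comment> \<open>At most 13 linear conditions on 14 coefficients leave a nonzero choice.\<close>
  have "\<forall>n. \<exists>x. (\<exists>s\<in>{..<14}. x s \<noteq> 0) \<and>
    (\<forall>q\<in>M. (\<Sum>s<14. (A n s (fst q) * C n s (fst (snd q)) * C n s (snd (snd q))) * x s) = 0)"
    by (intro allI nontrivial_solution card_M) (simp_all add: M_def)
  from choice[OF this] obtain lam where lam: "\<And>n. \<exists>s\<in>{..<14}. lam n s \<noteq> 0"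
    "\<And>n q. q \<in> M \<Longrightarrow> (\<Sum>s<14. (A n s (fst q) * C n s (fst (snd q)) * C n s (snd (snd q))) * lam n s) = 0"
    by blast
  define F where "F = (\<lambda>n q. \<Sum>s<14. (A n s (fst q) * C n s (fst (snd q)) * C n s (snd (snd q))) * lam n s)"
  define I where "I = {1..8::nat} \<times> {..<9::nat} \<times> {..<9::nat}"
  \<comment> \<open>If the form were 0, independence applied to each slice \<open>l\<close> would
    give \<open>lam n s * C n s l = 0\<close>, hence a zero vector \<open>C n s\<close>, and the
    zero matrix belonging to \<open>s\<close> would contradict independence.\<close>
  have F_nz: "\<exists>q\<in>I. F n q \<noteq> 0" for n
  proof (rule ccontr)
    assume "\<not> ?thesis"
    then have F0: "F n (i, k, l) = 0" if "i \<in> {1..8}" "k < 9" "l < 9" for i k l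
      using that by (simp add: I_def)
    obtain s where s: "s < 14" "lam n s \<noteq> 0" using lam(1)[of n] by auto
    have "lam n s * C n s l = 0" if "l < 9" for l
    proof (rule indep[of "\<lambda>s. lam n s * C n s l" n s])
      show "\<forall>i\<in>{1..8}. \<forall>k<9. (\<Sum>s<14. lam n s * C n s l * A n s i * C n s k) = 0"
        using F0 that by (simp add: F_def ac_simps)
    qed (rule s(1))
    then have C0: "C n s l = 0" if "l < 9" for l using that s(2) by simp
    have "(of_bool (s = s) :: complex) = 0"
    proof (rule indep[of "\<lambda>t. of_bool (t = s)" n s, OF _ s(1)], intro ballI allI impI)
      fix i k :: nat assume "k < 9"
      then show "(\<Sum>t<14. of_bool (t = s) * A n t i * C n t k) = 0"
        using C0 by (intro sum.neutral) auto
    qed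
    then show False by simp
  qed
  have "finite I" by (simp add: I_def)
  from normalized_subsequence[of I F, OF this F_nz] obtain q X t where q: "strict_mono q"
    and X: "\<forall>p\<in>I. (\<lambda>n. t (q n) * F (q n) p) \<longlonglongrightarrow> X p" "\<exists>p\<in>I. X p \<noteq> 0" by blast
  define Y where "Y = (\<lambda>p. if p \<in> I then X p else 0)"
  have Y_lim: "(\<lambda>n. t (q n) * F (q n) p) \<longlonglongrightarrow> Y p" if "p \<in> I" for p
    using X(1) that by (simp add: Y_def)
  have Y_sym: "Y (i, k, l) = Y (i, l, k)" for i k l
  proof (cases "(i, k, l) \<in> I")
    case True
    then have I': "(i, l, k) \<in> I" by (simp add: I_def)
    have "F n (i, k, l) = F n (i, l, k)" for n by (simp add: F_def ac_simps)
    with Y_lim[OF True] have "(\<lambda>n. t (q n) * F (q n) (i, l, k)) \<longlonglongrightarrow> Y (i, k, l)" by simp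
    from LIMSEQ_unique[OF this Y_lim[OF I']] show ?thesis .
  next
    case False
    then show ?thesis by (auto simp: Y_def I_def)
  qed
  define N where "N = {p \<in> I. Y p \<noteq> 0}"
  have N: "finite N" "N \<noteq> {}"
    using \<open>finite I\<close> X(2) by (auto simp: N_def Y_def)
  define wt where "wt = (\<lambda>(i, k, l). weight i + weight k + weight l)"
  define u where "u = Max (wt ` N)"
  have "u \<in> wt ` N" unfolding u_def using N by (intro Max_in) auto
  then obtain i k l where ikl: "(i, k, l) \<in> N" "wt (i, k, l) = u" by auto
  have "Y (i, k, l) = 0"
  proof (rule homogeneous_part_eq_0[OF approx14_subsequence[OF approx q], where u = u])
    show "(\<lambda>i k. Y (i, k, l)) \<in> limit_span (\<lambda>n. A (q n)) (\<lambda>n. C (q n))" if "l < 9" for l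
      unfolding limit_span_def
    proof (intro CollectI exI ballI allI impI)
      fix i k :: nat assume "i \<in> {1..8}" "k < 9"
      with that have "(i, k, l) \<in> I" by (simp add: I_def)
      from Y_lim[OF this]
      show "(\<lambda>n. \<Sum>s<14. (t (q n) * lam (q n) s * C (q n) s l) * A (q n) s i * C (q n) s k) \<longlonglongrightarrow> Y (i, k, l)"
        by (simp add: F_def sum_distrib_left ac_simps)
    qed
    show "Y (i, k, l) = Y (i, l, k)" for i k l by (rule Y_sym)
    show "Y (i, k, l) = 0" if v: "((i, k, l), d) \<in> set vanishing_conditions"
      "meets (leading_set (\<lambda>n. A (q n)) (\<lambda>n. C (q n))) d" for i k l d
    proof -
      \<comment> \<open>The conditions were chosen for \<open>S\<close>, which by stability is still
        the leading set along \<open>q\<close>.\<close>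
      have "(i, k, l) \<in> M"
        using v stable'[OF q] by (force simp: M_def)
      then have "F n (i, k, l) = 0" for n using lam(2) unfolding F_def by blast
      moreover have "(i, k, l) \<in> I" using vanishing_conditions_range[OF v(1)] by (simp add: I_def)
      ultimately show ?thesis using Y_lim[of "(i, k, l)"] by (simp add: LIMSEQ_const_iff)
    qed
    show "Y (i, k, l) = 0" if "i \<in> {1..8}" "k < 9" "l < 9" "u < weight i + weight k + weight l" for i k l
    proof (rule ccontr)
      assume "Y (i, k, l) \<noteq> 0"
      then have "(i, k, l) \<in> N" using that by (simp add: N_def I_def)
      then have "wt (i, k, l) \<le> u" using N(1) unfolding u_def by (intro Max_ge) auto
      then show False using that(4) by (simp add: wt_def)
    qed
  qed (use ikl in \<open>auto simp: N_def I_def wt_def\<close>)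
  with ikl show False by (simp add: N_def)
qed

section \<open>From 15 terms to 14\<close>

text \<open>The cyclic translation of rows and columns that moves position 0 to \<open>p\<close>; it
  preserves transversals and lets any slice play the role of slice 0.\<close>

definition shift :: "nat \<Rightarrow> nat \<Rightarrow> nat" where
  "shift p i = 3 * ((i div 3 + p div 3) mod 3) + (i mod 3 + p mod 3) mod 3"

lemma shift:
  assumes "p < 9"
  shows "shift p i < 9" "i < 9 \<Longrightarrow> shift p i = p \<longleftrightarrow> i = 0"
    "i < 9 \<Longrightarrow> j < 9 \<Longrightarrow> k < 9 \<Longrightarrow> perm3 (shift p i) (shift p j) (shift p k) = perm3 i j k"
proof -
  have dm: "shift p i div 3 = (i div 3 + p div 3) mod 3" "shift p i mod 3 = (i mod 3 + p mod 3) mod 3" for i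
    by (simp_all add: shift_def)
  have less_3: "x < 3 \<longleftrightarrow> x = 0 \<or> x = 1 \<or> x = 2" for x :: nat by auto
  have inj: "inj_on (\<lambda>x. (x + q) mod 3) {0, 1, 2}" if "q < 3" for q :: nat
    using that unfolding less_3 by (auto simp: inj_on_def)
  show lt: "shift p i < 9" for i
  proof -
    have "(i div 3 + p div 3) mod 3 < 3" "(i mod 3 + p mod 3) mod 3 < 3" by simp_all
    then show ?thesis unfolding shift_def by linarith
  qed
  show "shift p i = p \<longleftrightarrow> i = 0" if "i < 9"
  proof
    assume "shift p i = p"
    with dm[of i] have "(i div 3 + p div 3) mod 3 = p div 3" "(i mod 3 + p mod 3) mod 3 = p mod 3" by simp_all
    moreover have "i div 3 < 3" "p div 3 < 3" "i mod 3 < 3" "p mod 3 < 3" using that assms by simp_all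
    moreover have "x = 0" if "(x + q) mod 3 = q" "x < 3" "q < 3" for x q :: nat
      using that unfolding less_3 by auto
    ultimately have "i div 3 = 0" "i mod 3 = 0" by metis+
    then show "i = 0" using div_mult_mod_eq[of i 3] by simp
  next
    assume "i = 0"
    moreover have "p div 3 < 3" using assms by simp
    ultimately show "shift p i = p" by (simp add: shift_def)
  qed
  show "perm3 (shift p i) (shift p j) (shift p k) = perm3 i j k" if "i < 9" "j < 9" "k < 9"
  proof -
    have "transversal (shift p i) (shift p j) (shift p k) = transversal i j k"
      by (rule transversal_image[OF _ inj[of "p div 3"] inj[of "p mod 3"] that]) (use assms in \<open>simp_all add: lt dm\<close>)
    then show ?thesis by (simp add: perm3_def)
  qed
qed

lemma perm3_scale:
  assumes "t \<noteq> 0"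
  shows "t ^ weight i * (t ^ weight j / t ^ 32) * t ^ weight k * perm3 i j k = perm3 i j k"
proof (cases "transversal i j k")
  case True
  have "t ^ weight i * (t ^ weight j / t ^ 32) * t ^ weight k = t ^ (weight i + weight j + weight k) / t ^ 32"
    by (simp add: power_add)
  also have "\<dots> = 1" using weight_transversal[OF True] assms by simp
  finally show ?thesis by simp
qed (simp add: perm3_def)

lemma weight_inj: "i < 9 \<Longrightarrow> j < 9 \<Longrightarrow> weight i = weight j \<Longrightarrow> i = j"
  by (simp add: weight_def nth_eq_iff_index_eq)

text \<open>
  The last of the 15 terms is eliminated by subtracting multiples of one slice from the others.
  The slice is the one of maximal weight that survives in the limit, so that the torus action pushes
  the subtracted multiples to 0 without changing the tensor.
\<close>

lemma eliminate_term:
  fixes a b c :: "nat \<Rightarrow> nat \<Rightarrow> nat \<Rightarrow> complex"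
  assumes "\<And>i j k. i < 9 \<Longrightarrow> j < 9 \<Longrightarrow> k < 9 \<Longrightarrow> (\<lambda>n. \<Sum>s<15. a n s i * b n s j * c n s k) \<longlonglongrightarrow> perm3 i j k"
    and nz: "\<And>n. \<exists>i\<in>{..<9}. a n 14 i \<noteq> 0"
  shows "\<exists>p<9. \<exists>a b c :: nat \<Rightarrow> nat \<Rightarrow> nat \<Rightarrow> complex. \<forall>i<9. \<forall>j<9. \<forall>k<9. i \<noteq> p \<longrightarrow> (\<lambda>n. \<Sum>s<14. a n s i * b n s j * c n s k) \<longlonglongrightarrow> perm3 i j k"
proof -
  from normalized_subsequence[of "{..<9::nat}" "\<lambda>n. a n 14", OF _ nz] obtain r t u where
    r: "strict_mono r" and u: "\<forall>i\<in>{..<9}. (\<lambda>n. t (r n) * a (r n) 14 i) \<longlonglongrightarrow> u i" "\<exists>i\<in>{..<9}. u i \<noteq> 0"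
    by auto
  define U where "U = {i \<in> {..<9}. u i \<noteq> 0}"
  have U: "finite U" "U \<noteq> {}" using u(2) by (auto simp: U_def)
  have "Max (weight ` U) \<in> weight ` U" using U by (intro Max_in) auto
  then obtain p where p: "p \<in> U" "weight p = Max (weight ` U)" by auto
  have p9: "p < 9" and up: "u p \<noteq> 0" using p(1) by (auto simp: U_def)
  have u0: "u i = 0" if "i < 9" "i \<noteq> p" "\<not> weight i < weight p" for i
  proof (rule ccontr)
    assume "u i \<noteq> 0"
    then have "weight i \<le> weight p" unfolding p(2) using that U(1) by (intro Max_ge) (auto simp: U_def)
    with that weight_inj[OF that(1) p9] show False by auto
  qed
  \<comment> \<open>The multiple of slice \<open>p\<close> whose subtraction cancels the last term.
    The unnormalised quotient converges because numerator and denominator are scaled by the same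
    \<open>t (r n)\<close>.\<close>
  define \<rho> where "\<rho> = (\<lambda>n i. a (r n) 14 i / a (r n) 14 p)"
  have \<rho>: "(\<lambda>n. \<rho> n i) \<longlonglongrightarrow> u i / u p" if "i < 9" for i
  proof -
    have "(\<lambda>n. (t (r n) * a (r n) 14 i) / (t (r n) * a (r n) 14 p)) \<longlonglongrightarrow> u i / u p"
      using u(1) that p9 up by (intro tendsto_divide) auto
    moreover have "\<forall>\<^sub>F n in sequentially. t (r n) * a (r n) 14 p \<noteq> 0"
      using u(1) p9 up by (intro tendsto_imp_eventually_ne[of _ "u p"]) auto
    then have "\<forall>\<^sub>F n in sequentially. (t (r n) * a (r n) 14 i) / (t (r n) * a (r n) 14 p) = \<rho> n i"
      by eventually_elim (simp add: \<rho>_def)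
    ultimately show ?thesis by (rule Lim_transform_eventually)
  qed
  define A where "A = (\<lambda>n s i. a (r n) s i - \<rho> n i * a (r n) s p)"
  have G: "(\<lambda>n. \<Sum>s<14. A n s i * b (r n) s j * c (r n) s k) \<longlonglongrightarrow> perm3 i j k - u i / u p * perm3 p j k"
    if ijk: "i < 9" "j < 9" "k < 9" for i j k
  proof -
    define F where "F = (\<lambda>n i. \<Sum>s<15. a n s i * b n s j * c n s k)"
    have F: "(\<lambda>n. F (r n) i) \<longlonglongrightarrow> perm3 i j k" if "i < 9" for i
      using LIMSEQ_subseq_LIMSEQ[OF assms(1)[OF that ijk(2,3)] r] by (simp add: F_def o_def)
    have "(\<lambda>n. F (r n) i - \<rho> n i * F (r n) p) \<longlonglongrightarrow> perm3 i j k - u i / u p * perm3 p j k"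
      by (intro tendsto_diff tendsto_mult F \<rho> ijk p9)
    moreover have "\<forall>\<^sub>F n in sequentially. t (r n) * a (r n) 14 p \<noteq> 0"
      using u(1) p9 up by (intro tendsto_imp_eventually_ne[of _ "u p"]) auto
    then have "\<forall>\<^sub>F n in sequentially. F (r n) i - \<rho> n i * F (r n) p = (\<Sum>s<14. A n s i * b (r n) s j * c (r n) s k)"
    proof eventually_elim
      case (elim n)
      have "F (r n) i - \<rho> n i * F (r n) p = (\<Sum>s<15. A n s i * b (r n) s j * c (r n) s k)"
        by (simp add: F_def A_def sum_distrib_left sum_subtractf[symmetric] algebra_simps)
      also have "{..<15} = insert 14 {..<14::nat}" by auto
      also have "(\<Sum>s\<in>insert 14 {..<14}. A n s i * b (r n) s j * c (r n) s k) = (\<Sum>s<14. A n s i * b (r n) s j * c (r n) s k)"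
        using elim by (simp add: A_def \<rho>_def)
      finally show ?case .
    qed
    ultimately show ?thesis by (rule Lim_transform_eventually)
  qed
  \<comment> \<open>Torus parameter m + 1, nonzero and tending to infinity.\<close>
  define \<tau> where "\<tau> = (\<lambda>m::nat. of_nat (Suc m) :: complex)"
  have \<tau>: "\<tau> m \<noteq> 0" for m unfolding \<tau>_def using of_nat_neq_0 by blast
  define H where "H = (\<lambda>m i j k. \<tau> m ^ weight i * (\<tau> m ^ weight j / \<tau> m ^ 32) * \<tau> m ^ weight k * (perm3 i j k - u i / u p * perm3 p j k))"
  define E where "E = (\<lambda>m n i j k. \<Sum>s<14. (\<tau> m ^ weight i * A n s i) * (\<tau> m ^ weight j / \<tau> m ^ 32 * b (r n) s j) * (\<tau> m ^ weight k * c (r n) s k))"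
  have E: "(\<lambda>n. E m n i j k) \<longlonglongrightarrow> H m i j k" if "i < 9" "j < 9" "k < 9" for m i j k
  proof -
    have "E m n i j k = \<tau> m ^ weight i * (\<tau> m ^ weight j / \<tau> m ^ 32) * \<tau> m ^ weight k * (\<Sum>s<14. A n s i * b (r n) s j * c (r n) s k)" for n
      unfolding E_def sum_distrib_left by (intro sum.cong refl) (simp add: ac_simps)
    then show ?thesis unfolding H_def by (simp only:) (intro tendsto_mult tendsto_const G that)
  qed
  have H: "(\<lambda>m. H m i j k) \<longlonglongrightarrow> perm3 i j k" if ijk: "i < 9" "j < 9" "k < 9" "i \<noteq> p" for i j k
  proof -
    \<comment> \<open>The factor by which the torus scales the unwanted multiple of slice
      \<open>p\<close> relative to slice \<open>i\<close>; it tends to 0 when \<open>p\<close> is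
      heavier.\<close>
    define v where "v = (\<lambda>m. \<tau> m ^ weight i / \<tau> m ^ weight p)"
    have H_eq: "H m i j k = perm3 i j k - u i / u p * perm3 p j k * v m" for m
    proof -
      define q where "q = \<tau> m ^ weight i * (\<tau> m ^ weight j / \<tau> m ^ 32) * \<tau> m ^ weight k"
      have "q * perm3 p j k = v m * (\<tau> m ^ weight p * (\<tau> m ^ weight j / \<tau> m ^ 32) * \<tau> m ^ weight k * perm3 p j k)"
        using \<tau>[of m] by (simp add: v_def q_def)
      also have "\<dots> = v m * perm3 p j k" by (simp only: perm3_scale[OF \<tau>])
      finally have p: "q * perm3 p j k = v m * perm3 p j k" .
      have "H m i j k = q * perm3 i j k - u i / u p * (q * perm3 p j k)"
        unfolding H_def q_def[symmetric] by (simp add: right_diff_distrib)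
      also have "q * perm3 i j k = perm3 i j k" unfolding q_def by (rule perm3_scale[OF \<tau>])
      finally show ?thesis unfolding p by simp
    qed
    show ?thesis
    proof (cases "weight i < weight p")
      case False
      then show ?thesis using u0 ijk by (simp add: H_eq)
    next
      case True
      have v_eq: "v = (\<lambda>m. (1 / \<tau> m) ^ (weight p - weight i))"
        unfolding v_def using True \<tau> by (auto simp: fun_eq_iff power_diff power_one_over field_simps)
      have "(\<lambda>m. 1 / \<tau> m) \<longlonglongrightarrow> 0"
        unfolding \<tau>_def by (rule LIMSEQ_Suc[OF lim_1_over_n])
      then have "(\<lambda>m. (1 / \<tau> m) ^ (weight p - weight i)) \<longlonglongrightarrow> 0 ^ (weight p - weight i)"
        by (intro tendsto_power)
      then have "v \<longlonglongrightarrow> 0" using True unfolding v_eq by (simp add: power_0_left)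
      then have "(\<lambda>m. perm3 i j k - u i / u p * perm3 p j k * v m) \<longlonglongrightarrow> perm3 i j k - u i / u p * perm3 p j k * 0"
        by (intro tendsto_intros)
      then show ?thesis by (simp add: H_eq)
    qed
  qed
  \<comment> \<open>Diagonal choice: for each torus parameter, one \<open>n\<close> that is good for
    all 729 coordinates.\<close>
  have "\<exists>n. \<forall>i\<in>{..<9}. \<forall>j\<in>{..<9}. \<forall>k\<in>{..<9}. norm (E m n i j k - H m i j k) < 1 / real (Suc m)" for m
  proof -
    have "\<forall>\<^sub>F n in sequentially. \<forall>i\<in>{..<9}. \<forall>j\<in>{..<9}. \<forall>k\<in>{..<9}. norm (E m n i j k - H m i j k) < 1 / real (Suc m)"
    proof (intro eventually_ball_finite ballI finite_lessThan)
      fix i j k :: nat assume "i \<in> {..<9}" "j \<in> {..<9}" "k \<in> {..<9}"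
      then have "(\<lambda>n. E m n i j k) \<longlonglongrightarrow> H m i j k" by (intro E) auto
      from tendstoD[OF this, of "1 / real (Suc m)"]
      show "\<forall>\<^sub>F n in sequentially. norm (E m n i j k - H m i j k) < 1 / real (Suc m)" by (simp add: dist_norm)
    qed
    then show ?thesis by (rule eventually_happens'[OF sequentially_bot])
  qed
  then have "\<forall>m. \<exists>n. \<forall>i\<in>{..<9}. \<forall>j\<in>{..<9}. \<forall>k\<in>{..<9}. norm (E m n i j k - H m i j k) < 1 / real (Suc m)" ..
  from choice[OF this] obtain N where
    N': "\<forall>m. \<forall>i\<in>{..<9}. \<forall>j\<in>{..<9}. \<forall>k\<in>{..<9}. norm (E m (N m) i j k - H m i j k) < 1 / real (Suc m)" ..
  have N: "norm (E m (N m) i j k - H m i j k) < 1 / real (Suc m)" if "i < 9" "j < 9" "k < 9" for m i j k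
    by (rule N'[rule_format]) (use that in auto)
  have "(\<lambda>m. E m (N m) i j k) \<longlonglongrightarrow> perm3 i j k" if ijk: "i < 9" "j < 9" "k < 9" "i \<noteq> p" for i j k
  proof -
    have "(\<lambda>m. E m (N m) i j k - H m i j k) \<longlonglongrightarrow> 0"
    proof (rule Lim_null_comparison[OF always_eventually])
      show "\<forall>m. norm (E m (N m) i j k - H m i j k) \<le> 1 / real (Suc m)"
        using N[OF ijk(1-3)] by (simp add: less_imp_le)
      show "(\<lambda>m. 1 / real (Suc m)) \<longlonglongrightarrow> 0"
        using LIMSEQ_inverse_real_of_nat by (simp add: inverse_eq_divide)
    qed
    from tendsto_add[OF this H[OF ijk]] show ?thesis by simp
  qed
  note lim = this
  define A' where "A' = (\<lambda>m s i. \<tau> m ^ weight i * A (N m) s i)"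
  define B' where "B' = (\<lambda>m s j. \<tau> m ^ weight j / \<tau> m ^ 32 * b (r (N m)) s j)"
  define C' where "C' = (\<lambda>m s k. \<tau> m ^ weight k * c (r (N m)) s k)"
  have fin: "\<forall>i<9. \<forall>j<9. \<forall>k<9. i \<noteq> p \<longrightarrow> (\<lambda>m. \<Sum>s<14. A' m s i * B' m s j * C' m s k) \<longlonglongrightarrow> perm3 i j k"
    using lim unfolding E_def A'_def B'_def C'_def by simp
  show ?thesis
    by (rule exI[of _ p], rule conjI, rule p9, rule exI[of _ A'], rule exI[of _ B'], rule exI[of _ C'], rule fin)
qed

lemma no_approx15:
  fixes a b c :: "nat \<Rightarrow> nat \<Rightarrow> nat \<Rightarrow> complex"
  assumes lim: "\<And>i j k. i < 9 \<Longrightarrow> j < 9 \<Longrightarrow> k < 9 \<Longrightarrow> (\<lambda>n. \<Sum>s<15. a n s i * b n s j * c n s k) \<longlonglongrightarrow> perm3 i j k"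
  shows False
proof -
  define z where "z = (\<lambda>n. \<forall>i<9. a n 14 i = 0)"
  \<comment> \<open>A last term with zero first vector is rewritten as one with zero second vector,
    since the elimination divides by an entry of the first vector.\<close>
  define a' where "a' = (\<lambda>n s i. if s = 14 \<and> z n then 1 else a n s i)"
  define b' where "b' = (\<lambda>n s i. if s = 14 \<and> z n then 0 else b n s i)"
  have eq: "(\<Sum>s<15. a' n s i * b' n s j * c n s k) = (\<Sum>s<15. a n s i * b n s j * c n s k)" if "i < 9" for n i j k
    using that by (intro sum.cong) (auto simp: a'_def b'_def z_def)
  have "\<exists>i\<in>{..<9}. a' n 14 i \<noteq> 0" for n
  proof (cases "z n")
    case True
    then show ?thesis by (intro bexI[of _ 0]) (simp_all add: a'_def)
  next
    case False
    then show ?thesis by (auto simp: a'_def z_def)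
  qed
  then have "\<exists>p<9. \<exists>a b c :: nat \<Rightarrow> nat \<Rightarrow> nat \<Rightarrow> complex. \<forall>i<9. \<forall>j<9. \<forall>k<9. i \<noteq> p \<longrightarrow> (\<lambda>n. \<Sum>s<14. a n s i * b n s j * c n s k) \<longlonglongrightarrow> perm3 i j k"
    by (intro eliminate_term[of a' b' c]) (simp_all only: eq lim)
  then obtain p and a'' b'' c'' :: "nat \<Rightarrow> nat \<Rightarrow> nat \<Rightarrow> complex" where p: "p < 9" and lim'':
    "\<forall>i<9. \<forall>j<9. \<forall>k<9. i \<noteq> p \<longrightarrow> (\<lambda>n. \<Sum>s<14. a'' n s i * b'' n s j * c'' n s k) \<longlonglongrightarrow> perm3 i j k"
    by (elim exE conjE) (rule that)
  \<comment> \<open>Translation turns the lost slice \<open>p\<close> into slice 0.\<close>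
  have "approx14 (\<lambda>n s i. a'' n s (shift p i)) (\<lambda>n s i. b'' n s (shift p i)) (\<lambda>n s i. c'' n s (shift p i))"
    unfolding approx14_def
  proof (intro ballI allI impI)
    fix i j k :: nat assume "i \<in> {1..8}" "j < 9" "k < 9"
    then have ijk: "i < 9" "j < 9" "k < 9" "i \<noteq> 0" by auto
    have "(\<lambda>n. \<Sum>s<14. a'' n s (shift p i) * b'' n s (shift p j) * c'' n s (shift p k)) \<longlonglongrightarrow> perm3 (shift p i) (shift p j) (shift p k)"
      by (rule lim''[rule_format]) (use shift[OF p] ijk in auto)
    then show "(\<lambda>n. \<Sum>s<14. a'' n s (shift p i) * b'' n s (shift p j) * c'' n s (shift p k)) \<longlonglongrightarrow> perm3 i j k"
      using shift(3)[OF p ijk(1-3)] by simp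
  qed
  with no_approx14 show False by blast
qed

section \<open>Tensor rank and coordinates\<close>

lemma sum_rank_one_exists:
  assumes "finite P" "\<And>p. p \<in> P \<Longrightarrow> rank_one (g p)"
  shows "\<exists>f. (\<forall>s<card P. rank_one (f s)) \<and> (\<Sum>p\<in>P. g p) = (\<Sum>s<card P. f s)"
proof -
  from ex_bij_betw_nat_finite[OF assms(1)] obtain h where h: "bij_betw h {..<card P} P"
    by (auto simp: atLeast0LessThan)
  have "rank_one (g (h s))" if "s < card P" for s
    using assms(2) bij_betwE[OF h] that by auto
  moreover have "(\<Sum>p\<in>P. g p) = (\<Sum>s<card P. g (h s))"
    using sum.reindex_bij_betw[OF h, of g] by simp
  ultimately show ?thesis by (intro exI[of _ "\<lambda>s. g (h s)"] conjI allI impI)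
qed

lemma tensor_rank_le_card:
  assumes "finite P" "\<And>p. p \<in> P \<Longrightarrow> rank_one (g p)"
  shows "tensor_rank (\<Sum>p\<in>P. g p) \<le> card P"
  unfolding tensor_rank_def using sum_rank_one_exists[OF assms] by (rule Least_le)

text \<open>Supplies at least one decomposition into rank one tensors, so that the
  \<open>LEAST\<close> in \<open>tensor_rank\<close> is attained.\<close>

lemma sum_units:
  "T = (\<Sum>(i, j, k)\<in>{(i, j, k). T $ i $ j $ k \<noteq> 0}. outer (axis i (T $ i $ j $ k)) (axis j 1) (axis k 1))"
  for T :: "('a::finite, 'b::finite, 'c::finite) tensor"
proof -
  define P where "P = {(i, j, k). T $ i $ j $ k \<noteq> 0}"
  have "(\<Sum>(i, j, k)\<in>P. outer (axis i (T $ i $ j $ k)) (axis j 1) (axis k 1)) $ a $ b $ c = T $ a $ b $ c" for a b c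
  proof -
    have "(\<Sum>(i, j, k)\<in>P. outer (axis i (T $ i $ j $ k)) (axis j 1) (axis k 1)) $ a $ b $ c
      = (\<Sum>p\<in>P. if p = (a, b, c) then T $ a $ b $ c else 0)"
      unfolding sum_component by (intro sum.cong) (auto simp: outer_def axis_def split: if_splits)
    also have "\<dots> = T $ a $ b $ c" by (simp add: P_def)
    finally show ?thesis .
  qed
  then show ?thesis by (simp add: vec_eq_iff P_def)
qed

lemma tensor_rank_decomposition:
  fixes T :: "('a::finite, 'b::finite, 'c::finite) tensor"
  obtains f where "\<And>s. s < tensor_rank T \<Longrightarrow> rank_one (f s)" "T = (\<Sum>s<tensor_rank T. f s)"
proof -
  define P where "P = {(i, j, k). T $ i $ j $ k \<noteq> 0}"
  define g where "g = (\<lambda>(i, j, k). outer (axis i (T $ i $ j $ k)) (axis j 1) (axis k 1))"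
  have "rank_one (g p)" if "p \<in> P" for p
    using that by (auto simp: P_def g_def rank_one_def split: prod.splits)
      (metis axis_eq_0_iff zero_neq_one)
  from sum_rank_one_exists[of P g, OF _ this] obtain f where f: "\<forall>s<card P. rank_one (f s)" "(\<Sum>p\<in>P. g p) = (\<Sum>s<card P. f s)"
    by auto
  have "T = (\<Sum>p\<in>P. g p)" unfolding P_def g_def by (rule sum_units)
  then have "(\<forall>s<card P. rank_one (f s)) \<and> T = (\<Sum>s<card P. f s)" using f by simp
  then have "\<exists>f. (\<forall>s<card P. rank_one (f s)) \<and> T = (\<Sum>s<card P. f s)" by (rule exI[where x = f])
  then have "\<exists>r::nat. \<exists>f. (\<forall>s<r. rank_one (f s)) \<and> T = (\<Sum>s<r. f s)" by (rule exI[where x = "card P"])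
  then have "\<exists>f. (\<forall>s<tensor_rank T. rank_one (f s)) \<and> T = (\<Sum>s<tensor_rank T. f s)"
    unfolding tensor_rank_def by (rule LeastI_ex)
  then show ?thesis by (elim exE conjE) (rule that; simp)
qed

lemma tensor_rank_coordinates:
  fixes T :: "('a::finite, 'b::finite, 'c::finite) tensor"
  assumes "tensor_rank T \<le> r"
  shows "\<exists>a b c. \<forall>i j k. T $ i $ j $ k = (\<Sum>s<r. a s $ i * b s $ j * c s $ k)"
proof -
  obtain f where f: "\<And>s. s < tensor_rank T \<Longrightarrow> rank_one (f s)" "T = (\<Sum>s<tensor_rank T. f s)"
    using tensor_rank_decomposition[of T] by blast
  from f(1) have "\<forall>s\<in>{..<tensor_rank T}. \<exists>p. f s = outer (fst p) (fst (snd p)) (snd (snd p))"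
    unfolding rank_one_def by force
  from bchoice[OF this] obtain p where p: "\<And>s. s < tensor_rank T \<Longrightarrow> f s = outer (fst (p s)) (fst (snd (p s))) (snd (snd (p s)))"
    by blast
  \<comment> \<open>Zero vectors pad a decomposition to exactly \<open>r\<close> terms.\<close>
  define a where "a = (\<lambda>s. if s < tensor_rank T then fst (p s) else 0)"
  have "T $ i $ j $ k = (\<Sum>s<r. a s $ i * fst (snd (p s)) $ j * snd (snd (p s)) $ k)" for i j k
  proof -
    have "T $ i $ j $ k = (\<Sum>s<tensor_rank T. f s $ i $ j $ k)"
      by (subst (1) f(2)) (simp only: sum_component)
    also have "\<dots> = (\<Sum>s<tensor_rank T. a s $ i * fst (snd (p s)) $ j * snd (snd (p s)) $ k)"
      by (intro sum.cong) (auto simp: p a_def outer_def)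
    also have "\<dots> = (\<Sum>s<r. a s $ i * fst (snd (p s)) $ j * snd (snd (p s)) $ k)"
      using assms by (intro sum.mono_neutral_left) (auto simp: a_def)
    finally show ?thesis .
  qed
  then show ?thesis
    by (intro exI[of _ a] exI[of _ "\<lambda>s. fst (snd (p s))"] exI[of _ "\<lambda>s. snd (snd (p s))"] allI)
qed

section \<open>Coordinates and explicit decomposition of the Coppersmith-Winograd tensor\<close>

lemma UNIV_3': "UNIV = {0, 1, 2 :: 3}"
  using UNIV_3 by auto

lemma distinct_3: "(0::3) \<noteq> 1" "(0::3) \<noteq> 2" "(1::3) \<noteq> 0" "(2::3) \<noteq> 0" "(1::3) \<noteq> 2" "(2::3) \<noteq> 1"
  by simp_all

lemma sum_3': "(\<Sum>i\<in>UNIV. f i) = f (0::3) + f 1 + (f 2 :: complex)"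
proof -
  have "(3::3) = 0" by simp
  then have "(\<Sum>i\<in>UNIV. f i) = f 1 + f 2 + f 0" using sum_3[of f] by metis
  then show ?thesis by (simp only: ac_simps)
qed

lemma all_3: "(\<forall>i::3. P i) \<longleftrightarrow> P 0 \<and> P 1 \<and> P 2"
proof -
  have "(3::3) = 0" by simp
  then show ?thesis using forall_3[of P] by metis
qed

lemma small_cw_2_nth:
  "small_cw_2 $ i $ j $ k = of_bool (i = 0 \<and> j = k \<and> j \<noteq> 0 \<or> j = 0 \<and> i = k \<and> i \<noteq> 0 \<or> k = 0 \<and> i = j \<and> i \<noteq> 0)"
proof -
  have "UNIV - {0} = {1, 2 :: 3}" using UNIV_3' distinct_3 by auto
  then have "\<forall>i j k. small_cw_2 $ i $ j $ k = of_bool (i = 0 \<and> j = k \<and> j \<noteq> 0 \<or> j = 0 \<and> i = k \<and> i \<noteq> 0 \<or> k = 0 \<and> i = j \<and> i \<noteq> 0)"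
    unfolding all_3 by (simp add: small_cw_def outer_def axis_def distinct_3)
  then show ?thesis by blast
qed

text \<open>The last two rows are the factors of \<open>x\<^sub>1\<^sup>2 + x\<^sub>2\<^sup>2 = (x\<^sub>1 + \<i> x\<^sub>2) (x\<^sub>1 - \<i> x\<^sub>2)\<close>.\<close>

definition basis_change :: "nat \<Rightarrow> 3 \<Rightarrow> complex" where
  "basis_change a p = (if p = 0 then of_bool (a = 0) else if p = 1 then [0, 1/2, 1] ! a else [0, -\<i>/2, \<i>] ! a)"

lemma basis_change_small_cw:
  assumes "a < 3" "b < 3" "c < 3"
  shows "(\<Sum>p\<in>UNIV. \<Sum>q\<in>UNIV. \<Sum>r\<in>UNIV. basis_change a p * basis_change b q * basis_change c r * small_cw_2 $ p $ q $ r)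
    = of_bool (distinct [a, b, c])"
proof -
  have "a \<in> {0, 1, 2}" "b \<in> {0, 1, 2}" "c \<in> {0, 1, 2}" using assms by auto
  then show ?thesis
    unfolding sum_3' small_cw_2_nth insert_iff empty_iff
    by (elim disjE) (simp_all add: distinct_3 basis_change_def)
qed

lemma sum_pair_product:
  "(\<Sum>p\<in>UNIV. f (fst p) * g (snd p)) = (\<Sum>i\<in>UNIV. f i) * (\<Sum>j\<in>UNIV. g j)"
  for f :: "'a::finite \<Rightarrow> complex" and g :: "'b::finite \<Rightarrow> complex"
  by (simp add: sum_product sum.cartesian_product case_prod_unfold flip: UNIV_Times_UNIV)

lemma sum_pair_product3:
  fixes f :: "'a::finite \<Rightarrow> 'b::finite \<Rightarrow> 'c::finite \<Rightarrow> complex" and g :: "'d::finite \<Rightarrow> 'e::finite \<Rightarrow> 'f::finite \<Rightarrow> complex"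
  shows "(\<Sum>p\<in>UNIV. \<Sum>q\<in>UNIV. \<Sum>r\<in>UNIV. f (fst p) (fst q) (fst r) * g (snd p) (snd q) (snd r))
    = (\<Sum>i\<in>UNIV. \<Sum>j\<in>UNIV. \<Sum>k\<in>UNIV. f i j k) * (\<Sum>i\<in>UNIV. \<Sum>j\<in>UNIV. \<Sum>k\<in>UNIV. g i j k)"
proof -
  have "(\<Sum>r\<in>UNIV. f (fst p) (fst q) (fst r) * g (snd p) (snd q) (snd r))
    = (\<Sum>k\<in>UNIV. f (fst p) (fst q) k) * (\<Sum>k\<in>UNIV. g (snd p) (snd q) k)" for p q
    by (rule sum_pair_product)
  moreover have "(\<Sum>q\<in>UNIV. (\<Sum>k\<in>UNIV. f (fst p) (fst q) k) * (\<Sum>k\<in>UNIV. g (snd p) (snd q) k))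
    = (\<Sum>j\<in>UNIV. \<Sum>k\<in>UNIV. f (fst p) j k) * (\<Sum>j\<in>UNIV. \<Sum>k\<in>UNIV. g (snd p) j k)" for p
    by (rule sum_pair_product)
  moreover have "(\<Sum>p\<in>UNIV. (\<Sum>j\<in>UNIV. \<Sum>k\<in>UNIV. f (fst p) j k) * (\<Sum>j\<in>UNIV. \<Sum>k\<in>UNIV. g (snd p) j k))
    = (\<Sum>i\<in>UNIV. \<Sum>j\<in>UNIV. \<Sum>k\<in>UNIV. f i j k) * (\<Sum>i\<in>UNIV. \<Sum>j\<in>UNIV. \<Sum>k\<in>UNIV. g i j k)"
    by (rule sum_pair_product)
  ultimately show ?thesis by simp
qed

definition position_form :: "nat \<Rightarrow> 3 \<times> 3 \<Rightarrow> complex" where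
  "position_form i p = basis_change (i div 3) (fst p) * basis_change (i mod 3) (snd p)"

lemma position_form_kronecker:
  assumes "i < 9" "j < 9" "k < 9"
  shows "(\<Sum>p\<in>UNIV. \<Sum>q\<in>UNIV. \<Sum>r\<in>UNIV. position_form i p * position_form j q * position_form k r
      * kronecker small_cw_2 small_cw_2 $ p $ q $ r) = perm3 i j k"
proof -
  have "(\<Sum>p\<in>UNIV. \<Sum>q\<in>UNIV. \<Sum>r\<in>UNIV. position_form i p * position_form j q * position_form k r
      * kronecker small_cw_2 small_cw_2 $ p $ q $ r)
    = (\<Sum>p\<in>UNIV. \<Sum>q\<in>UNIV. \<Sum>r\<in>UNIV.
        (basis_change (i div 3) (fst p) * basis_change (j div 3) (fst q) * basis_change (k div 3) (fst r) * small_cw_2 $ fst p $ fst q $ fst r)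
      * (basis_change (i mod 3) (snd p) * basis_change (j mod 3) (snd q) * basis_change (k mod 3) (snd r) * small_cw_2 $ snd p $ snd q $ snd r))"
    by (intro sum.cong refl) (simp add: position_form_def kronecker_def)
  also have "\<dots> = of_bool (distinct [i div 3, j div 3, k div 3]) * of_bool (distinct [i mod 3, j mod 3, k mod 3])"
    using assms by (subst sum_pair_product3, subst (1 2) basis_change_small_cw) auto
  also have "\<dots> = perm3 i j k" using assms by (auto simp: perm3_def transversal_def)
  finally show ?thesis .
qed

text \<open>The vector \<open>x0 + e1 x1 + e2 x2\<close> with \<open>x0 = (1, 0, 0)\<close>,
  \<open>x1 = (0, 1, \<i>)\<close> and \<open>x2 = (0, 1/2, -\<i>/2)\<close>, in which the tensor is
  the sum over all orderings of \<open>x0\<close>, \<open>x1\<close>, \<open>x2\<close>. Weighting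
  its cube by \<open>e1 e2 / 4\<close> keeps exactly the monomials of odd degree in both
  \<open>x1\<close> and \<open>x2\<close>.\<close>

definition sign_vector :: "complex \<times> complex \<Rightarrow> (complex, 3) vec" where
  "sign_vector e = (\<chi> i. if i = 0 then 1 else if i = 1 then fst e + snd e / 2 else \<i> * (fst e - snd e / 2))"

abbreviation signs :: "(complex \<times> complex) set" where "signs \<equiv> {1, -1} \<times> {1, -1}"

lemma small_cw_signs:
  "small_cw_2 $ i $ j $ k = (\<Sum>e\<in>signs. fst e * snd e / 4 * sign_vector e $ i * sign_vector e $ j * sign_vector e $ k)"
proof -
  have signs: "signs = {(1, 1), (1, -1), (-1, 1), (-1, -1)}" by auto
  have "\<forall>i j k. small_cw_2 $ i $ j $ k = (\<Sum>e\<in>signs. fst e * snd e / 4 * sign_vector e $ i * sign_vector e $ j * sign_vector e $ k)"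
    unfolding all_3 small_cw_2_nth signs
    by (simp add: sign_vector_def distinct_3 field_simps)
  then show ?thesis by blast
qed

lemma tensor_rank_kronecker_le: "tensor_rank (kronecker small_cw_2 small_cw_2) \<le> 16"
proof -
  define c where "c = (\<lambda>e :: complex \<times> complex. fst e * snd e / 4)"
  define v where "v = (\<lambda>e d. \<chi> p. sign_vector e $ fst p * sign_vector d $ snd p)"
  define g where "g = (\<lambda>(e, d). outer (\<chi> p. c e * c d * v e d $ p) (v e d) (v e d))"
  \<comment> \<open>The entry 1 at \<open>(0, 0)\<close> certifies below that the vectors are
    nonzero, as \<open>rank_one\<close> demands.\<close>
  have v0: "v e d $ (0, 0) = 1" for e d by (simp add: v_def sign_vector_def)
  have c0: "c e \<noteq> 0" if "e \<in> signs" for e using that by (auto simp: c_def)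
  have "rank_one (g p)" if "p \<in> signs \<times> signs" for p
  proof -
    have "v e d \<noteq> 0" for e d
    proof
      assume "v e d = 0"
      then show False using v0[of e d] by simp
    qed
    moreover have "(\<chi> q. c (fst p) * c (snd p) * v (fst p) (snd p) $ q) \<noteq> 0"
    proof
      assume "(\<chi> q. c (fst p) * c (snd p) * v (fst p) (snd p) $ q) = 0"
      then have "(\<chi> q. c (fst p) * c (snd p) * v (fst p) (snd p) $ q) $ (0, 0) = 0" by simp
      then have "c (fst p) = 0 \<or> c (snd p) = 0" by (simp add: v0)
      moreover have "fst p \<in> signs" "snd p \<in> signs" using that by (metis mem_Times_iff)+
      ultimately show False using c0 by metis
    qed
    ultimately show ?thesis unfolding rank_one_def g_def case_prod_unfold by blast
  qed
  from tensor_rank_le_card[of "signs \<times> signs" g, OF _ this]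
  have "tensor_rank (\<Sum>p\<in>signs \<times> signs. g p) \<le> 16" by (simp add: card_cartesian_product)
  also have "(\<Sum>p\<in>signs \<times> signs. g p) = kronecker small_cw_2 small_cw_2"
  proof -
    have "(\<Sum>p\<in>signs \<times> signs. g p) $ i $ j $ k = kronecker small_cw_2 small_cw_2 $ i $ j $ k" for i j k
    proof -
      have "kronecker small_cw_2 small_cw_2 $ i $ j $ k
        = (\<Sum>p\<in>signs \<times> signs. (c (fst p) * sign_vector (fst p) $ fst i * sign_vector (fst p) $ fst j * sign_vector (fst p) $ fst k)
          * (c (snd p) * sign_vector (snd p) $ snd i * sign_vector (snd p) $ snd j * sign_vector (snd p) $ snd k))"
        unfolding kronecker_def vec_lambda_beta small_cw_signs sum_product sum.cartesian_product c_def case_prod_unfold ..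
      also have "\<dots> = (\<Sum>p\<in>signs \<times> signs. g p $ i $ j $ k)"
        by (intro sum.cong refl) (simp add: g_def v_def outer_def case_prod_unfold ac_simps)
      finally show ?thesis by (simp add: sum_component)
    qed
    then show ?thesis by (simp add: vec_eq_iff)
  qed
  finally show ?thesis .
qed

section \<open>The lower bound in coordinates\<close>

lemma sum_swap3:
  "(\<Sum>s\<in>S. \<Sum>p\<in>P. \<Sum>q\<in>Q. \<Sum>r\<in>R. f s p q r) = (\<Sum>p\<in>P. \<Sum>q\<in>Q. \<Sum>r\<in>R. \<Sum>s\<in>S. f s p q r)"
proof -
  have "(\<Sum>s\<in>S. \<Sum>p\<in>P. \<Sum>q\<in>Q. \<Sum>r\<in>R. f s p q r) = (\<Sum>p\<in>P. \<Sum>s\<in>S. \<Sum>q\<in>Q. \<Sum>r\<in>R. f s p q r)"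
    by (rule sum.swap)
  also have "\<dots> = (\<Sum>p\<in>P. \<Sum>q\<in>Q. \<Sum>s\<in>S. \<Sum>r\<in>R. f s p q r)"
    by (rule sum.cong[OF refl]) (rule sum.swap)
  also have "\<dots> = (\<Sum>p\<in>P. \<Sum>q\<in>Q. \<Sum>r\<in>R. \<Sum>s\<in>S. f s p q r)"
    by (rule sum.cong[OF refl], rule sum.cong[OF refl]) (rule sum.swap)
  finally show ?thesis .
qed

lemma product_of_sums:
  "(\<Sum>x\<in>X. f x) * (\<Sum>y\<in>Y. g y) * (\<Sum>z\<in>Z. h z) = (\<Sum>x\<in>X. \<Sum>y\<in>Y. \<Sum>z\<in>Z. f x * g y * h z)"
  for f g h :: "_ \<Rightarrow> complex"
  by (simp only: sum_distrib_left[symmetric] sum_distrib_right[symmetric])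

text \<open>The linear change \<open>position_form\<close> acts on each vector of each term, so the
  number of terms is kept, and by continuity the limit is carried to \<open>perm3\<close>.\<close>

lemma limit_coordinates:
  assumes S: "S \<longlonglongrightarrow> kronecker small_cw_2 small_cw_2" and rank: "\<And>n. tensor_rank (S n) \<le> m"
  shows "\<exists>a b c. \<forall>i<9. \<forall>j<9. \<forall>k<9. (\<lambda>n. \<Sum>s<m. a n s i * b n s j * c n s k) \<longlonglongrightarrow> perm3 i j k"
proof -
  have "\<forall>n. \<exists>p. \<forall>i j k. S n $ i $ j $ k = (\<Sum>s<m. fst p s $ i * fst (snd p) s $ j * snd (snd p) s $ k)"
  proof
    fix n
    from tensor_rank_coordinates[OF rank[of n]] obtain a b c where
      "\<forall>i j k. S n $ i $ j $ k = (\<Sum>s<m. a s $ i * b s $ j * c s $ k)" by (elim exE)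
    then show "\<exists>p. \<forall>i j k. S n $ i $ j $ k = (\<Sum>s<m. fst p s $ i * fst (snd p) s $ j * snd (snd p) s $ k)"
      by (intro exI[of _ "(a, b, c)"]) simp
  qed
  from choice[OF this] obtain p where
    p: "\<forall>n. \<forall>i j k. S n $ i $ j $ k = (\<Sum>s<m. fst (p n) s $ i * fst (snd (p n)) s $ j * snd (snd (p n)) s $ k)" ..
  define A where "A = (\<lambda>n s i. \<Sum>x\<in>UNIV. position_form i x * fst (p n) s $ x)"
  define B where "B = (\<lambda>n s i. \<Sum>x\<in>UNIV. position_form i x * fst (snd (p n)) s $ x)"
  define C where "C = (\<lambda>n s i. \<Sum>x\<in>UNIV. position_form i x * snd (snd (p n)) s $ x)"
  have "(\<lambda>n. \<Sum>s<m. A n s i * B n s j * C n s k) \<longlonglongrightarrow> perm3 i j k" if ijk: "i < 9" "j < 9" "k < 9" for i j k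
  proof -
    have "(\<Sum>s<m. A n s i * B n s j * C n s k)
      = (\<Sum>x\<in>UNIV. \<Sum>y\<in>UNIV. \<Sum>z\<in>UNIV. position_form i x * position_form j y * position_form k z * S n $ x $ y $ z)" for n
    proof -
      have "A n s i * B n s j * C n s k = (\<Sum>x\<in>UNIV. \<Sum>y\<in>UNIV. \<Sum>z\<in>UNIV. position_form i x * position_form j y * position_form k z
        * (fst (p n) s $ x * fst (snd (p n)) s $ y * snd (snd (p n)) s $ z))" for s
        unfolding A_def B_def C_def product_of_sums by (intro sum.cong refl) (simp add: ac_simps)
      then have "(\<Sum>s<m. A n s i * B n s j * C n s k) = (\<Sum>s<m. \<Sum>x\<in>UNIV. \<Sum>y\<in>UNIV. \<Sum>z\<in>UNIV. position_form i x * position_form j y * position_form k z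
        * (fst (p n) s $ x * fst (snd (p n)) s $ y * snd (snd (p n)) s $ z))" by simp
      also have "\<dots> = (\<Sum>x\<in>UNIV. \<Sum>y\<in>UNIV. \<Sum>z\<in>UNIV. \<Sum>s<m. position_form i x * position_form j y * position_form k z
        * (fst (p n) s $ x * fst (snd (p n)) s $ y * snd (snd (p n)) s $ z))" by (rule sum_swap3)
      finally show ?thesis by (simp only: p[rule_format] sum_distrib_left)
    qed
    moreover have "(\<lambda>n. \<Sum>x\<in>UNIV. \<Sum>y\<in>UNIV. \<Sum>z\<in>UNIV. position_form i x * position_form j y * position_form k z * S n $ x $ y $ z)
      \<longlonglongrightarrow> (\<Sum>x\<in>UNIV. \<Sum>y\<in>UNIV. \<Sum>z\<in>UNIV. position_form i x * position_form j y * position_form k z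
        * kronecker small_cw_2 small_cw_2 $ x $ y $ z)"
      by (intro tendsto_sum tendsto_mult tendsto_const tendsto_vec_nth S)
    ultimately show ?thesis by (simp only: position_form_kronecker[OF ijk])
  qed
  then have fin: "\<forall>i<9. \<forall>j<9. \<forall>k<9. (\<lambda>n. \<Sum>s<m. A n s i * B n s j * C n s k) \<longlonglongrightarrow> perm3 i j k" by simp
  show ?thesis by (rule exI[of _ A], rule exI[of _ B], rule exI[of _ C], rule fin)
qed

theorem theorem1p1:
  shows "border_rank (kronecker small_cw_2 small_cw_2) = 16"
proof -
  let ?K = "kronecker small_cw_2 small_cw_2"
  define P where "P = (\<lambda>r. \<exists>S. (\<forall>n. tensor_rank (S n) \<le> r) \<and> S \<longlonglongrightarrow> ?K)"
  have P16: "P 16"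
    unfolding P_def
  proof (intro exI conjI allI)
    show "tensor_rank ?K \<le> 16" by (rule tensor_rank_kronecker_le)
    show "(\<lambda>_. ?K) \<longlonglongrightarrow> ?K" by (rule tendsto_const)
  qed
  have "\<not> P r" if "r \<le> 15" for r
  proof
    assume "P r"
    then obtain S where S: "\<And>n. tensor_rank (S n) \<le> r" "S \<longlonglongrightarrow> ?K" unfolding P_def by auto
    have "tensor_rank (S n) \<le> 15" for n using S(1)[of n] that by simp
    from limit_coordinates[OF S(2) this] obtain a b c :: "nat \<Rightarrow> nat \<Rightarrow> nat \<Rightarrow> complex" where
      abc: "\<forall>i<9. \<forall>j<9. \<forall>k<9. (\<lambda>n. \<Sum>s<15. a n s i * b n s j * c n s k) \<longlonglongrightarrow> perm3 i j k"
      by (elim exE)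
    show False by (rule no_approx15[of a b c]) (use abc in simp)
  qed
  then have "(LEAST r. P r) = 16"
    using P16 by (intro Least_equality) (auto simp: not_less_eq_eq[symmetric] intro: ccontr)
  then show ?thesis unfolding border_rank_def P_def .
qed

end
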